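(* A finite-length $\mathcal A$-Hilbert complex $(\mathscr E,t)$ is $\mathcal A$-Fredholm if and only if its even Dirac operator $\mathcal D^+_t$ is $\mathcal A$-Fredholm.
   Context: $\mathcal A$ is a fixed complex C*-algebra. Hilbert $\mathcal A$-modules are right Hilbert C*-modules over $\mathcal A$; $\oplus$ is the orthogonal direct sum; $\mathcal L_{\mathcal A}(\mathscr E,\mathscr F)$ is the space of adjointable operators. The compact operators $\mathcal K_{\mathcal A}(\mathscr E,\mathscr F)$ are the norm closure of the span of $\theta_{x,y}(z)=x\langle y\mid z\rangle$, $x\in\mathscr F$, $y\in\mathscr E$; $\mathcal K_{\mathcal A}(\mathscr E)=\mathcal K_{\mathcal A}(\mathscr E,\mathscr E)$. A densely defined $\mathcal A$-linear operator $t\colon \mathrm{dom}(t)\subset \mathscr E\to\mathscr F$ is semi-regular if its adjoint $t^*$ is densely defined; a semi-regular $t$ is regular if it is closed and $1+t^*t$ has dense range. $\mathcal R_{\mathcal A}(\mathscr E,\mathscr F)$ denotes the set of regular operators. An $\mathcal A$-Hilbert complex $(\mathscr E,t)$ is a sequence of regular operators $t_k\in\mathcal R_{\mathcal A}(\mathscr E_k,\mathscr E_{k+1})$, $k\in\mathbb Z$, between Hilbert $\mathcal A$-modules, with $\mathrm{ran}(t_k)\subset\ker(t_{k+1})$ for all $k$. It has finite length if $\mathscr E_k=0$ for $|k|$ large; it is then indexed so that $\mathscr E_k=0$ unless $0\le k\le N+1$, written $\{t_k\}_{k=0}^N$, and $t_k=0$ (everywhere defined) for $k<0$ or $k>N$.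 A joint parametrix of a finite-length complex $\{t_k\}_{k=0}^N$ is a collection $P_{l,k},P_{r,k}\in\mathcal L_{\mathcal A}(\mathscr E_{k+1},\mathscr E_k)$, $0\le k\le N$ (zero for $k<0$ or $k>N$), for which there are $C_k\in\mathcal K_{\mathcal A}(\mathscr E_k)$, $0\le k\le N+1$, with $P_{r,k-1}(\mathrm{dom}(t_k))\subset\mathrm{dom}(t_{k-1})$ and $P_{l,k}t_k+t_{k-1}P_{r,k-1}=1_{\mathscr E_k}-C_k$ on $\mathrm{dom}(t_k)$ for all $0\le k\le N+1$. A finite-length complex is $\mathcal A$-Fredholm if it has a joint parametrix. A regular operator $t\in\mathcal R_{\mathcal A}(\mathscr E,\mathscr F)$ is $\mathcal A$-Fredholm if it is so as a complex of length one $0\to\mathscr E\xrightarrow{t}\mathscr F\to0$, i.e. there are $P_l,P_r\in\mathcal L_{\mathcal A}(\mathscr F,\mathscr E)$ and compact $C_l,C_r$ with $\mathrm{ran}(P_r)\subset\mathrm{dom}(t)$, $P_lt=1-C_l$ on $\mathrm{dom}(t)$ and $tP_r=1-C_r$. Put $\mathscr E_{\mathrm{ev}}=\bigoplus_k\mathscr E_{2k}$, $\mathscr E_{\mathrm{odd}}=\bigoplus_k\mathscr E_{2k+1}$. The even Dirac operator $\mathcal D^+_t\colon\mathrm{dom}(\mathcal D^+_t)\subset\mathscr E_{\mathrm{ev}}\to\mathscr E_{\mathrm{odd}}$ has domain $\bigoplus_k \mathrm{dom}(t_{2k})\cap\mathrm{dom}(t_{2k-1}^* )$ and is given by $\mathcal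 D^+_t(x_{2k})_k=(t_{2k}x_{2k}+t_{2k+1}^*x_{2k+2})_k$; it is a regular operator. *)

theory Defs
  imports "HOL-Analysis.Analysis" "HOL-Library.Function_Algebras"
begin

class complex_vector = ab_group_add +
  fixes scaleC :: "complex \<Rightarrow> 'a \<Rightarrow> 'a"  (infixr "*\<^sub>C" 75)
  assumes scaleC_add_right: "c *\<^sub>C (x + y) = c *\<^sub>C x + c *\<^sub>C y"
    and scaleC_add_left: "(c + d) *\<^sub>C x = c *\<^sub>C x + d *\<^sub>C x"
    and scaleC_scaleC: "c *\<^sub>C (d *\<^sub>C x) = (c * d) *\<^sub>C x"
    and scaleC_one: "1 *\<^sub>C x = x"

instantiation "fun" :: (type, complex_vector) complex_vector
begin

definition scaleC_fun_def: "c *\<^sub>C f = (\<lambda>i. c *\<^sub>C f i)"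

instance
  by standard
    (simp_all add: scaleC_fun_def plus_fun_def scaleC_add_right scaleC_add_left
      scaleC_scaleC scaleC_one)

end

text \<open>The algebra need not be unital.\<close>

class cstar_algebra = complex_vector + real_normed_algebra + banach +
  fixes star :: "'a \<Rightarrow> 'a"
  assumes scaleR_eq_scaleC: "r *\<^sub>R a = complex_of_real r *\<^sub>C a"
    and norm_scaleC: "norm (c *\<^sub>C a) = cmod c * norm a"
    and scaleC_mult_left: "(c *\<^sub>C a) * b = c *\<^sub>C (a * b)"
    and scaleC_mult_right: "a * (c *\<^sub>C b) = c *\<^sub>C (a * b)"
    and star_star: "star (star a) = a"
    and star_add: "star (a + b) = star a + star b"
    and star_scaleC: "star (c *\<^sub>C a) = cnj c *\<^sub>C star a"
    and star_mult: "star (a * b) = star b * star a"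
    and cstar_identity: "norm (star a * a) = (norm a)\<^sup>2"

definition cstar_pos :: "'a::cstar_algebra \<Rightarrow> bool"
  where "cstar_pos a \<longleftrightarrow> (\<exists>b. a = star b * b)"

text \<open>
  A family of Hilbert modules has to live in a single type. Each module therefore consists of
  a linear subspace of an ambient complex vector space, with its own right action of the
  algebra and its own inner product, which need not extend to the ambient space.
  There is no loss of generality, since a family of vector spaces embeds into its direct sum.
  The inner product is linear in the second variable.
\<close>

record ('a, 'e) hmodule =
  mcarrier :: "'e set"
  mact :: "'e \<Rightarrow> 'a \<Rightarrow> 'e"
  minner :: "'e \<Rightarrow> 'e \<Rightarrow> 'a"

definition mnorm :: "('a::cstar_algebra, 'e) hmodule \<Rightarrow> 'e \<Rightarrow> real"
  where "mnorm E x = sqrt (norm (minner E x x))"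

definition mtendsto :: "('a::cstar_algebra, 'e::complex_vector) hmodule \<Rightarrow> (nat \<Rightarrow> 'e) \<Rightarrow> 'e \<Rightarrow> bool"
  where "mtendsto E X x \<longleftrightarrow> (\<lambda>n. mnorm E (X n - x)) \<longlonglongrightarrow> 0"

definition mCauchy :: "('a::cstar_algebra, 'e::complex_vector) hmodule \<Rightarrow> (nat \<Rightarrow> 'e) \<Rightarrow> bool"
  where "mCauchy E X \<longleftrightarrow> (\<forall>e>0. \<exists>M. \<forall>m\<ge>M. \<forall>n\<ge>M. mnorm E (X m - X n) < e)"

definition mdense :: "('a::cstar_algebra, 'e::complex_vector) hmodule \<Rightarrow> 'e set \<Rightarrow> bool"
  where "mdense E S \<longleftrightarrow> S \<subseteq> mcarrier E \<and> (\<forall>x\<in>mcarrier E. \<forall>e>0. \<exists>y\<in>S. mnorm E (x - y) < e)"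

definition submodule :: "('a::cstar_algebra, 'e::complex_vector) hmodule \<Rightarrow> 'e set \<Rightarrow> bool"
  where "submodule E S \<longleftrightarrow> S \<subseteq> mcarrier E \<and> 0 \<in> S \<and>
    (\<forall>x\<in>S. \<forall>y\<in>S. x + y \<in> S) \<and> (\<forall>c. \<forall>x\<in>S. c *\<^sub>C x \<in> S) \<and>
    (\<forall>x\<in>S. \<forall>a. mact E x a \<in> S)"

locale hilbert_module =
  fixes E :: "('a::cstar_algebra, 'e::complex_vector) hmodule"
  assumes carrier_submodule: "submodule E (mcarrier E)"
    and act_add_left: "\<lbrakk>x \<in> mcarrier E; y \<in> mcarrier E\<rbrakk> \<Longrightarrow> mact E (x + y) a = mact E x a + mact E y a"
    and act_add_right: "x \<in> mcarrier E \<Longrightarrow> mact E x (a + b) = mact E x a + mact E x b"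
    and act_mult: "x \<in> mcarrier E \<Longrightarrow> mact E x (a * b) = mact E (mact E x a) b"
    and act_scaleC_left: "x \<in> mcarrier E \<Longrightarrow> mact E (c *\<^sub>C x) a = c *\<^sub>C mact E x a"
    and act_scaleC_right: "x \<in> mcarrier E \<Longrightarrow> mact E x (c *\<^sub>C a) = c *\<^sub>C mact E x a"
    and inner_add_right: "\<lbrakk>x \<in> mcarrier E; y \<in> mcarrier E; z \<in> mcarrier E\<rbrakk> \<Longrightarrow>
      minner E x (y + z) = minner E x y + minner E x z"
    and inner_scaleC_right: "\<lbrakk>x \<in> mcarrier E; y \<in> mcarrier E\<rbrakk> \<Longrightarrow>
      minner E x (c *\<^sub>C y) = c *\<^sub>C minner E x y"
    and inner_act_right: "\<lbrakk>x \<in> mcarrier E; y \<in> mcarrier E\<rbrakk> \<Longrightarrow>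
      minner E x (mact E y a) = minner E x y * a"
    and star_inner: "\<lbrakk>x \<in> mcarrier E; y \<in> mcarrier E\<rbrakk> \<Longrightarrow> star (minner E x y) = minner E y x"
    and inner_pos: "x \<in> mcarrier E \<Longrightarrow> cstar_pos (minner E x x)"
    and inner_definite: "\<lbrakk>x \<in> mcarrier E; minner E x x = 0\<rbrakk> \<Longrightarrow> x = 0"
    and complete: "\<lbrakk>\<And>n. X n \<in> mcarrier E; mCauchy E X\<rbrakk> \<Longrightarrow> \<exists>x\<in>mcarrier E. mtendsto E X x"

text \<open>The index set \<open>J\<close> has to be finite.\<close>

definition dsum :: "int set \<Rightarrow> (int \<Rightarrow> ('a::cstar_algebra, 'e::complex_vector) hmodule)
    \<Rightarrow> ('a, int \<Rightarrow> 'e) hmodule"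
  where "dsum J E = \<lparr>
    mcarrier = {x. (\<forall>k\<in>J. x k \<in> mcarrier (E k)) \<and> (\<forall>k. k \<notin> J \<longrightarrow> x k = 0)},
    mact = (\<lambda>x a k. if k \<in> J then mact (E k) (x k) a else 0),
    minner = (\<lambda>x y. \<Sum>k\<in>J. minner (E k) (x k) (y k))\<rparr>"

text \<open>Only the values on the carrier of the source module are relevant.\<close>

definition adjointable :: "('a::cstar_algebra, 'e::complex_vector) hmodule
    \<Rightarrow> ('a, 'f::complex_vector) hmodule \<Rightarrow> ('e \<Rightarrow> 'f) \<Rightarrow> bool"
  where "adjointable E F T \<longleftrightarrow> T \<in> mcarrier E \<rightarrow> mcarrier F \<and>
    (\<exists>S. S \<in> mcarrier F \<rightarrow> mcarrier E \<and>
      (\<forall>x\<in>mcarrier E. \<forall>y\<in>mcarrier F. minner F (T x) y = minner E x (S y)))"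

definition theta :: "('a::cstar_algebra, 'e::complex_vector) hmodule
    \<Rightarrow> ('a, 'f::complex_vector) hmodule \<Rightarrow> 'f \<Rightarrow> 'e \<Rightarrow> 'e \<Rightarrow> 'f"
  where "theta E F x y = (\<lambda>z. mact F x (minner E y z))"

inductive_set theta_span :: "('a::cstar_algebra, 'e::complex_vector) hmodule
    \<Rightarrow> ('a, 'f::complex_vector) hmodule \<Rightarrow> ('e \<Rightarrow> 'f) set"
  for E F where
    theta_span_zero: "0 \<in> theta_span E F"
  | theta_span_theta: "\<lbrakk>x \<in> mcarrier F; y \<in> mcarrier E\<rbrakk> \<Longrightarrow> theta E F x y \<in> theta_span E F"
  | theta_span_add: "\<lbrakk>S \<in> theta_span E F; T \<in> theta_span E F\<rbrakk> \<Longrightarrow> S + T \<in> theta_span E F"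
  | theta_span_scaleC: "S \<in> theta_span E F \<Longrightarrow> c *\<^sub>C S \<in> theta_span E F"

text \<open>The bound below says that the operator norm of \<open>K - S\<close> is at most \<open>e\<close>.\<close>

definition compact_op :: "('a::cstar_algebra, 'e::complex_vector) hmodule
    \<Rightarrow> ('a, 'f::complex_vector) hmodule \<Rightarrow> ('e \<Rightarrow> 'f) \<Rightarrow> bool"
  where "compact_op E F K \<longleftrightarrow> adjointable E F K \<and>
    (\<forall>e>0. \<exists>S\<in>theta_span E F. \<forall>z\<in>mcarrier E. mnorm F (K z - S z) \<le> e * mnorm E z)"

text \<open>
  An unbounded operator is a domain together with a function; only the values of the function
  on the domain are relevant.
\<close>

record ('e, 'f) unbounded_op =
  opdom :: "'e set"
  app :: "'e \<Rightarrow> 'f"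

definition densely_defined_linear :: "('a::cstar_algebra, 'e::complex_vector) hmodule
    \<Rightarrow> ('a, 'f::complex_vector) hmodule \<Rightarrow> ('e, 'f) unbounded_op \<Rightarrow> bool"
  where "densely_defined_linear E F t \<longleftrightarrow>
    submodule E (opdom t) \<and> mdense E (opdom t) \<and> app t \<in> opdom t \<rightarrow> mcarrier F \<and>
    (\<forall>x\<in>opdom t. \<forall>y\<in>opdom t. app t (x + y) = app t x + app t y) \<and>
    (\<forall>c. \<forall>x\<in>opdom t. app t (c *\<^sub>C x) = c *\<^sub>C app t x) \<and>
    (\<forall>x\<in>opdom t. \<forall>a. app t (mact E x a) = mact F (app t x) a)"

text \<open>For densely defined \<open>t\<close> the vector \<open>z\<close> in the definition of the adjoint is unique.\<close>

definition adjoint_op :: "('a::cstar_algebra, 'e::complex_vector) hmodule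
    \<Rightarrow> ('a, 'f::complex_vector) hmodule \<Rightarrow> ('e, 'f) unbounded_op \<Rightarrow> ('f, 'e) unbounded_op"
  where "adjoint_op E F t = \<lparr>
    opdom = {y \<in> mcarrier F. \<exists>z\<in>mcarrier E. \<forall>x\<in>opdom t. minner F (app t x) y = minner E x z},
    app = (\<lambda>y. THE z. z \<in> mcarrier E \<and> (\<forall>x\<in>opdom t. minner F (app t x) y = minner E x z))\<rparr>"

definition semiregular :: "('a::cstar_algebra, 'e::complex_vector) hmodule
    \<Rightarrow> ('a, 'f::complex_vector) hmodule \<Rightarrow> ('e, 'f) unbounded_op \<Rightarrow> bool"
  where "semiregular E F t \<longleftrightarrow>
    densely_defined_linear E F t \<and> mdense F (opdom (adjoint_op E F t))"

definition closed_op :: "('a::cstar_algebra, 'e::complex_vector) hmodule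
    \<Rightarrow> ('a, 'f::complex_vector) hmodule \<Rightarrow> ('e, 'f) unbounded_op \<Rightarrow> bool"
  where "closed_op E F t \<longleftrightarrow>
    (\<forall>X x y. (\<forall>n. X n \<in> opdom t) \<and> x \<in> mcarrier E \<and> y \<in> mcarrier F \<and>
      mtendsto E X x \<and> mtendsto F (\<lambda>n. app t (X n)) y \<longrightarrow> x \<in> opdom t \<and> app t x = y)"

definition regular :: "('a::cstar_algebra, 'e::complex_vector) hmodule
    \<Rightarrow> ('a, 'f::complex_vector) hmodule \<Rightarrow> ('e, 'f) unbounded_op \<Rightarrow> bool"
  where "regular E F t \<longleftrightarrow> semiregular E F t \<and> closed_op E F t \<and>
    mdense E {x + app (adjoint_op E F t) (app t x) | x.
      x \<in> opdom t \<and> app t x \<in> opdom (adjoint_op E F t)}"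

definition fredholm_op :: "('a::cstar_algebra, 'e::complex_vector) hmodule
    \<Rightarrow> ('a, 'f::complex_vector) hmodule \<Rightarrow> ('e, 'f) unbounded_op \<Rightarrow> bool"
  where "fredholm_op E F t \<longleftrightarrow> regular E F t \<and>
    (\<exists>Pl Pr Cl Cr. adjointable F E Pl \<and> adjointable F E Pr \<and>
      compact_op E E Cl \<and> compact_op F F Cr \<and>
      (\<forall>x\<in>opdom t. Pl (app t x) = x - Cl x) \<and>
      (\<forall>y\<in>mcarrier F. Pr y \<in> opdom t \<and> app t (Pr y) = y - Cr y))"

definition hilbert_complex :: "(int \<Rightarrow> ('a::cstar_algebra, 'e::complex_vector) hmodule)
    \<Rightarrow> (int \<Rightarrow> ('e, 'e) unbounded_op) \<Rightarrow> bool"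
  where "hilbert_complex E t \<longleftrightarrow> (\<forall>k. hilbert_module (E k)) \<and>
    (\<forall>k. regular (E k) (E (k + 1)) (t k)) \<and>
    (\<forall>k. \<forall>x\<in>opdom (t k). app (t k) x \<in> opdom (t (k + 1)) \<and> app (t (k + 1)) (app (t k) x) = 0)"

definition finite_length_complex :: "nat \<Rightarrow> (int \<Rightarrow> ('a::cstar_algebra, 'e::complex_vector) hmodule)
    \<Rightarrow> (int \<Rightarrow> ('e, 'e) unbounded_op) \<Rightarrow> bool"
  where "finite_length_complex N E t \<longleftrightarrow> hilbert_complex E t \<and>
    (\<forall>k. k \<notin> {0..int N + 1} \<longrightarrow> mcarrier (E k) = {0}) \<and>
    (\<forall>k. k \<notin> {0..int N} \<longrightarrow> opdom (t k) = mcarrier (E k) \<and> (\<forall>x\<in>mcarrier (E k). app (t k) x = 0))"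

definition joint_parametrix :: "nat \<Rightarrow> (int \<Rightarrow> ('a::cstar_algebra, 'e::complex_vector) hmodule)
    \<Rightarrow> (int \<Rightarrow> ('e, 'e) unbounded_op) \<Rightarrow> (int \<Rightarrow> 'e \<Rightarrow> 'e) \<Rightarrow> (int \<Rightarrow> 'e \<Rightarrow> 'e) \<Rightarrow> bool"
  where "joint_parametrix N E t Pl Pr \<longleftrightarrow>
    (\<forall>k\<in>{0..int N}. adjointable (E (k + 1)) (E k) (Pl k) \<and> adjointable (E (k + 1)) (E k) (Pr k)) \<and>
    (\<forall>k. k \<notin> {0..int N} \<longrightarrow> (\<forall>x\<in>mcarrier (E (k + 1)). Pl k x = 0 \<and> Pr k x = 0)) \<and>
    (\<exists>C. \<forall>k\<in>{0..int N + 1}. compact_op (E k) (E k) (C k) \<and>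
      (\<forall>x\<in>opdom (t k). Pr (k - 1) x \<in> opdom (t (k - 1)) \<and>
        Pl k (app (t k) x) + app (t (k - 1)) (Pr (k - 1) x) = x - C k x))"

definition fredholm_complex :: "nat \<Rightarrow> (int \<Rightarrow> ('a::cstar_algebra, 'e::complex_vector) hmodule)
    \<Rightarrow> (int \<Rightarrow> ('e, 'e) unbounded_op) \<Rightarrow> bool"
  where "fredholm_complex N E t \<longleftrightarrow> (\<exists>Pl Pr. joint_parametrix N E t Pl Pr)"

text \<open>
  Elements of the even and odd parts are families indexed by the even, respectively odd,
  degrees in \<open>{0..N + 1}\<close>; the summands in all other degrees are zero.
\<close>

definition ev_degrees :: "nat \<Rightarrow> int set"
  where "ev_degrees N = {k \<in> {0..int N + 1}. even k}"

definition odd_degrees :: "nat \<Rightarrow> int set"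
  where "odd_degrees N = {k \<in> {0..int N + 1}. odd k}"

definition even_part :: "nat \<Rightarrow> (int \<Rightarrow> ('a::cstar_algebra, 'e::complex_vector) hmodule)
    \<Rightarrow> ('a, int \<Rightarrow> 'e) hmodule"
  where "even_part N E = dsum (ev_degrees N) E"

definition odd_part :: "nat \<Rightarrow> (int \<Rightarrow> ('a::cstar_algebra, 'e::complex_vector) hmodule)
    \<Rightarrow> ('a, int \<Rightarrow> 'e) hmodule"
  where "odd_part N E = dsum (odd_degrees N) E"

definition even_dirac :: "nat \<Rightarrow> (int \<Rightarrow> ('a::cstar_algebra, 'e::complex_vector) hmodule)
    \<Rightarrow> (int \<Rightarrow> ('e, 'e) unbounded_op) \<Rightarrow> (int \<Rightarrow> 'e, int \<Rightarrow> 'e) unbounded_op"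
  where "even_dirac N E t = \<lparr>
    opdom = {x \<in> mcarrier (even_part N E). \<forall>k\<in>ev_degrees N.
      x k \<in> opdom (t k) \<inter> opdom (adjoint_op (E (k - 1)) (E k) (t (k - 1)))},
    app = (\<lambda>x j. if j \<in> odd_degrees N
      then app (t (j - 1)) (x (j - 1)) + app (adjoint_op (E j) (E (j + 1)) (t j)) (x (j + 1))
      else 0)\<rparr>"

end

theory Submission
  imports Defs
begin

text \<open>
  Write \<open>\<Delta>\<^sub>k = t\<^sub>k\<^sup>* t\<^sub>k + t\<^sub>k\<^sub>-\<^sub>1 t\<^sub>k\<^sub>-\<^sub>1\<^sup>*\<close>. Both Fredholm properties are equivalent to the same elliptic
  estimate in every degree: there are a compact \<open>C\<close> and a constant \<open>c\<close> with
  \<open>\<parallel>x\<parallel> \<le> \<parallel>C x\<parallel> + c (\<parallel>t\<^sub>k x\<parallel> + \<parallel>t\<^sub>k\<^sub>-\<^sub>1\<^sup>* x\<parallel>)\<close> on the common domain of \<open>t\<^sub>k\<close> and \<open>t\<^sub>k\<^sub>-\<^sub>1\<^sup>*\<close>.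
  
  A parametrix yields the estimate. Pair \<open>x = C x + P\<^sub>l t x + t P\<^sub>r x\<close> with \<open>x\<close>: the second summand is
  controlled by \<open>\<parallel>t x\<parallel>\<close>, and the third becomes \<open>\<langle>t\<^sup>* x | P\<^sub>r x\<rangle>\<close> (\<open>elliptic_of_parametrix\<close>). A parametrix
  of \<open>D\<^sup>+\<close> is treated alike: its left half gives the even degrees, and its right half gives the odd
  degrees because the odd Dirac operator \<open>D\<^sup>-\<close> is contained in the adjoint of \<open>D\<^sup>+\<close>.
  
  Conversely the estimate makes \<open>\<Delta>\<^sub>k + C\<^sup>* C\<close> bounded below, uniformly along the segment that joins it to
  \<open>\<Delta>\<^sub>k + 1\<close>. The latter is onto, so the method of continuity shows that the former is onto as well
  (\<open>elliptic_surjective\<close>). Its inverse is a self-adjoint Green operator \<open>G\<^sub>k\<close>, and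
  \<open>\<Delta>\<^sub>k G\<^sub>k = 1 - C\<^sup>* C G\<^sub>k\<close> is the identity up to a compact operator. Then \<open>D\<^sup>- G\<close> and \<open>(D\<^sup>+ G)\<^sup>*\<close> are right
  and left parametrices of \<open>D\<^sup>+\<close>, and \<open>(t\<^sub>k G\<^sub>k)\<^sup>*\<close>, \<open>t\<^sub>k\<^sub>-\<^sub>1\<^sup>* G\<^sub>k\<close> form a joint parametrix: the discrepancy in the
  last case is \<open>Z - Z\<^sup>*\<close> for \<open>Z = t\<^sub>k\<^sup>* t\<^sub>k G\<^sub>k\<close>, which is compact because \<open>t\<^sub>k\<^sup>*\<close> and \<open>t\<^sub>k\<^sub>-\<^sub>1\<close> have orthogonal
  ranges (\<open>parametrix_of_elliptic\<close>).
  
  That \<open>D\<^sup>+\<close> is regular rests on the resolvent of \<open>\<Delta>\<^sub>k\<close>. If \<open>B\<close> and \<open>B'\<close> are the inverses of \<open>1 + t\<^sub>k\<^sup>* t\<^sub>k\<close> and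
  \<open>1 + t\<^sub>k\<^sub>-\<^sub>1 t\<^sub>k\<^sub>-\<^sub>1\<^sup>*\<close>, then \<open>B + B' - 1\<close> inverts \<open>1 + \<Delta>\<^sub>k\<close>, again by orthogonality of the two ranges.
  
  The estimates use that the norm is monotone on sums of elements \<open>b\<^sup>* b\<close>. Power
  series in the unitization take the place of spectral theory in the proof of this (\<open>positive_star_mult\<close>).
\<close>

section \<open>The involution\<close>

interpretation cv: vector_space "scaleC :: complex \<Rightarrow> 'a \<Rightarrow> 'a::complex_vector"
  by unfold_locales (simp_all add: scaleC_add_right scaleC_add_left scaleC_scaleC scaleC_one)

lemma star_zero [simp]: "star (0::'a::cstar_algebra) = 0"
  using star_add[of "0::'a" 0] by simp

lemma star_minus: "star (- a) = - star (a::'a::cstar_algebra)"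
  using star_add[of "-a" a] by (simp add: eq_neg_iff_add_eq_0)

lemma star_diff: "star (a - b) = star a - star (b::'a::cstar_algebra)"
  using star_add[of a "-b"] by (simp add: star_minus)

lemma star_scaleR: "star (r *\<^sub>R a) = r *\<^sub>R star (a::'a::cstar_algebra)"
  by (simp add: scaleR_eq_scaleC star_scaleC)

lemma norm_star [simp]: "norm (star a) = norm (a::'a::cstar_algebra)"
proof -
  have le: "norm b \<le> norm (star b)" for b :: 'a
  proof (cases "b = 0")
    case False
    have "norm b * norm b \<le> norm (star b) * norm b"
      using norm_mult_ineq[of "star b" b] cstar_identity[of b] by (simp add: power2_eq_square)
    then show ?thesis using False by simp
  qed simp
  show ?thesis using le[of a] le[of "star a"] by (simp add: star_star)
qed

lemma bounded_linear_star: "bounded_linear (star :: 'a::cstar_algebra \<Rightarrow> 'a)"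
  by (rule bounded_linear_intro[where K = 1]) (simp_all add: star_add star_scaleR)

lemma cstar_identity': "norm (a * star a) = (norm (a::'a::cstar_algebra))\<^sup>2"
  using cstar_identity[of "star a"] by (simp add: star_star)

section \<open>The unitization\<close>

datatype 'a unitization = Unitization (scalar_part: complex) (algebra_part: 'a)

text \<open>
  The operator by which the element \<open>l + a\<close> of the unitization acts on the algebra from the left.
\<close>

definition affine_mult :: "complex \<Rightarrow> 'a::cstar_algebra \<Rightarrow> 'a \<Rightarrow> 'a"
  where "affine_mult l a = (\<lambda>x. l *\<^sub>C x + a * x)"

lemma bounded_linear_affine_mult: "bounded_linear (affine_mult l (a::'a::cstar_algebra))"
  unfolding affine_mult_def
proof (rule bounded_linear_intro[where K = "cmod l + norm a"])
  fix x :: 'a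
  have "norm (l *\<^sub>C x + a * x) \<le> norm (l *\<^sub>C x) + norm (a * x)" by (rule norm_triangle_ineq)
  also have "\<dots> \<le> cmod l * norm x + norm a * norm x"
    using norm_mult_ineq[of a x] by (simp add: norm_scaleC)
  finally show "norm (l *\<^sub>C x + a * x) \<le> norm x * (cmod l + norm a)" by (simp add: algebra_simps)
qed (simp_all add: algebra_simps scaleC_add_right scaleR_eq_scaleC scaleC_scaleC scaleC_mult_right
    mult.commute)

lemma onorm_affine_mult_le: "onorm (affine_mult l (a::'a::cstar_algebra)) \<le> cmod l + norm a"
proof (rule onorm_bound)
  fix x :: 'a
  have "norm (l *\<^sub>C x + a * x) \<le> norm (l *\<^sub>C x) + norm (a * x)" by (rule norm_triangle_ineq)
  also have "\<dots> \<le> cmod l * norm x + norm a * norm x"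
    using norm_mult_ineq[of a x] by (simp add: norm_scaleC)
  finally show "norm (affine_mult l a x) \<le> (cmod l + norm a) * norm x"
    by (simp add: algebra_simps affine_mult_def)
qed simp

text \<open>
  The C*-identity, applied at \<open>star a\<close>, shows that left multiplication loses no norm.
\<close>

lemma onorm_mult_left: "onorm (affine_mult 0 (a::'a::cstar_algebra)) = norm a"
proof (rule antisym)
  show "onorm (affine_mult 0 a) \<le> norm a" using onorm_affine_mult_le[of 0 a] by simp
  have "norm a * norm a = norm (affine_mult 0 a (star a))"
    by (simp add: affine_mult_def cstar_identity' power2_eq_square)
  also have "\<dots> \<le> onorm (affine_mult 0 a) * norm a"
    using onorm[OF bounded_linear_affine_mult, of 0 a "star a"] by simp
  finally show "norm a \<le> onorm (affine_mult 0 a)"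
    by (cases "a = 0") (simp_all add: onorm_pos_le bounded_linear_affine_mult)
qed

text \<open>
  Together with the trivial upper bound this makes the norm of the unitization equivalent to that of a
  product, whence completeness.
\<close>

lemma norm_le_onorm_affine_mult:
  "norm (a::'a::cstar_algebra) \<le> onorm (affine_mult l a) + cmod l"
proof -
  have "norm a = onorm (\<lambda>x. affine_mult l a x + affine_mult (-l) 0 x)"
    by (subst onorm_mult_left[symmetric]) (simp add: affine_mult_def)
  also have "\<dots> \<le> onorm (affine_mult l a) + onorm (affine_mult (-l) (0::'a))"
    by (rule onorm_triangle) (rule bounded_linear_affine_mult)+
  also have "onorm (affine_mult (-l) (0::'a)) \<le> cmod l"
    using onorm_affine_mult_le[of "-l" "0::'a"] by simp
  finally show ?thesis by simp
qed

lemma affine_mult_add: "affine_mult (l + m) (a + b) x = affine_mult l a x + affine_mult m b x"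
  by (simp add: affine_mult_def scaleC_add_left algebra_simps)

lemma affine_mult_scaleC: "affine_mult (c * l) (c *\<^sub>C a) x = c *\<^sub>C affine_mult l a x"
  by (simp add: affine_mult_def scaleC_add_right scaleC_scaleC scaleC_mult_left)

lemma affine_mult_comp: "affine_mult l a (affine_mult m b x) =
  affine_mult (l * m) (l *\<^sub>C b + m *\<^sub>C a + a * b) x"
  by (simp add: affine_mult_def scaleC_add_right scaleC_scaleC scaleC_mult_left scaleC_mult_right
      algebra_simps)

instantiation unitization :: (cstar_algebra) "{ring_1, complex_vector}"
begin
definition "0 = Unitization 0 0"
definition "1 = Unitization 1 0"
definition "x + y = Unitization (scalar_part x + scalar_part y) (algebra_part x + algebra_part y)"
definition "x - y = Unitization (scalar_part x - scalar_part y) (algebra_part x - algebra_part y)"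
definition "- x = Unitization (- scalar_part x) (- algebra_part x)"
definition "x * y = Unitization (scalar_part x * scalar_part y)
   (scalar_part x *\<^sub>C algebra_part y + scalar_part y *\<^sub>C algebra_part x + algebra_part x * algebra_part y)"
definition "c *\<^sub>C x = Unitization (c * scalar_part x) (c *\<^sub>C algebra_part x)"
instance
  by standard
    (auto simp: zero_unitization_def one_unitization_def plus_unitization_def minus_unitization_def
      uminus_unitization_def times_unitization_def scaleC_unitization_def
      scaleC_add_right scaleC_add_left scaleC_scaleC scaleC_mult_left scaleC_mult_right algebra_simps
      scaleC_one)
end

lemmas unitization_simps =
  zero_unitization_def one_unitization_def plus_unitization_def minus_unitization_def
  uminus_unitization_def times_unitization_def scaleC_unitization_def

lemma onorm_affine_mult_scaleC:
  "onorm (affine_mult (c * l) (c *\<^sub>C a)) = cmod c * onorm (affine_mult l (a::'a::cstar_algebra))"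
proof -
  have le: "onorm (affine_mult (c * l) (c *\<^sub>C a)) \<le> cmod c * onorm (affine_mult l a)"
    for c l and a :: 'a
  proof (rule onorm_bound)
    show "0 \<le> cmod c * onorm (affine_mult l a)"
      by (simp add: onorm_pos_le bounded_linear_affine_mult)
    show "norm (affine_mult (c * l) (c *\<^sub>C a) x) \<le> cmod c * onorm (affine_mult l a) * norm x" for x
      unfolding affine_mult_scaleC norm_scaleC mult.assoc
      by (intro mult_left_mono onorm[OF bounded_linear_affine_mult]) simp
  qed
  show ?thesis
  proof (cases "c = 0")
    case True
    then show ?thesis using onorm_mult_left[of "0::'a"] by simp
  next
    case False
    have "cmod c * onorm (affine_mult l a) \<le> cmod c * (cmod (inverse c) * onorm (affine_mult (c * l) (c *\<^sub>C a)))"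
      using le[of "inverse c" "c * l" "c *\<^sub>C a"] False
      by (intro mult_left_mono) (simp_all add: scaleC_scaleC scaleC_one mult.assoc[symmetric])
    also have "\<dots> = onorm (affine_mult (c * l) (c *\<^sub>C a))"
      using False by (simp add: norm_inverse)
    finally show ?thesis using le[of c l a] by simp
  qed
qed

instantiation unitization :: (cstar_algebra) real_vector
begin
definition "r *\<^sub>R x = complex_of_real r *\<^sub>C (x :: 'a unitization)"
instance
  by standard (simp_all add: scaleR_unitization_def scaleC_add_right scaleC_add_left scaleC_scaleC scaleC_one)
end

text \<open>
  The operator norm alone is only a seminorm if the algebra already has a unit \<open>e\<close>: then \<open>1 - e\<close> acts as
  zero. The maximum with the modulus of the scalar part repairs this and keeps the C*-identity.
\<close>

instantiation unitization :: (cstar_algebra) real_normed_algebra_1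
begin
definition "norm x = max (cmod (scalar_part x)) (onorm (affine_mult (scalar_part x) (algebra_part x)))"
definition "dist x y = norm (x - y :: 'a unitization)"
definition "sgn x = inverse (norm x) *\<^sub>R (x :: 'a unitization)"
definition "uniformity = (INF e\<in>{0<..}. principal {(x, y). dist (x :: 'a unitization) y < e})"
definition "open (U :: 'a unitization set) =
    (\<forall>x\<in>U. eventually (\<lambda>(x', y). x' = x \<longrightarrow> y \<in> U) uniformity)"

instance
proof
  fix x y z :: "'a unitization" and r q :: real and c :: complex
  obtain l a where x: "x = Unitization l a" by (cases x)
  obtain m b where y: "y = Unitization m b" by (cases y)
  note defs = x y unitization_simps scaleR_unitization_def norm_unitization_def
  show "r *\<^sub>R x * y = r *\<^sub>R (x * y)" "x * r *\<^sub>R y = r *\<^sub>R (x * y)"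
    by (simp_all add: defs scaleC_mult_left scaleC_mult_right scaleC_add_right scaleC_scaleC mult.commute
        mult.left_commute)
  show "dist x y = norm (x - y)" "sgn x = x /\<^sub>R norm x"
    by (rule dist_unitization_def sgn_unitization_def)+
  show "uniformity = (INF e\<in>{0<..}. principal {(x, y). dist (x :: 'a unitization) y < e})"
    by (rule uniformity_unitization_def)
  show "open U = (\<forall>x\<in>U. eventually (\<lambda>(x', y). x' = x \<longrightarrow> y \<in> U) uniformity)" for U :: "'a unitization set"
    by (rule open_unitization_def)
  have bl: "bounded_linear (affine_mult l a)" "bounded_linear (affine_mult m b)"
    by (rule bounded_linear_affine_mult)+
  have pos: "0 \<le> onorm (affine_mult l a)" "0 \<le> onorm (affine_mult m b)"
    using bl by (auto intro: onorm_pos_le)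
  show "(norm x = 0) = (x = 0)"
  proof
    assume "norm x = 0"
    then have "cmod l \<le> 0" "onorm (affine_mult l a) \<le> 0"
      by (metis defs(1) max.cobounded1 max.cobounded2 norm_unitization_def unitization.sel)+
    then have "l = 0" "onorm (affine_mult l a) = 0" using pos by auto
    then have "l = 0" "a = 0" using onorm_mult_left[of a] by auto
    then show "x = 0" by (simp add: defs)
  next
    assume "x = 0"
    then have "l = 0" "a = 0" by (simp_all add: defs)
    then show "norm x = 0" using onorm_mult_left[of a] by (simp add: defs)
  qed
  show "norm (x + y) \<le> norm x + norm y"
  proof -
    have "affine_mult (l + m) (a + b) = (\<lambda>x. affine_mult l a x + affine_mult m b x)"
      by (rule ext) (rule affine_mult_add)
    then have "onorm (affine_mult (l + m) (a + b)) \<le> onorm (affine_mult l a) + onorm (affine_mult m b)"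
      using onorm_triangle[OF bl] by simp
    then show ?thesis using norm_triangle_ineq[of l m] by (auto simp: defs)
  qed
  show "norm (r *\<^sub>R x) = \<bar>r\<bar> * norm x"
    by (simp add: scaleR_unitization_def norm_unitization_def scaleC_unitization_def onorm_affine_mult_scaleC
      max_mult_distrib_left norm_mult)
  show "norm (x * y) \<le> norm x * norm y"
  proof -
    have eq: "affine_mult (l * m) (l *\<^sub>C b + m *\<^sub>C a + a * b) = affine_mult l a \<circ> affine_mult m b"
      by (rule ext) (simp add: affine_mult_comp)
    have "onorm (affine_mult (l * m) (l *\<^sub>C b + m *\<^sub>C a + a * b)) \<le>
        onorm (affine_mult l a) * onorm (affine_mult m b)"
      unfolding eq by (rule onorm_compose) (rule bl)+
    also have "\<dots> \<le> max (cmod l) (onorm (affine_mult l a)) * max (cmod m) (onorm (affine_mult m b))"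
      using pos by (intro mult_mono) (auto simp: le_max_iff_disj)
    finally have 1: "onorm (affine_mult (l * m) (l *\<^sub>C b + m *\<^sub>C a + a * b)) \<le> \<dots>" .
    have 2: "cmod (l * m) \<le> max (cmod l) (onorm (affine_mult l a)) * max (cmod m) (onorm (affine_mult m b))"
      unfolding norm_mult by (intro mult_mono) (auto simp: le_max_iff_disj)
    show ?thesis using 1 2 by (simp add: defs)
  qed
  have "onorm (affine_mult 1 (0::'a)) \<le> 1" using onorm_affine_mult_le[of 1 "0::'a"] by simp
  then show "norm (1 :: 'a unitization) = 1"
    by (simp add: norm_unitization_def one_unitization_def max_def)
qed
end

lemma norm_scaleC_unitization: "norm (c *\<^sub>C x) = cmod c * norm (x :: 'a::cstar_algebra unitization)"
  by (simp add: norm_unitization_def scaleC_unitization_def onorm_affine_mult_scaleC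
      max_mult_distrib_left norm_mult)

instance unitization :: (cstar_algebra) banach
proof
  fix X :: "nat \<Rightarrow> 'a unitization"
  assume X: "Cauchy X"
  have n1: "cmod (scalar_part x) \<le> norm x" for x :: "'a unitization"
    by (simp add: norm_unitization_def)
  have n2: "norm (algebra_part x) \<le> 2 * norm x" for x :: "'a unitization"
    using norm_le_onorm_affine_mult[of "algebra_part x" "scalar_part x"]
    by (simp add: norm_unitization_def)
  have n3: "norm x \<le> cmod (scalar_part x) + norm (algebra_part x)" for x :: "'a unitization"
    using onorm_affine_mult_le[of "scalar_part x" "algebra_part x"]
    by (simp add: norm_unitization_def)
  have "Cauchy (\<lambda>n. scalar_part (X n))"
  proof (rule metric_CauchyI)
    fix e :: real assume "0 < e"
    then obtain M where "\<forall>m\<ge>M. \<forall>n\<ge>M. dist (X m) (X n) < e" using X metric_CauchyD by blast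
    moreover have "dist (scalar_part (X m)) (scalar_part (X n)) \<le> dist (X m) (X n)" for m n
      using n1[of "X m - X n"] by (simp add: dist_unitization_def dist_norm minus_unitization_def)
    ultimately show "\<exists>M. \<forall>m\<ge>M. \<forall>n\<ge>M. dist (scalar_part (X m)) (scalar_part (X n)) < e"
      using le_less_trans by blast
  qed
  then obtain l where l: "(\<lambda>n. scalar_part (X n)) \<longlonglongrightarrow> l" using Cauchy_convergent convergent_def by blast
  have "Cauchy (\<lambda>n. algebra_part (X n))"
  proof (rule metric_CauchyI)
    fix e :: real assume "0 < e"
    then obtain M where "\<forall>m\<ge>M. \<forall>n\<ge>M. dist (X m) (X n) < e / 2" using X metric_CauchyD[of X "e/2"] by auto
    moreover have "dist (algebra_part (X m)) (algebra_part (X n)) \<le> 2 * dist (X m) (X n)" for m n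
      using n2[of "X m - X n"] by (simp add: dist_unitization_def dist_norm minus_unitization_def)
    ultimately have "dist (algebra_part (X m)) (algebra_part (X n)) < e" if "m \<ge> M" "n \<ge> M" for m n
      using that by (smt (verit) field_sum_of_halves)
    then show "\<exists>M. \<forall>m\<ge>M. \<forall>n\<ge>M. dist (algebra_part (X m)) (algebra_part (X n)) < e" by blast
  qed
  then obtain a where a: "(\<lambda>n. algebra_part (X n)) \<longlonglongrightarrow> a" using Cauchy_convergent convergent_def by blast
  have "(\<lambda>n. cmod (scalar_part (X n) - l) + norm (algebra_part (X n) - a)) \<longlonglongrightarrow> 0 + 0"
    by (intro tendsto_add) (use l a in \<open>simp_all add: LIM_zero tendsto_norm_zero\<close>)
  then have lim0: "(\<lambda>n. cmod (scalar_part (X n) - l) + norm (algebra_part (X n) - a)) \<longlonglongrightarrow> 0" by simp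
  have bound: "norm (X n - Unitization l a) \<le> cmod (scalar_part (X n) - l) + norm (algebra_part (X n) - a)" for n
    using n3[of "X n - Unitization l a"] by (simp add: minus_unitization_def)
  have "(\<lambda>n. X n - Unitization l a) \<longlonglongrightarrow> 0"
    by (rule Lim_null_comparison[OF _ lim0]) (simp add: bound)
  then show "convergent X" by (auto simp: convergent_def LIM_zero_iff)
qed

instantiation unitization :: (cstar_algebra) cstar_algebra
begin
definition "star x = Unitization (cnj (scalar_part x)) (star (algebra_part x))"
instance
proof
  fix x y :: "'a unitization" and r :: real and c :: complex
  obtain l a where x: "x = Unitization l a" by (cases x)
  obtain m b where y: "y = Unitization m b" by (cases y)
  note defs = x y unitization_simps norm_unitization_def star_unitization_def
  show "r *\<^sub>R x = complex_of_real r *\<^sub>C x" by (rule scaleR_unitization_def)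
  show "norm (c *\<^sub>C x) = cmod c * norm x" by (rule norm_scaleC_unitization)
  have pos: "0 \<le> onorm (affine_mult l a)" 
    by (intro onorm_pos_le bounded_linear_affine_mult)
  show "c *\<^sub>C x * y = c *\<^sub>C (x * y)" "x * c *\<^sub>C y = c *\<^sub>C (x * y)"
    by (simp_all add: defs scaleC_mult_left scaleC_mult_right scaleC_add_right scaleC_scaleC mult.commute
        mult.left_commute)
  show "star (star x) = x" by (simp add: defs star_star)
  show "star (x + y) = star x + star y" by (simp add: defs star_add)
  show "star (c *\<^sub>C x) = cnj c *\<^sub>C star x" by (simp add: defs star_scaleC)
  show "star (x * y) = star y * star x" by (simp add: defs star_add star_scaleC star_mult)
  \<comment> \<open>The C*-identity of operators: \<open>\<parallel>T v\<parallel>\<^sup>2 = \<parallel>v\<^sup>* T\<^sup>* T v\<parallel>\<close>.\<close>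
  have key: "(onorm (affine_mult l a))\<^sup>2 \<le>
     onorm (affine_mult (cnj l * l) (cnj l *\<^sub>C a + l *\<^sub>C star a + star a * a))"
    (is "_ \<le> onorm ?T") for l and a :: 'a
  proof -
    have T0: "0 \<le> onorm ?T" by (simp add: onorm_pos_le bounded_linear_affine_mult)
    have "onorm (affine_mult l a) \<le> sqrt (onorm ?T)"
    proof (rule onorm_bound)
      fix v :: 'a
      have "(norm (affine_mult l a v))\<^sup>2 = norm (star (affine_mult l a v) * affine_mult l a v)"
        by (simp add: cstar_identity)
      also have "star (affine_mult l a v) * affine_mult l a v = star v * ?T v"
        by (simp add: affine_mult_def star_add star_scaleC star_mult scaleC_add_right scaleC_mult_left
            scaleC_mult_right scaleC_scaleC algebra_simps)
      also have "norm \<dots> \<le> norm v * (onorm ?T * norm v)"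
      proof -
        have "norm (star v * ?T v) \<le> norm (star v) * norm (?T v)" by (rule norm_mult_ineq)
        also have "\<dots> \<le> norm v * (onorm ?T * norm v)"
          unfolding norm_star by (intro mult_left_mono onorm[OF bounded_linear_affine_mult]) simp
        finally show ?thesis .
      qed
      also have "\<dots> = (sqrt (onorm ?T) * norm v)\<^sup>2"
        using T0 by (simp add: power_mult_distrib power2_eq_square)
      finally show "norm (affine_mult l a v) \<le> sqrt (onorm ?T) * norm v"
        by (rule power2_le_imp_le) (use T0 in simp)
    qed (use T0 in simp)
    then have "(onorm (affine_mult l a))\<^sup>2 \<le> (sqrt (onorm ?T))\<^sup>2"
      by (intro power_mono) (simp_all add: onorm_pos_le bounded_linear_affine_mult)
    then show ?thesis using T0 by simp
  qed
  have sub: "onorm (affine_mult (cnj l * l) (cnj l *\<^sub>C a + l *\<^sub>C star a + star a * a)) \<le>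
     onorm (affine_mult (cnj l) (star a)) * onorm (affine_mult l a)" for l and a :: 'a
  proof -
    have eq: "affine_mult (cnj l * l) (cnj l *\<^sub>C a + l *\<^sub>C star a + star a * a) =
        affine_mult (cnj l) (star a) \<circ> affine_mult l a"
      by (rule ext) (simp add: affine_mult_comp)
    show ?thesis unfolding eq by (rule onorm_compose) (rule bounded_linear_affine_mult)+
  qed
  have star_le: "onorm (affine_mult l a) \<le> onorm (affine_mult (cnj l) (star a))" for l and a :: 'a
  proof (cases "onorm (affine_mult l a) = 0")
    case True
    then show ?thesis by (simp add: onorm_pos_le bounded_linear_affine_mult)
  next
    case False
    then have "0 < onorm (affine_mult l a)"
      using onorm_pos_le[OF bounded_linear_affine_mult, of l a] by simp
    with order_trans[OF key sub, of l a] show ?thesis by (simp add: power2_eq_square)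
  qed
  have "onorm (affine_mult (cnj l) (star a)) = onorm (affine_mult l a)"
    using star_le[of l a] star_le[of "cnj l" "star a"] by (simp add: star_star)
  then have "onorm (affine_mult (cnj l * l) (cnj l *\<^sub>C a + l *\<^sub>C star a + star a * a)) =
     (onorm (affine_mult l a))\<^sup>2"
    using key[of l a] sub[of l a] by (simp add: power2_eq_square)
  moreover have "max (u\<^sup>2) (v\<^sup>2) = (max u v)\<^sup>2" if "0 \<le> u" "0 \<le> v" for u v :: real
    using that by (auto simp: max_def power_mono_iff)
  ultimately show "norm (star x * x) = (norm x)\<^sup>2"
    using pos by (simp add: defs norm_mult power2_eq_square)
qed
end

section \<open>Square roots and positivity in a unital algebra\<close>

class unital_cstar_algebra = cstar_algebra + real_normed_algebra_1

instance unitization :: (cstar_algebra) unital_cstar_algebra ..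

text \<open>
  The Taylor coefficients of \<open>\<lambda>z. sqrt (1 - z)\<close>.
\<close>

definition sqrt_coeff :: "nat \<Rightarrow> real"
  where "sqrt_coeff n = (-1) ^ n * ((1/2) gchoose n)"

lemma sqrt_coeff_nonpos: "sqrt_coeff (Suc n) \<le> 0"
proof -
  have "pochhammer (-1/2 :: real) (Suc n) = -1/2 * pochhammer (1/2) n"
    by (simp add: pochhammer_rec)
  moreover have "pochhammer (1/2 :: real) n \<ge> 0" by (rule pochhammer_nonneg) simp
  ultimately show ?thesis
    by (simp add: sqrt_coeff_def gbinomial_pochhammer power_mult_distrib[symmetric] mult.assoc[symmetric]
        divide_nonpos_pos del: pochhammer_Suc)
qed

text \<open>
  All coefficients but the first are nonpositive, and the partial sums have a closed form that is
  nonnegative. Hence the series converges absolutely even at the boundary of the unit disc.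
\<close>

lemma sum_abs_sqrt_coeff_le: "(\<Sum>k\<le>n. \<bar>sqrt_coeff k\<bar>) \<le> 2"
proof -
  have eq: "(\<Sum>k\<le>n. sqrt_coeff k) = (-1) ^ n * ((-1/2) gchoose n)"
    using gbinomial_sum_lower_neg[of "1/2::real" n] by (simp add: sqrt_coeff_def mult.commute)
  have pos: "(-1) ^ n * ((-1/2 :: real) gchoose n) \<ge> 0"
    by (simp add: gbinomial_pochhammer power_mult_distrib[symmetric] mult.assoc[symmetric] pochhammer_nonneg)
  have abs: "\<bar>sqrt_coeff k\<bar> = (if k = 0 then 2 else 0) - sqrt_coeff k" for k
    using sqrt_coeff_nonpos[of "k - 1"] by (cases k) (auto simp: sqrt_coeff_def)
  have "(\<Sum>k\<le>n. \<bar>sqrt_coeff k\<bar>) = 2 - (\<Sum>k\<le>n. sqrt_coeff k)"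
    unfolding abs sum_subtractf by simp
  with eq pos show ?thesis by simp
qed

lemma summable_abs_sqrt_coeff: "summable (\<lambda>n. \<bar>sqrt_coeff n\<bar>)"
  by (rule bounded_imp_summable[OF _ sum_abs_sqrt_coeff_le]) simp

text \<open>
  Vandermonde's identity: the square of the series is \<open>1 - z\<close>.
\<close>

lemma sqrt_coeff_convolution:
  "(\<Sum>i\<le>n. sqrt_coeff i * sqrt_coeff (n - i)) = (if n = 0 then 1 else if n = 1 then -1 else 0)"
proof -
  have "(\<Sum>i\<le>n. sqrt_coeff i * sqrt_coeff (n - i)) =
      (\<Sum>i\<le>n. (-1) ^ n * (((1/2) gchoose i) * ((1/2) gchoose (n - i))))"
    by (rule sum.cong) (auto simp: sqrt_coeff_def power_add[symmetric] algebra_simps)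
  also have "\<dots> = (-1) ^ n * ((1 :: real) gchoose n)"
    using gbinomial_Vandermonde[of "1/2::real" "1/2" n]
    by (simp add: sum_distrib_left[symmetric] atMost_atLeast0)
  also have "(1 :: real) gchoose n = of_nat (1 choose n)"
    using binomial_gbinomial[of 1 n, where 'a = real] by simp
  also have "(-1) ^ n * real (1 choose n) = (if n = 0 then 1 else if n = 1 then -1 else 0)"
    by (cases "n \<le> 1") (auto simp: le_Suc_eq binomial_eq_0)
  finally show ?thesis .
qed

text \<open>
  Elements of norm exactly 1 are admitted; this is what makes square roots available for positive elements
  that are not invertible. The bound on \<open>1 - r\<close> shows that the root is itself positive.
\<close>

lemma sqrt_one_minus:
  fixes d :: "'u::unital_cstar_algebra"
  assumes d: "norm d \<le> 1" "star d = d"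
  obtains r where "star r = r" "r * r = 1 - d" "norm (1 - r) \<le> 1"
    "\<And>b. b * d = d * b \<Longrightarrow> b * r = r * b"
proof
  let ?f = "\<lambda>n. sqrt_coeff n *\<^sub>R d ^ n"
  let ?r = "\<Sum>n. ?f n"
  have star_one: "star (1::'u) = 1"
    by (metis mult.right_neutral mult_1 star_mult star_star)
  have star_pow: "star (d ^ n) = d ^ n" for n
    by (induction n) (simp_all add: star_one star_mult d power_commutes)
  have le: "norm (?f n) \<le> \<bar>sqrt_coeff n\<bar>" for n
    using power_le_one[OF norm_ge_zero d(1), of n] norm_power_ineq[of d n]
      mult_left_mono[of "norm (d ^ n)" 1 "\<bar>sqrt_coeff n\<bar>"] by simp
  have abs: "summable (\<lambda>n. norm (?f n))"
    by (rule summable_comparison_test'[OF summable_abs_sqrt_coeff, of 0]) (simp add: le[simplified])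
  have sm: "summable ?f" using abs by (rule summable_norm_cancel)
  have "norm (1 - ?r) = norm (\<Sum>n. ?f (Suc n))"
    using suminf_split_head[OF sm] by (simp add: sqrt_coeff_def norm_minus_commute)
  also have "\<dots> \<le> (\<Sum>n. norm (?f (Suc n)))"
    by (rule summable_norm) (use abs summable_Suc_iff[of "\<lambda>n. norm (?f n)"] in simp)
  also have "\<dots> \<le> (\<Sum>n. \<bar>sqrt_coeff (Suc n)\<bar>)"
    by (rule suminf_le[OF le]) (use abs summable_abs_sqrt_coeff summable_Suc_iff[of "\<lambda>n. norm (?f n)"]
        summable_Suc_iff[of "\<lambda>n. \<bar>sqrt_coeff n\<bar>"] in simp_all)
  also have "\<dots> = (\<Sum>n. \<bar>sqrt_coeff n\<bar>) - 1"
    using suminf_split_head[OF summable_abs_sqrt_coeff] by (simp add: sqrt_coeff_def)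
  also have "(\<Sum>n. \<bar>sqrt_coeff n\<bar>) \<le> 2"
    using sum_abs_sqrt_coeff_le by (intro suminf_le_const[OF summable_abs_sqrt_coeff])
      (metis lessThan_Suc_atMost sum.lessThan_Suc abs_ge_zero add_increasing2 le_add_same_cancel1 order_trans)
  finally show "norm (1 - ?r) \<le> 1" by simp
  show "star ?r = ?r"
    using bounded_linear.suminf[OF bounded_linear_star sm] by (simp add: star_scaleR star_pow)
  have "(\<lambda>n. \<Sum>i\<le>n. ?f i * ?f (n - i)) = (\<lambda>n. (if n = 0 then 1 else if n = 1 then -1 else 0) *\<^sub>R d ^ n)"
  proof
    fix n
    have "(\<Sum>i\<le>n. ?f i * ?f (n - i)) = (\<Sum>i\<le>n. (sqrt_coeff i * sqrt_coeff (n - i)) *\<^sub>R d ^ n)"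
      by (rule sum.cong) (auto simp: power_add[symmetric])
    also have "\<dots> = (\<Sum>i\<le>n. sqrt_coeff i * sqrt_coeff (n - i)) *\<^sub>R d ^ n"
      by (simp add: scaleR_left.sum)
    finally show "(\<Sum>i\<le>n. ?f i * ?f (n - i)) =
        (if n = 0 then 1 else if n = 1 then -1 else 0) *\<^sub>R d ^ n"
      unfolding sqrt_coeff_convolution .
  qed
  then have "(\<lambda>n. (if n = 0 then 1 else if n = 1 then -1 else 0) *\<^sub>R d ^ n) sums (?r * ?r)"
    using Cauchy_product_sums[OF abs abs] by simp
  moreover have "(\<lambda>n. (if n = 0 then 1 else if n = 1 then -1 else 0) *\<^sub>R d ^ n) sums
      (\<Sum>n\<in>{0,1}. (if n = 0 then 1 else if n = 1 then -1 else 0) *\<^sub>R d ^ n)"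
    by (rule sums_finite) auto
  ultimately show "?r * ?r = 1 - d" using sums_unique2 by fastforce
  fix b assume b: "b * d = d * b"
  have comm: "b * d ^ n = d ^ n * b" for n
    by (induction n) (simp_all, metis b mult.assoc)
  have "b * ?r = (\<Sum>n. b * ?f n)" by (rule suminf_mult[OF sm, symmetric])
  also have "\<dots> = (\<Sum>n. ?f n * b)" by (simp add: comm)
  also have "\<dots> = ?r * b" by (rule suminf_mult2[OF sm, symmetric])
  finally show "b * ?r = ?r * b" .
qed

text \<open>
  For self-adjoint \<open>a\<close> the norm condition says that the spectrum lies in \<open>[0, 2t]\<close>. In this form it is
  evident that the positive elements are a convex cone.
\<close>

definition positive :: "'u::unital_cstar_algebra \<Rightarrow> bool"
  where "positive a \<longleftrightarrow> star a = a \<and> (\<exists>t\<ge>0. norm (t *\<^sub>R 1 - a) \<le> t)"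

lemma star_one: "star (1::'u::unital_cstar_algebra) = 1"
  by (metis mult.right_neutral mult_1 star_mult star_star)

lemma positive_zero: "positive (0::'u::unital_cstar_algebra)" 
  by (auto simp: positive_def intro: exI[of _ 0])

lemma positive_scaleR:
  fixes a :: "'u::unital_cstar_algebra"
  assumes "positive a" "0 \<le> r" shows "positive (r *\<^sub>R a)"
proof -
  obtain s where "s \<ge> 0" "norm (s *\<^sub>R 1 - a) \<le> s"
    using assms by (auto simp: positive_def)
  then have "norm ((r * s) *\<^sub>R 1 - r *\<^sub>R a) \<le> r * s" "r * s \<ge> 0"
    using assms(2) norm_scaleR[of r "s *\<^sub>R 1 - a"]
    by (auto simp: scaleR_right_diff_distrib mult_left_mono)
  then show ?thesis using assms by (auto simp: positive_def star_scaleR)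
qed

lemma sqrt_positive:
  fixes a :: "'u::unital_cstar_algebra"
  assumes "positive a"
  obtains h where "star h = h" "h * h = a" "\<And>b. b * a = a * b \<Longrightarrow> b * h = h * b" "positive h"
proof -
  from assms obtain t where t: "star a = a" "t \<ge> 0" "norm (t *\<^sub>R 1 - a) \<le> t" by (auto simp: positive_def)
  show thesis
  proof (cases "t = 0")
    case True
    then have "a = 0" using t by simp
    then show thesis using that[of 0] positive_zero by simp
  next
    case False
    then have tp: "t > 0" using t by simp
    define d where "d = 1 - a /\<^sub>R t"
    have "d = (t *\<^sub>R 1 - a) /\<^sub>R t" using tp by (simp add: d_def scaleR_right_diff_distrib)
    then have "norm d = norm (t *\<^sub>R 1 - a) / t" using tp by (simp add: divide_inverse_commute)
    then have "norm d \<le> 1" using tp t by simp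
    moreover have "star d = d" by (simp add: d_def star_diff star_one star_scaleR t)
    ultimately obtain r where r: "star r = r" "r * r = 1 - d" "norm (1 - r) \<le> 1" "\<And>b. b * d = d * b \<Longrightarrow> b * r = r * b"
      by (rule sqrt_one_minus) blast
    show thesis
    proof
      show "star (sqrt t *\<^sub>R r) = sqrt t *\<^sub>R r" by (simp add: star_scaleR r(1))
      show "sqrt t *\<^sub>R r * sqrt t *\<^sub>R r = a" using tp by (simp add: r(2) d_def mult.assoc[symmetric])
      fix b assume "b * a = a * b"
      then have "b * d = d * b" by (simp add: d_def algebra_simps)
      from r(4)[OF this] show "b * sqrt t *\<^sub>R r = sqrt t *\<^sub>R r * b" by simp
    next
      have "positive r" using r(1,3) by (auto simp: positive_def intro!: exI[of _ 1])
      then show "positive (sqrt t *\<^sub>R r)" using tp by (intro positive_scaleR) simp_all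
    qed
  qed
qed

lemma star_cartesian:
  fixes h k :: "'u::unital_cstar_algebra"
  assumes "star h = h" "star k = k"
  shows "star (h + \<i> *\<^sub>C k) = h - \<i> *\<^sub>C k"
  by (simp add: star_add star_scaleC assms)

lemma norm_le_norm_cartesian:
  fixes h k :: "'u::unital_cstar_algebra"
  assumes "star h = h" "star k = k"
  shows "norm h \<le> norm (h + \<i> *\<^sub>C k)" "norm k \<le> norm (h + \<i> *\<^sub>C k)"
proof -
  let ?u = "h + \<i> *\<^sub>C k"
  have "2 *\<^sub>R h = ?u + star ?u" by (simp add: star_cartesian assms scaleR_2)
  then have "2 * norm h \<le> norm ?u + norm (star ?u)"
    by (metis abs_numeral norm_scaleR norm_triangle_ineq)
  then show "norm h \<le> norm ?u" by simp
  have "norm (2 *\<^sub>R k) = norm (?u - star ?u)"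
    by (simp add: star_cartesian assms scaleR_2 scaleC_add_right[symmetric] norm_scaleC)
  then have "2 * norm k \<le> norm ?u + norm (star ?u)"
    by (metis abs_numeral norm_scaleR norm_triangle_ineq4)
  then show "norm k \<le> norm ?u" by simp
qed

lemma star_mult_cartesian:
  fixes h k :: "'u::unital_cstar_algebra"
  assumes "star h = h" "star k = k" "h * k = k * h"
  shows "star (h + \<i> *\<^sub>C k) * (h + \<i> *\<^sub>C k) = h * h + k * k"
  by (simp add: star_cartesian assms(1,2) algebra_simps scaleC_mult_left scaleC_mult_right
      scaleC_scaleC assms(3))

text \<open>
  Commuting self-adjoint \<open>h\<close>, \<open>k\<close> with scalar \<open>h\<^sup>2 + k\<^sup>2\<close> are the real and imaginary parts of a multiple of
  a unitary, and taking a real or imaginary part does not increase the norm.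
\<close>

lemma norm_square_le_of_sum:
  fixes h k :: "'u::unital_cstar_algebra"
  assumes "star h = h" "star k = k" "h * k = k * h" "h * h + k * k = t *\<^sub>R 1"
  shows "norm (h * h) \<le> \<bar>t\<bar>" "norm (k * k) \<le> \<bar>t\<bar>"
proof -
  have "(norm (h + \<i> *\<^sub>C k))\<^sup>2 = \<bar>t\<bar>"
    using cstar_identity[of "h + \<i> *\<^sub>C k"] star_mult_cartesian[OF assms(1-3)] assms(4) by simp
  moreover have "norm (h * h) = (norm h)\<^sup>2" "norm (k * k) = (norm k)\<^sup>2"
    using cstar_identity[of h] cstar_identity[of k] assms(1,2) by simp_all
  moreover note norm_le_norm_cartesian[OF assms(1,2)]
  ultimately show "norm (h * h) \<le> \<bar>t\<bar>" "norm (k * k) \<le> \<bar>t\<bar>"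
    by (metis norm_ge_zero power_mono)+
qed

lemma positive_add:
  fixes a b :: "'u::unital_cstar_algebra"
  assumes "positive a" "positive b" shows "positive (a + b)"
proof -
  obtain s t where "s \<ge> 0" "norm (s *\<^sub>R 1 - a) \<le> s" "t \<ge> 0" "norm (t *\<^sub>R 1 - b) \<le> t"
    using assms by (auto simp: positive_def)
  moreover have "(s + t) *\<^sub>R 1 - (a + b) = (s *\<^sub>R 1 - a) + (t *\<^sub>R 1 - b)"
    by (simp add: scaleR_add_left)
  ultimately have "norm ((s + t) *\<^sub>R 1 - (a + b)) \<le> s + t" "s + t \<ge> 0"
    using norm_triangle_ineq[of "s *\<^sub>R 1 - a" "t *\<^sub>R 1 - b"] by (linarith | simp only:)+
  then show ?thesis using assms by (auto simp: positive_def star_add)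
qed

lemma positive_norm_minus:
  fixes b :: "'u::unital_cstar_algebra"
  assumes "star b = b" "norm b \<le> t" shows "positive (t *\<^sub>R 1 - b)"
proof -
  have "0 \<le> t" using assms(2) norm_ge_zero order_trans by blast
  then show ?thesis
    using assms by (auto simp: positive_def star_diff star_scaleR star_one intro!: exI[of _ t])
qed

lemma positive_square:
  fixes h :: "'u::unital_cstar_algebra"
  assumes "star h = h" shows "positive (h * h)"
proof -
  let ?t = "norm (h * h)"
  have "star (h * h) = h * h" by (simp add: star_mult assms)
  then have "positive (?t *\<^sub>R 1 - h * h)" by (rule positive_norm_minus) simp
  then obtain k where k: "star k = k" "k * k = ?t *\<^sub>R 1 - h * h"
      "\<And>b. b * (?t *\<^sub>R 1 - h * h) = (?t *\<^sub>R 1 - h * h) * b \<Longrightarrow> b * k = k * b"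
    by (rule sqrt_positive) blast
  have "h * k = k * h" by (rule k(3)) (simp add: algebra_simps)
  then have "norm (k * k) \<le> \<bar>?t\<bar>"
    by (intro norm_square_le_of_sum[OF assms k(1)]) (simp_all add: k(2))
  then show ?thesis
    using \<open>star (h * h) = h * h\<close> unfolding positive_def k(2)[symmetric] by (auto simp: k(2) intro!: exI[of _ ?t])
qed

text \<open>
  Since \<open>\<parallel>b\<parallel> - a\<close> is positive, it and \<open>a\<close> have commuting square roots whose squares add up to a scalar.
\<close>

lemma norm_mono_positive:
  fixes a b :: "'u::unital_cstar_algebra"
  assumes "positive a" "positive (b - a)" shows "norm a \<le> norm b"
proof -
  have sa: "star a = a" "star (b - a) = b - a" using assms by (auto simp: positive_def)
  then have "star b = b" by (simp add: star_diff)
  then have "positive (norm b *\<^sub>R 1 - b)" by (rule positive_norm_minus) simp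
  from positive_add[OF this assms(2)] have "positive (norm b *\<^sub>R 1 - a)" by simp
  then obtain k where k: "star k = k" "k * k = norm b *\<^sub>R 1 - a"
      "\<And>c. c * (norm b *\<^sub>R 1 - a) = (norm b *\<^sub>R 1 - a) * c \<Longrightarrow> c * k = k * c"
    by (rule sqrt_positive) blast
  obtain h where h: "star h = h" "h * h = a" "\<And>c. c * a = a * c \<Longrightarrow> c * h = h * c"
    using sqrt_positive[OF assms(1)] by blast
  have "a * k = k * a" by (rule k(3)) (simp add: algebra_simps)
  then have "k * h = h * k" by (intro h(3)) simp
  then have "norm (h * h) \<le> \<bar>norm b\<bar>"
    by (intro norm_square_le_of_sum[OF h(1) k(1)]) (simp_all add: h(2) k(2))
  then show ?thesis by (simp add: h(2))
qed

text \<open>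
  With real and imaginary parts \<open>c = h + ik\<close> the sum is \<open>2 (h\<^sup>2 + k\<^sup>2)\<close>.
\<close>

lemma positive_star_mult_add:
  fixes c :: "'u::unital_cstar_algebra"
  shows "positive (star c * c + c * star c)"
proof -
  define h where "h = (1/2) *\<^sub>R (c + star c)"
  define k where "k = (- \<i> / 2) *\<^sub>C (c - star c)"
  have h: "star h = h" by (simp add: h_def star_scaleR star_add star_star add.commute)
  have k: "star k = k"
    unfolding k_def star_scaleC star_diff star_star
    by (simp add: algebra_simps cv.scale_right_diff_distrib)
  have c: "c = h + \<i> *\<^sub>C k"
  proof -
    have "\<i> *\<^sub>C k = (1/2) *\<^sub>R (c - star c)"
      by (simp add: k_def scaleC_scaleC scaleR_eq_scaleC)
    then have "h + \<i> *\<^sub>C k = (1/2) *\<^sub>R (c + c)"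
      by (simp only: h_def flip: scaleR_add_right) simp
    then show ?thesis by (simp add: scaleR_2[symmetric])
  qed
  have "star c * c + c * star c = 2 *\<^sub>R (h * h + k * k)"
    unfolding c star_cartesian[OF h k]
    by (simp add: algebra_simps scaleC_mult_left scaleC_mult_right scaleC_scaleC scaleR_2)
  then show ?thesis
    using h k by (simp add: positive_scaleR positive_add positive_square del: scaleR_add_right)
qed

text \<open>
  Since \<open>c\<^sup>* c + c c\<^sup>*\<close> and \<open>m\<^sup>2\<close> are positive, so is \<open>c c\<^sup>*\<close>, whereas \<open>c\<^sup>* c\<close> is negative. Spectral theory
  would say that both have the same nonzero spectrum. Here is a substitute: choose \<open>t\<close> with
  \<open>\<parallel>t - c c\<^sup>*\<parallel> \<le> t\<close> and put \<open>e = t - c\<^sup>* c = t + m\<^sup>2\<close>. By monotonicity \<open>\<parallel>e\<parallel> \<ge> t + \<mu>\<close> for \<open>\<mu> = \<parallel>m\<^sup>2\<parallel>\<close>, while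
  \<open>e m\<^sup>2 = - c\<^sup>* (t - c c\<^sup>*) c\<close> has norm at most \<open>\<mu> t\<close>. Comparing norms in \<open>e\<^sup>2 = t e + e m\<^sup>2\<close> forces
  \<open>(t + \<mu>) \<mu> \<le> \<mu> t\<close>, so \<open>\<mu> = 0\<close>.
\<close>

lemma star_mult_eq_minus_square:
  fixes c m :: "'u::unital_cstar_algebra"
  assumes c: "star c * c = - (m * m)" and m: "star m = m"
  shows "c = 0"
proof -
  let ?\<mu> = "norm (m * m)"
  have mu: "?\<mu> = (norm c)\<^sup>2" using cstar_identity[of c] c by simp
  have "c * star c = (star c * c + c * star c) + m * m" by (simp add: c)
  also have "positive \<dots>" by (intro positive_add positive_star_mult_add positive_square m)
  finally obtain t0 where t0: "t0 \<ge> 0" "norm (t0 *\<^sub>R 1 - c * star c) \<le> t0" by (auto simp: positive_def)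
  define t where "t = t0 + 1"
  have t: "t > 0" "norm (t *\<^sub>R 1 - c * star c) \<le> t"
  proof -
    have "t *\<^sub>R 1 - c * star c = (t0 *\<^sub>R 1 - c * star c) + 1" by (simp add: t_def scaleR_add_left)
    then have "norm (t *\<^sub>R 1 - c * star c) \<le> norm (t0 *\<^sub>R 1 - c * star c) + norm (1::'u)"
      by (simp only: norm_triangle_ineq)
    then show "norm (t *\<^sub>R 1 - c * star c) \<le> t" using t0 by (simp add: t_def)
  qed (use t0 in \<open>simp add: t_def\<close>)
  define e where "e = t *\<^sub>R 1 + m * m"
  have e: "star e = e" by (simp add: e_def star_add star_scaleR star_one star_mult m)
  have pe: "positive (norm e *\<^sub>R 1 - e)" by (rule positive_norm_minus[OF e]) simp
  have "positive (m * m)" by (rule positive_square[OF m])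
  have "positive (t *\<^sub>R (1 * 1 :: 'u))" using t(1) by (intro positive_scaleR positive_square star_one) simp
  then have "norm (t *\<^sub>R 1 :: 'u) \<le> norm e"
    using positive_square[OF m] by (intro norm_mono_positive) (simp_all add: e_def)
  then have te: "t \<le> norm e" using t by simp
  have "norm (m * m) \<le> norm ((norm e - t) *\<^sub>R 1 :: 'u)"
    by (rule norm_mono_positive[OF positive_square[OF m]])
      (use pe in \<open>simp add: e_def algebra_simps scaleR_left_diff_distrib\<close>)
  with te have le: "t + ?\<mu> \<le> norm e" by simp
  have "e * (m * m) = - (star c * (t *\<^sub>R 1 - c * star c) * c)"
  proof -
    have "m * m = - (star c * c)" by (simp add: c)
    then show ?thesis unfolding e_def by (simp add: algebra_simps)
  qed
  then have "norm (e * (m * m)) = norm (star c * (t *\<^sub>R 1 - c * star c) * c)" by simp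
  also have "\<dots> \<le> norm (star c) * norm (t *\<^sub>R 1 - c * star c) * norm c"
    by (meson norm_mult_ineq mult_right_mono norm_ge_zero order_trans)
  also have "\<dots> \<le> norm (star c) * t * norm c"
    using t by (intro mult_right_mono mult_left_mono) auto
  also have "\<dots> = ?\<mu> * t" by (simp add: mu power2_eq_square)
  finally have 1: "norm (e * (m * m)) \<le> ?\<mu> * t" .
  have "e * e = t *\<^sub>R e + e * (m * m)" by (subst (2) e_def) (simp add: distrib_left)
  then have "norm (e * e) \<le> t * norm e + ?\<mu> * t"
    using norm_triangle_ineq[of "t *\<^sub>R e" "e * (m * m)"] 1 t by simp
  moreover have "norm (e * e) = norm e * norm e"
    using cstar_identity[of e] e by (simp add: power2_eq_square)
  ultimately have "norm e * (norm e - t) \<le> ?\<mu> * t" by (simp add: algebra_simps)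
  moreover have "(t + ?\<mu>) * ?\<mu> \<le> norm e * (norm e - t)"
    using le t by (intro mult_mono) auto
  ultimately have "?\<mu> * ?\<mu> \<le> 0" by (simp add: algebra_simps)
  then have "?\<mu> = 0" by (metis mult_eq_0_iff order_antisym zero_le_square)
  with mu show ?thesis by simp
qed

text \<open>
  Let \<open>p = \<bar>a\<bar>\<close> be the positive root of \<open>a\<^sup>2\<close> for \<open>a = b\<^sup>* b\<close>, so that \<open>n = p - a\<close> is twice the negative part.
  The element \<open>b n\<close> has \<open>(b n)\<^sup>* (b n) = n a n = - p n\<^sup>2\<close>, minus a square, and the previous lemma shows that it
  vanishes.
\<close>

lemma positive_star_mult:
  fixes b :: "'u::unital_cstar_algebra"
  shows "positive (star b * b)"
proof -
  define a where "a = star b * b"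
  have a: "star a = a" by (simp add: a_def star_mult star_star)
  obtain p where p: "star p = p" "p * p = a * a" "\<And>c. c * (a * a) = (a * a) * c \<Longrightarrow> c * p = p * c"
      "positive p"
    using sqrt_positive[OF positive_square[OF a]] by blast
  have ap: "a * p = p * a" by (rule p(3)) (simp add: mult.assoc)
  obtain q where q: "star q = q" "q * q = p" "\<And>c. c * p = p * c \<Longrightarrow> c * q = q * c"
    using sqrt_positive[OF p(4)] by blast
  define n where "n = p - a"
  have n: "star n = n" by (simp add: n_def star_diff p(1) a)
  have nq: "n * q = q * n" by (rule q(3)) (simp add: n_def algebra_simps ap)
  have an: "a * n = - (p * n)" by (simp add: n_def algebra_simps ap p(2))
  have "star (b * n) * (b * n) = n * (a * n)" by (simp add: a_def star_mult n mult.assoc)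
  also have "\<dots> = - ((n * q) * (q * n))" by (simp add: an q(2)[symmetric] mult.assoc)
  also have "\<dots> = - ((q * n) * (q * n))" by (simp add: nq)
  finally have 1: "star (b * n) * (b * n) = - ((q * n) * (q * n))" .
  have "star (q * n) = q * n" by (simp add: star_mult q(1) n nq)
  from star_mult_eq_minus_square[OF 1 this] have "(q * n) * (q * n) = 0"
    using 1 by simp
  then have "q * n = 0" using cstar_identity[of "q * n"] \<open>star (q * n) = q * n\<close> by simp
  then have "p * n = 0" by (metis q(2) mult.assoc mult_zero_right)
  then have "n * n = 0" using an by (simp add: n_def left_diff_distrib)
  then have "n = 0" using cstar_identity[of n] n by simp
  then show ?thesis using p(4) by (simp add: n_def a_def)
qed

section \<open>The positive cone of a non-unital algebra\<close>

abbreviation embed :: "'a::cstar_algebra \<Rightarrow> 'a unitization"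
  where "embed a \<equiv> Unitization 0 a"

lemma star_embed: "star (embed a) = embed (star a)"
  by (simp add: star_unitization_def)

lemma embed_mult: "embed a * embed b = embed (a * b)"
  by (simp add: times_unitization_def)

lemma embed_add: "embed a + embed b = embed (a + b)"
  by (simp add: plus_unitization_def)

lemma embed_diff: "embed a - embed b = embed (a - b)"
  by (simp add: minus_unitization_def)

lemma embed_scaleR: "r *\<^sub>R embed a = embed (r *\<^sub>R a)"
  by (simp add: scaleR_unitization_def scaleC_unitization_def scaleR_eq_scaleC)

lemma norm_embed: "norm (embed a) = norm a"
  by (simp add: norm_unitization_def onorm_mult_left)

text \<open>
  The root taken in the unitization lies in the algebra, since its scalar part has square zero.
\<close>

lemma cstar_pos_iff_positive: "cstar_pos a \<longleftrightarrow> positive (embed a)"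
proof
  assume "cstar_pos a"
  then obtain b where "a = star b * b" by (auto simp: cstar_pos_def)
  then show "positive (embed a)"
    using positive_star_mult[of "embed b"] by (simp add: star_embed embed_mult)
next
  assume "positive (embed a)"
  then obtain h where h: "star h = h" "h * h = embed a" by (rule sqrt_positive)
  obtain l x where hx: "h = Unitization l x" by (cases h)
  from h(2) have l: "l = 0" by (simp add: hx times_unitization_def)
  with h have "star x = x" "x * x = a" by (simp_all add: hx star_embed embed_mult)
  then show "cstar_pos a" unfolding cstar_pos_def by metis
qed

lemma cstar_pos_zero: "cstar_pos 0"
  by (auto simp: cstar_pos_def intro: exI[of _ 0])

lemma cstar_pos_add: "cstar_pos a \<Longrightarrow> cstar_pos b \<Longrightarrow> cstar_pos (a + b)"
  by (simp add: cstar_pos_iff_positive positive_add embed_add[symmetric])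

lemma cstar_pos_sum: "(\<And>i. i \<in> I \<Longrightarrow> cstar_pos (f i)) \<Longrightarrow> cstar_pos (\<Sum>i\<in>I. f i)"
  by (induction I rule: infinite_finite_induct) (simp_all add: cstar_pos_zero cstar_pos_add)

lemma cstar_pos_scaleR: "cstar_pos a \<Longrightarrow> 0 \<le> r \<Longrightarrow> cstar_pos (r *\<^sub>R a)"
  by (simp add: cstar_pos_iff_positive positive_scaleR embed_scaleR[symmetric])

lemma norm_le_norm_add:
  assumes "cstar_pos a" "cstar_pos b" shows "norm a \<le> norm (a + b)"
  using norm_mono_positive[of "embed a" "embed (a + b)"] assms
  by (simp add: cstar_pos_iff_positive embed_diff norm_embed)

text \<open>
  Conjugate the positive element \<open>\<parallel>a\<parallel> - a\<close> of the unitization by \<open>c\<close>.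
\<close>

lemma cstar_pos_conjugate_le:
  assumes "cstar_pos a" shows "cstar_pos (norm a *\<^sub>R (star c * c) - star c * a * c)"
proof -
  have "positive (embed a)" using assms by (simp add: cstar_pos_iff_positive)
  then have "star (embed a) = embed a" by (simp add: positive_def)
  then have "positive (norm a *\<^sub>R 1 - embed a)"
    by (rule positive_norm_minus) (simp add: norm_embed)
  then obtain h where h: "star h = h" "h * h = norm a *\<^sub>R 1 - embed a" by (rule sqrt_positive)
  have "star (h * embed c) * (h * embed c) = embed (star c) * (h * h) * embed c"
    by (simp add: star_mult h(1) star_embed mult.assoc)
  also have "\<dots> = embed (norm a *\<^sub>R (star c * c) - star c * a * c)"
    unfolding h(2) by (simp add: right_diff_distrib left_diff_distrib embed_mult embed_scaleR embed_diff)
  finally show ?thesis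
    using positive_star_mult[of "h * embed c"] by (simp add: cstar_pos_iff_positive)
qed

section \<open>Hilbert modules\<close>

context hilbert_module
begin

lemma zero_mem: "0 \<in> mcarrier E"
  and add_mem: "\<lbrakk>x \<in> mcarrier E; y \<in> mcarrier E\<rbrakk> \<Longrightarrow> x + y \<in> mcarrier E"
  and scaleC_mem: "x \<in> mcarrier E \<Longrightarrow> c *\<^sub>C x \<in> mcarrier E"
  and act_mem: "x \<in> mcarrier E \<Longrightarrow> mact E x a \<in> mcarrier E"
  using carrier_submodule by (auto simp: submodule_def)

lemma uminus_mem: "x \<in> mcarrier E \<Longrightarrow> - x \<in> mcarrier E"
  using scaleC_mem[of x "-1"] by (simp add: scaleC_one)

lemma diff_mem: "\<lbrakk>x \<in> mcarrier E; y \<in> mcarrier E\<rbrakk> \<Longrightarrow> x - y \<in> mcarrier E"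
  using add_mem[of x "- y"] uminus_mem by simp

lemmas mem = zero_mem add_mem scaleC_mem act_mem uminus_mem diff_mem

lemma inner_zero_right [simp]: "x \<in> mcarrier E \<Longrightarrow> minner E x 0 = 0"
  using inner_add_right[of x 0 0] zero_mem by simp

lemma inner_minus_right: "\<lbrakk>x \<in> mcarrier E; y \<in> mcarrier E\<rbrakk> \<Longrightarrow> minner E x (- y) = - minner E x y"
  using inner_scaleC_right[of x y "-1"] by (simp add: scaleC_one)

lemma inner_diff_right: "\<lbrakk>x \<in> mcarrier E; y \<in> mcarrier E; z \<in> mcarrier E\<rbrakk> \<Longrightarrow>
    minner E x (y - z) = minner E x y - minner E x z"
  using inner_add_right[of x y "- z"] by (simp add: uminus_mem inner_minus_right)

lemma inner_add_left: "\<lbrakk>x \<in> mcarrier E; y \<in> mcarrier E; z \<in> mcarrier E\<rbrakk> \<Longrightarrow>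
    minner E (x + y) z = minner E x z + minner E y z"
  by (simp add: star_inner[of z, symmetric] add_mem inner_add_right star_add)

lemma inner_scaleC_left: "\<lbrakk>x \<in> mcarrier E; y \<in> mcarrier E\<rbrakk> \<Longrightarrow>
    minner E (c *\<^sub>C x) y = cnj c *\<^sub>C minner E x y"
  by (simp add: star_inner[of y, symmetric] scaleC_mem inner_scaleC_right star_scaleC)

lemma inner_act_left: "\<lbrakk>x \<in> mcarrier E; y \<in> mcarrier E\<rbrakk> \<Longrightarrow>
    minner E (mact E x a) y = star a * minner E x y"
  by (simp add: star_inner[of y, symmetric] act_mem inner_act_right star_mult)

lemma inner_zero_left [simp]: "x \<in> mcarrier E \<Longrightarrow> minner E 0 x = 0"
  by (simp add: star_inner[of x, symmetric] zero_mem)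

lemma inner_minus_left: "\<lbrakk>x \<in> mcarrier E; y \<in> mcarrier E\<rbrakk> \<Longrightarrow> minner E (- x) y = - minner E x y"
  using inner_scaleC_left[of x y "-1"] by (simp add: scaleC_one)

lemma inner_diff_left: "\<lbrakk>x \<in> mcarrier E; y \<in> mcarrier E; z \<in> mcarrier E\<rbrakk> \<Longrightarrow>
    minner E (x - y) z = minner E x z - minner E y z"
  using inner_add_left[of x "- y" z] by (simp add: uminus_mem inner_minus_left)

lemma mnorm_nonneg [simp]: "0 \<le> mnorm E x"
  by (simp add: mnorm_def)

lemma mnorm_power2: "(mnorm E x)\<^sup>2 = norm (minner E x x)"
  by (simp add: mnorm_def)

lemma mnorm_zero [simp]: "mnorm E 0 = 0"
  by (simp add: mnorm_def zero_mem)

lemma mnorm_eq_zero: "x \<in> mcarrier E \<Longrightarrow> mnorm E x = 0 \<Longrightarrow> x = 0"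
  by (simp add: mnorm_def inner_definite)

lemma mnorm_scaleC: "x \<in> mcarrier E \<Longrightarrow> mnorm E (c *\<^sub>C x) = cmod c * mnorm E x"
  by (simp add: mnorm_def inner_scaleC_left inner_scaleC_right scaleC_mem norm_scaleC scaleC_scaleC
      norm_mult real_sqrt_mult)

lemma mnorm_minus: "x \<in> mcarrier E \<Longrightarrow> mnorm E (- x) = mnorm E x"
  by (simp add: mnorm_def inner_minus_left inner_minus_right uminus_mem)

lemma mnorm_diff_commute: "\<lbrakk>x \<in> mcarrier E; y \<in> mcarrier E\<rbrakk> \<Longrightarrow> mnorm E (x - y) = mnorm E (y - x)"
  using mnorm_minus[of "y - x"] by (simp add: diff_mem)

text \<open>
  Expand the positive element \<open>\<langle>x a - s y | x a - s y\<rangle>\<close> for \<open>a = \<langle>x | y\<rangle>\<close> and \<open>s = \<parallel>x\<parallel>\<^sup>2\<close>, and estimate its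
  term \<open>a\<^sup>* \<langle>x | x\<rangle> a\<close> by \<open>s a\<^sup>* a\<close>.
\<close>

lemma Cauchy_Schwarz:
  assumes x: "x \<in> mcarrier E" and y: "y \<in> mcarrier E"
  shows "norm (minner E x y) \<le> mnorm E x * mnorm E y"
proof (cases "mnorm E x = 0")
  case True
  then have "x = 0" using mnorm_eq_zero x by simp
  then show ?thesis using y by simp
next
  case False
  define a where "a = minner E x y"
  define p where "p = minner E x x"
  define s where "s = norm p"
  have s: "s > 0" using False by (simp add: s_def p_def mnorm_def)
  have a': "minner E y x = star a" using star_inner[OF x y] by (simp add: a_def)
  let ?z = "mact E x a - complex_of_real s *\<^sub>C y"
  have z: "?z \<in> mcarrier E" using x y by (simp add: mem)
  have "minner E ?z ?z = star a * p * a - s *\<^sub>R (star a * a) - s *\<^sub>R (star a * a) + s *\<^sub>R s *\<^sub>R minner E y y"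
    using x y
    by (simp add: inner_diff_left inner_diff_right mem inner_act_left inner_act_right inner_scaleC_left
        inner_scaleC_right a' algebra_simps flip: a_def p_def scaleR_eq_scaleC)
  then have "(s *\<^sub>R s *\<^sub>R minner E y y - s *\<^sub>R (star a * a)) =
      minner E ?z ?z + (norm p *\<^sub>R (star a * a) - star a * p * a)"
    by (simp add: s_def)
  then have "cstar_pos (s *\<^sub>R s *\<^sub>R minner E y y - s *\<^sub>R (star a * a))"
    using inner_pos[OF z] cstar_pos_conjugate_le[OF inner_pos[OF x], of a] cstar_pos_add
    by (simp add: p_def)
  moreover have "cstar_pos (s *\<^sub>R (star a * a))"
    using s by (intro cstar_pos_scaleR) (auto simp: cstar_pos_def)
  ultimately have "norm (s *\<^sub>R (star a * a)) \<le> norm (s *\<^sub>R s *\<^sub>R minner E y y)"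
    using norm_le_norm_add[of "s *\<^sub>R (star a * a)" "s *\<^sub>R s *\<^sub>R minner E y y - s *\<^sub>R (star a * a)"] by simp
  then have "(norm a)\<^sup>2 \<le> s * norm (minner E y y)"
    using s by (simp add: cstar_identity)
  also have "\<dots> = (mnorm E x * mnorm E y)\<^sup>2"
    by (simp add: power_mult_distrib mnorm_power2 s_def p_def)
  finally show ?thesis unfolding a_def by (rule power2_le_imp_le) simp
qed

lemma mnorm_triangle:
  assumes x: "x \<in> mcarrier E" and y: "y \<in> mcarrier E"
  shows "mnorm E (x + y) \<le> mnorm E x + mnorm E y"
proof (rule power2_le_imp_le)
  have "(mnorm E (x + y))\<^sup>2 = norm (minner E x x + minner E y x + (minner E x y + minner E y y))"
    using x y by (simp add: mnorm_power2 inner_add_left inner_add_right add_mem)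
  also have "\<dots> \<le> norm (minner E x x) + norm (minner E y x) + (norm (minner E x y) + norm (minner E y y))"
    by (intro norm_triangle_mono order_refl)
  also have "\<dots> \<le> (mnorm E x)\<^sup>2 + mnorm E y * mnorm E x + (mnorm E x * mnorm E y + (mnorm E y)\<^sup>2)"
    using Cauchy_Schwarz x y by (intro add_mono) (simp_all add: mnorm_power2)
  also have "\<dots> = (mnorm E x + mnorm E y)\<^sup>2" by (simp add: power2_sum)
  finally show "(mnorm E (x + y))\<^sup>2 \<le> (mnorm E x + mnorm E y)\<^sup>2" .
qed simp

lemma mnorm_triangle_diff:
  assumes "x \<in> mcarrier E" "y \<in> mcarrier E"
  shows "mnorm E (x - y) \<le> mnorm E x + mnorm E y"
  using mnorm_triangle[of x "- y"] assms by (simp add: uminus_mem mnorm_minus)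

lemma mnorm_triangle_via:
  assumes "x \<in> mcarrier E" "y \<in> mcarrier E" "z \<in> mcarrier E"
  shows "mnorm E (x - z) \<le> mnorm E (x - y) + mnorm E (y - z)"
  using mnorm_triangle[of "x - y" "y - z"] assms by (simp add: diff_mem)

lemma eq_if_inner_eq:
  assumes "x \<in> mcarrier E" "y \<in> mcarrier E" "\<And>z. z \<in> mcarrier E \<Longrightarrow> minner E z x = minner E z y"
  shows "x = y"
  using inner_definite[of "x - y"] assms by (simp add: inner_diff_right diff_mem)

lemma orthogonal_to_dense:
  assumes S: "mdense E S" and x: "x \<in> mcarrier E" and orth: "\<And>y. y \<in> S \<Longrightarrow> minner E y x = 0"
  shows "x = 0"
proof (rule mnorm_eq_zero[OF x], rule ccontr)
  assume "mnorm E x \<noteq> 0"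
  then have "mnorm E x > 0" using mnorm_nonneg[of x] by linarith
  then obtain y where y: "y \<in> S" "mnorm E (x - y) < mnorm E x" using S x unfolding mdense_def by blast
  then have yE: "y \<in> mcarrier E" using S by (auto simp: mdense_def)
  have "(mnorm E x)\<^sup>2 = norm (minner E (x - y) x)"
    using x yE orth[OF y(1)] by (simp add: mnorm_power2 inner_diff_left)
  also have "\<dots> \<le> mnorm E (x - y) * mnorm E x" using x yE by (intro Cauchy_Schwarz diff_mem)
  also have "\<dots> < mnorm E x * mnorm E x" using y \<open>mnorm E x > 0\<close> by simp
  finally show False by (simp add: power2_eq_square)
qed

lemma mtendsto_inner:
  assumes X: "mtendsto E X x" "\<And>n. X n \<in> mcarrier E" and x: "x \<in> mcarrier E" and y: "y \<in> mcarrier E"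
  shows "(\<lambda>n. minner E y (X n)) \<longlonglongrightarrow> minner E y x"
proof -
  have "(\<lambda>n. mnorm E y * mnorm E (X n - x)) \<longlonglongrightarrow> mnorm E y * 0"
    using X by (intro tendsto_mult_left) (simp add: mtendsto_def)
  then have "(\<lambda>n. mnorm E y * mnorm E (X n - x)) \<longlonglongrightarrow> 0" by simp
  then have "(\<lambda>n. minner E y (X n) - minner E y x) \<longlonglongrightarrow> 0"
    by (rule Lim_null_comparison[rotated])
      (use Cauchy_Schwarz[OF y diff_mem[OF X(2) x]] inner_diff_right[OF y X(2) x] in simp)
  then show ?thesis by (simp add: LIM_zero_iff)
qed

lemma mtendsto_unique:
  assumes X: "mtendsto E X x" "mtendsto E X y" "\<And>n. X n \<in> mcarrier E"
    and x: "x \<in> mcarrier E" and y: "y \<in> mcarrier E"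
  shows "x = y"
  by (rule eq_if_inner_eq[OF x y])
    (rule LIMSEQ_unique[OF mtendsto_inner[OF X(1,3) x] mtendsto_inner[OF X(2,3) y]])

lemma geometric_limit:
  assumes X: "\<And>n. X n \<in> mcarrier E" and step: "\<And>n. mnorm E (X (Suc n) - X n) \<le> C * r ^ n"
    and r: "0 \<le> r" "r < 1"
  obtains x where "x \<in> mcarrier E" "mtendsto E X x" "\<And>n. mnorm E (x - X n) \<le> C * r ^ n / (1 - r)"
proof -
  have C: "C \<ge> 0" using order_trans[OF mnorm_nonneg step[of 0]] by simp
  have part: "mnorm E (X (n + k) - X n) \<le> C * r ^ n * (1 - r ^ k) / (1 - r)" for n k
  proof (induction k)
    case (Suc k)
    have "mnorm E (X (n + Suc k) - X n) \<le> mnorm E (X (Suc (n + k)) - X (n + k)) + mnorm E (X (n + k) - X n)"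
      using mnorm_triangle_via[OF X X X] by simp
    also have "\<dots> \<le> C * r ^ (n + k) + C * r ^ n * (1 - r ^ k) / (1 - r)"
      using step Suc by (intro add_mono) auto
    also have "\<dots> = C * r ^ n * (1 - r ^ Suc k) / (1 - r)"
      using r by (simp add: power_add field_simps)
    finally show ?case .
  qed (simp)
  have tail: "mnorm E (X m - X n) \<le> C * r ^ n / (1 - r)" if "m \<ge> n" for m n
  proof -
    have "mnorm E (X m - X n) \<le> C * r ^ n * (1 - r ^ (m - n)) / (1 - r)"
      using part[of n "m - n"] that by simp
    also have "\<dots> \<le> C * r ^ n * 1 / (1 - r)"
      using C r by (intro divide_right_mono mult_left_mono) auto
    finally show ?thesis by simp
  qed
  have lim: "(\<lambda>n. C * r ^ n / (1 - r)) \<longlonglongrightarrow> 0"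
    using tendsto_mult_right_zero[OF LIMSEQ_power_zero[of r], of "C / (1 - r)"] r by simp
  have "mCauchy E X" unfolding mCauchy_def
  proof (intro allI impI)
    fix e :: real assume "e > 0"
    then obtain M where M: "\<And>n. n \<ge> M \<Longrightarrow> C * r ^ n / (1 - r) < e"
      using lim[THEN order_tendstoD(2), of e] by (auto simp: eventually_sequentially)
    have "mnorm E (X m - X n) < e" if "m \<ge> M" "n \<ge> M" for m n
    proof (cases "m \<ge> n")
      case True
      then show ?thesis using tail[OF True] M[OF that(2)] by simp
    next
      case False
      then show ?thesis using tail[of m n] M[OF that(1)] mnorm_diff_commute[OF X X, of m n] by simp
    qed
    then show "\<exists>M. \<forall>m\<ge>M. \<forall>n\<ge>M. mnorm E (X m - X n) < e" by blast
  qed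
  then obtain x where x: "x \<in> mcarrier E" "mtendsto E X x" using complete[of X] X by blast
  have "mnorm E (x - X n) \<le> C * r ^ n / (1 - r)" for n
  proof (rule tendsto_lowerbound)
    have "(\<lambda>m. mnorm E (X m - x) + C * r ^ n / (1 - r)) \<longlonglongrightarrow> 0 + C * r ^ n / (1 - r)"
      using x by (intro tendsto_add) (simp_all add: mtendsto_def)
    then show "(\<lambda>m. mnorm E (X m - x) + C * r ^ n / (1 - r)) \<longlonglongrightarrow> C * r ^ n / (1 - r)" by simp
    show "\<forall>\<^sub>F m in sequentially. mnorm E (x - X n) \<le> mnorm E (X m - x) + C * r ^ n / (1 - r)"
    proof (rule eventually_sequentiallyI)
      fix m assume "n \<le> m"
      then show "mnorm E (x - X n) \<le> mnorm E (X m - x) + C * r ^ n / (1 - r)"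
        using mnorm_triangle_via[OF x(1) X[of m] X[of n]] tail[of n m] mnorm_diff_commute[OF x(1) X, of m] by simp
    qed
  qed simp
  then show thesis using that x by blast
qed

lemma contraction_fixpoint:
  assumes f: "\<And>x. x \<in> mcarrier E \<Longrightarrow> f x \<in> mcarrier E"
    and contr: "\<And>x y. \<lbrakk>x \<in> mcarrier E; y \<in> mcarrier E\<rbrakk> \<Longrightarrow> mnorm E (f x - f y) \<le> r * mnorm E (x - y)"
    and r: "0 \<le> r" "r < 1"
  obtains x where "x \<in> mcarrier E" "f x = x"
proof -
  define X where "X n = (f ^^ n) 0" for n
  have X: "X n \<in> mcarrier E" for n by (induction n) (simp_all add: X_def zero_mem f)
  have XS: "X (Suc n) = f (X n)" for n by (simp add: X_def)
  have step: "mnorm E (X (Suc n) - X n) \<le> mnorm E (X 1 - X 0) * r ^ n" for n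
  proof (induction n)
    case (Suc n)
    have "mnorm E (X (Suc (Suc n)) - X (Suc n)) \<le> r * mnorm E (X (Suc n) - X n)"
      using contr[OF X[of "Suc n"] X[of n]] by (simp only: XS)
    also have "\<dots> \<le> r * (mnorm E (X 1 - X 0) * r ^ n)" by (rule mult_left_mono[OF Suc r(1)])
    finally show ?case by (simp add: mult_ac)
  qed simp
  obtain x where x: "x \<in> mcarrier E" "mtendsto E X x" by (rule geometric_limit[OF X step r]) blast
  have "mtendsto E (\<lambda>n. X (Suc n)) (f x)" unfolding mtendsto_def
  proof (rule Lim_null_comparison)
    show "\<forall>\<^sub>F n in sequentially. norm (mnorm E (X (Suc n) - f x)) \<le> r * mnorm E (X n - x)"
      using contr[OF X x(1)] by (simp add: XS)
    show "(\<lambda>n. r * mnorm E (X n - x)) \<longlonglongrightarrow> 0"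
      using tendsto_mult_left[of "\<lambda>n. mnorm E (X n - x)" 0 sequentially r] x(2) by (simp add: mtendsto_def)
  qed
  moreover have "mtendsto E (\<lambda>n. X (Suc n)) x"
    using x(2) LIMSEQ_Suc by (auto simp: mtendsto_def)
  ultimately have "f x = x" using mtendsto_unique X f x(1) by blast
  with x that show thesis by blast
qed

end

section \<open>Adjointable and compact operators\<close>

text \<open>
  Adjointability with the adjoint as an explicit, symmetric datum.
\<close>

definition adjoints :: "('a::cstar_algebra, 'e::complex_vector) hmodule
    \<Rightarrow> ('a, 'f::complex_vector) hmodule \<Rightarrow> ('e \<Rightarrow> 'f) \<Rightarrow> ('f \<Rightarrow> 'e) \<Rightarrow> bool"
  where "adjoints E F T S \<longleftrightarrow> T \<in> mcarrier E \<rightarrow> mcarrier F \<and> S \<in> mcarrier F \<rightarrow> mcarrier E \<and>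
    (\<forall>x\<in>mcarrier E. \<forall>y\<in>mcarrier F. minner F (T x) y = minner E x (S y))"

lemma adjointable_iff_adjoints: "adjointable E F T \<longleftrightarrow> (\<exists>S. adjoints E F T S)"
  by (auto simp: adjointable_def adjoints_def)

lemma adjoints_mem: "adjoints E F T S \<Longrightarrow> x \<in> mcarrier E \<Longrightarrow> T x \<in> mcarrier F"
  by (auto simp: adjoints_def)

lemma adjoints_inner: "\<lbrakk>adjoints E F T S; x \<in> mcarrier E; y \<in> mcarrier F\<rbrakk> \<Longrightarrow>
    minner F (T x) y = minner E x (S y)"
  by (auto simp: adjoints_def)

locale hilbert_module_pair = E: hilbert_module E + F: hilbert_module F
  for E :: "('a::cstar_algebra, 'e::complex_vector) hmodule"
    and F :: "('a, 'f::complex_vector) hmodule"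
begin

lemma adjoints_sym:
  assumes "adjoints E F T S" shows "adjoints F E S T"
  unfolding adjoints_def
proof (intro conjI ballI)
  fix y x assume yx: "y \<in> mcarrier F" "x \<in> mcarrier E"
  then have "minner F (T x) y = minner E x (S y)" "T x \<in> mcarrier F" "S y \<in> mcarrier E"
    using assms by (auto simp: adjoints_def)
  then show "minner E (S y) x = minner F y (T x)"
    using yx by (metis E.star_inner F.star_inner)
qed (use assms in \<open>auto simp: adjoints_def\<close>)

lemma adjoints_inner': "\<lbrakk>adjoints E F T S; x \<in> mcarrier E; y \<in> mcarrier F\<rbrakk> \<Longrightarrow>
    minner F y (T x) = minner E (S y) x"
  using adjoints_inner[OF adjoints_sym] by metis

lemma adjoints_add:
  assumes T: "adjoints E F T S" and "x \<in> mcarrier E" "y \<in> mcarrier E"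
  shows "T (x + y) = T x + T y"
  by (rule F.eq_if_inner_eq)
    (use assms adjoints_mem[OF adjoints_sym[OF T]] in
      \<open>simp_all add: adjoints_mem E.add_mem F.add_mem adjoints_inner'[OF T] F.inner_add_right E.inner_add_right\<close>)

lemma adjoints_scaleC:
  assumes T: "adjoints E F T S" and "x \<in> mcarrier E"
  shows "T (c *\<^sub>C x) = c *\<^sub>C T x"
  by (rule F.eq_if_inner_eq)
    (use assms adjoints_mem[OF adjoints_sym[OF T]] in
      \<open>simp_all add: adjoints_mem E.mem F.mem adjoints_inner'[OF T] F.inner_scaleC_right E.inner_scaleC_right\<close>)

lemma adjoints_act:
  assumes T: "adjoints E F T S" and "x \<in> mcarrier E"
  shows "T (mact E x a) = mact F (T x) a"
  by (rule F.eq_if_inner_eq)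
    (use assms adjoints_mem[OF adjoints_sym[OF T]] in
      \<open>simp_all add: adjoints_mem E.mem F.mem adjoints_inner'[OF T] F.inner_act_right E.inner_act_right\<close>)

lemma adjoints_zero: "adjoints E F T S \<Longrightarrow> T 0 = 0"
  using adjoints_add[of T S 0 0] E.zero_mem by simp

lemma adjoints_diff:
  assumes T: "adjoints E F T S" and "x \<in> mcarrier E" "y \<in> mcarrier E"
  shows "T (x - y) = T x - T y"
  using adjoints_add[OF T, of "x - y" y] assms by (simp add: E.diff_mem)

text \<open>
  Uniform boundedness for the functionals \<open>\<lambda>x. \<langle>T z | x\<rangle> = \<langle>z | S x\<rangle>\<close> with \<open>\<parallel>z\<parallel> \<le> 1\<close>, which are pointwise bounded
  by \<open>\<parallel>S x\<parallel>\<close>. If \<open>T\<close> were unbounded, a gliding hump would produce a point where they are not.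
\<close>

lemma adjoints_bounded:
  assumes T: "adjoints E F T S"
  obtains c where "c \<ge> 0" "\<And>x. x \<in> mcarrier E \<Longrightarrow> mnorm F (T x) \<le> c * mnorm E x"
proof (rule ccontr)
  note S = adjoints_sym[OF T] and bounded = that
  assume neg: "\<not> thesis"
  have "\<exists>z\<in>mcarrier E. mnorm E z \<le> 1 \<and> mnorm F (T z) \<ge> 8 ^ n" for n :: nat
  proof -
    obtain z where z: "z \<in> mcarrier E" "mnorm F (T z) > 8 ^ n * mnorm E z"
      using neg bounded[of "8 ^ n"] by (meson linorder_not_le zero_le_numeral zero_le_power)
    have "mnorm E z \<noteq> 0"
    proof
      assume "mnorm E z = 0"
      then have "z = 0" using E.mnorm_eq_zero z by blast
      then show False using z(2) adjoints_zero[OF T] by simp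
    qed
    then have pos: "mnorm E z > 0" using E.mnorm_nonneg[of z] by linarith
    let ?c = "complex_of_real (inverse (mnorm E z))"
    have "mnorm E (?c *\<^sub>C z) = 1" using pos z E.mnorm_scaleC[OF z(1), of ?c] by (simp add: norm_inverse)
    moreover have "mnorm F (T (?c *\<^sub>C z)) = mnorm F (T z) / mnorm E z"
      using pos z by (simp add: adjoints_scaleC[OF T] F.mnorm_scaleC adjoints_mem[OF T] norm_inverse divide_inverse_commute)
    moreover have "8 ^ n \<le> mnorm F (T z) / mnorm E z" using z(2) pos by (simp add: field_simps)
    ultimately show ?thesis using E.scaleC_mem[OF z(1), of ?c] by (intro bexI[of _ "?c *\<^sub>C z"]) auto
  qed
  then obtain z where z: "\<And>n. z n \<in> mcarrier E" "\<And>n. mnorm E (z n) \<le> 1" "\<And>n. mnorm F (T (z n)) \<ge> 8 ^ n"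
    by metis
  have Tz: "T (z n) \<in> mcarrier F" for n using z adjoints_mem[OF T] by blast
  have Tpos: "mnorm F (T (z n)) > 0" for n
    using z(3)[of n] by (meson less_le_trans zero_less_numeral zero_less_power)
  \<comment> \<open>Step \<open>n\<close> adds \<open>h n\<close> whenever this is needed to make \<open>f n\<close> at least half as large as at \<open>h n\<close>. The
    later steps add up to \<open>(1/4)\<^sup>n / 3\<close>, less than one half of \<open>\<parallel>h n\<parallel>\<close>, and cannot destroy this.\<close>
  define h where "h n = complex_of_real ((1/4) ^ n / mnorm F (T (z n))) *\<^sub>C T (z n)" for n
  have h: "h n \<in> mcarrier F" for n by (simp add: h_def F.scaleC_mem Tz)
  have h_norm: "mnorm F (h n) = (1/4) ^ n" for n
    using Tpos[of n] by (simp add: h_def F.mnorm_scaleC Tz norm_divide norm_power)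
  define f where "f n x = minner F (T (z n)) x" for n x
  have f_h: "norm (f n (h n)) = (1/4) ^ n * mnorm F (T (z n))" for n
  proof -
    have "norm (f n (h n)) = (1/4) ^ n / mnorm F (T (z n)) * (mnorm F (T (z n)))\<^sup>2"
      using Tpos[of n] unfolding f_def h_def F.inner_scaleC_right[OF Tz Tz] norm_scaleC norm_of_real
      by (simp add: F.mnorm_power2)
    then show ?thesis using Tpos[of n] by (simp add: power2_eq_square)
  qed
  have f_diff: "f n (x - y) = f n x - f n y" "f n (x + y) = f n x + f n y"
    if "x \<in> mcarrier F" "y \<in> mcarrier F" for n x y
    using that by (simp_all add: f_def F.inner_diff_right F.inner_add_right Tz)
  have f_le: "norm (f n x) \<le> mnorm F (T (z n)) * mnorm F x" if "x \<in> mcarrier F" for n x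
    using F.Cauchy_Schwarz[OF Tz that] by (simp add: f_def)
  have f_bounded: "norm (f n x) \<le> mnorm E (S x)" if "x \<in> mcarrier F" for n x
  proof -
    have "f n x = minner E (z n) (S x)" using adjoints_inner[OF T z(1) that] by (simp add: f_def)
    then have "norm (f n x) \<le> mnorm E (z n) * mnorm E (S x)"
      using E.Cauchy_Schwarz[OF z(1) adjoints_mem[OF S that]] by simp
    also have "\<dots> \<le> 1 * mnorm E (S x)" using z(2) by (intro mult_right_mono) auto
    finally show ?thesis by simp
  qed
  define X where "X = rec_nat 0 (\<lambda>n x. if norm (f n x) \<ge> norm (f n (h n)) / 2 then x else x + h n)"
  have X0: "X 0 = 0" and XS: "X (Suc n) = (if norm (f n (X n)) \<ge> norm (f n (h n)) / 2 then X n else X n + h n)" for n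
    by (simp_all add: X_def)
  have X: "X n \<in> mcarrier F" for n by (induction n) (simp_all add: X0 XS F.zero_mem F.add_mem h)
  have step: "mnorm F (X (Suc n) - X n) \<le> 1 * (1/4) ^ n" for n by (simp add: XS h_norm)
  obtain x where x: "x \<in> mcarrier F" and tail: "\<And>n. mnorm F (x - X n) \<le> 1 * (1/4) ^ n / (1 - 1/4)"
    by (rule F.geometric_limit[OF X step]) auto
  have large: "norm (f n (X (Suc n))) \<ge> norm (f n (h n)) / 2" for n
  proof (cases "norm (f n (X n)) \<ge> norm (f n (h n)) / 2")
    case False
    then show ?thesis
      using norm_triangle_ineq2[of "f n (h n)" "- f n (X n)"] by (simp add: XS f_diff X h add.commute)
  qed (simp add: XS)
  have growth: "2 ^ n / 6 \<le> mnorm E (S x)" for n :: nat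
  proof -
    let ?M = "mnorm F (T (z n))"
    have "norm (f n x) \<ge> norm (f n (X (Suc n))) - norm (f n (x - X (Suc n)))"
      using norm_triangle_ineq2[of "f n (X (Suc n))" "f n (X (Suc n)) - f n x"]
      by (simp add: f_diff x X norm_minus_commute)
    moreover have "norm (f n (x - X (Suc n))) \<le> (1/4) ^ n * ?M / 3"
    proof -
      have "norm (f n (x - X (Suc n))) \<le> ?M * mnorm F (x - X (Suc n))" by (rule f_le[OF F.diff_mem[OF x X]])
      also have "\<dots> \<le> ?M * ((1/4) ^ n / 3)" using tail[of "Suc n"] by (intro mult_left_mono) auto
      finally show ?thesis by (simp add: mult.commute)
    qed
    moreover note large[of n] f_h[of n] f_bounded[OF x, of n]
    ultimately have "(1/4) ^ n * ?M / 6 \<le> mnorm E (S x)" by simp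
    moreover have "(2::real) ^ n / 6 = (1/4) ^ n * 8 ^ n / 6" by (simp flip: power_mult_distrib)
    moreover have "(1/4) ^ n * 8 ^ n / 6 \<le> (1/4) ^ n * ?M / 6"
      by (intro divide_right_mono mult_left_mono z) auto
    ultimately show ?thesis by linarith
  qed
  obtain n :: nat where "6 * mnorm E (S x) < 2 ^ n" using real_arch_pow[of 2] by auto
  with growth[of n] show False by simp
qed

end

lemma adjoints_comp:
  "adjoints E F T S \<Longrightarrow> adjoints F G U V \<Longrightarrow> adjoints E G (\<lambda>x. U (T x)) (\<lambda>y. S (V y))"
  by (auto simp: adjoints_def Pi_iff)

lemma adjointable_comp:
  "adjointable E F T \<Longrightarrow> adjointable F G U \<Longrightarrow> adjointable E G (\<lambda>x. U (T x))"
proof -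
  assume "adjointable E F T" "adjointable F G U"
  then obtain S V where "adjoints E F T S" "adjoints F G U V" by (auto simp: adjointable_iff_adjoints)
  from adjoints_comp[OF this] show ?thesis by (auto simp: adjointable_iff_adjoints)
qed

lemma adjoints_id: "adjoints E E (\<lambda>x. x) (\<lambda>x. x)"
  by (auto simp: adjoints_def)

lemma theta_span_mem: "S \<in> theta_span E F \<Longrightarrow> hilbert_module F \<Longrightarrow> S z \<in> mcarrier F"
  by (induction rule: theta_span.induct)
    (auto simp: theta_def hilbert_module.act_mem hilbert_module.add_mem hilbert_module.scaleC_mem
      hilbert_module.zero_mem scaleC_fun_def)

lemma adjointable_bounded:
  assumes "hilbert_module E" "hilbert_module F" "adjointable E F T"
  obtains c where "c \<ge> 0" "\<And>x. x \<in> mcarrier E \<Longrightarrow> mnorm F (T x) \<le> c * mnorm E x"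
proof -
  interpret hilbert_module_pair E F using assms by (simp add: hilbert_module_pair_def)
  obtain S where "adjoints E F T S" using assms by (auto simp: adjointable_iff_adjoints)
  then show thesis using adjoints_bounded that by blast
qed

context hilbert_module_pair
begin

lemma adjoints_op_add:
  assumes "adjoints E F T S" "adjoints E F U V"
  shows "adjoints E F (\<lambda>x. T x + U x) (\<lambda>y. S y + V y)"
  using assms by (auto simp: adjoints_def Pi_iff E.mem F.mem F.inner_add_left E.inner_add_right)

lemma adjoints_op_uminus: "adjoints E F T S \<Longrightarrow> adjoints E F (\<lambda>x. - T x) (\<lambda>y. - S y)"
  by (auto simp: adjoints_def Pi_iff E.mem F.mem F.inner_minus_left E.inner_minus_right)

lemma adjoints_op_diff:
  assumes "adjoints E F T S" "adjoints E F U V"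
  shows "adjoints E F (\<lambda>x. T x - U x) (\<lambda>y. S y - V y)"
  using adjoints_op_add[OF assms(1) adjoints_op_uminus[OF assms(2)]] by simp

lemma adjoints_op_zero: "adjoints E F (\<lambda>x. 0) (\<lambda>y. 0)"
  by (auto simp: adjoints_def E.mem F.mem)

lemma compact_op_zero: "compact_op E F (\<lambda>x. 0)"
  unfolding compact_op_def
proof (intro conjI allI impI)
  show "adjointable E F (\<lambda>x. 0)" using adjoints_op_zero adjointable_iff_adjoints by blast
  fix e :: real assume "e > 0"
  then show "\<exists>S\<in>theta_span E F. \<forall>z\<in>mcarrier E. mnorm F (0 - S z) \<le> e * mnorm E z"
    by (intro bexI[OF _ theta_span_zero]) simp
qed

lemma compact_op_add:
  assumes K: "compact_op E F K" and L: "compact_op E F L"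
  shows "compact_op E F (\<lambda>x. K x + L x)"
  unfolding compact_op_def
proof (intro conjI allI impI)
  show "adjointable E F (\<lambda>x. K x + L x)"
    using K L adjoints_op_add by (meson adjointable_iff_adjoints compact_op_def)
  fix e :: real assume e: "e > 0"
  obtain S where S: "S \<in> theta_span E F" "\<And>z. z \<in> mcarrier E \<Longrightarrow> mnorm F (K z - S z) \<le> e / 2 * mnorm E z"
    using K e unfolding compact_op_def by (meson half_gt_zero)
  obtain S' where S': "S' \<in> theta_span E F" "\<And>z. z \<in> mcarrier E \<Longrightarrow> mnorm F (L z - S' z) \<le> e / 2 * mnorm E z"
    using L e unfolding compact_op_def by (meson half_gt_zero)
  have "mnorm F (K z + L z - (S + S') z) \<le> e * mnorm E z" if z: "z \<in> mcarrier E" for z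
  proof -
    have m: "K z \<in> mcarrier F" "L z \<in> mcarrier F" "S z \<in> mcarrier F" "S' z \<in> mcarrier F"
      using K L z S(1) S'(1) theta_span_mem F.hilbert_module_axioms
      by (auto simp: compact_op_def adjointable_def)
    have "K z + L z - (S + S') z = (K z - S z) + (L z - S' z)" by simp
    then have "mnorm F (K z + L z - (S + S') z) \<le> mnorm F (K z - S z) + mnorm F (L z - S' z)"
      using F.mnorm_triangle[of "K z - S z" "L z - S' z"] m by (simp only: F.mem)
    then show ?thesis using S(2)[OF z] S'(2)[OF z] by (simp add: field_simps)
  qed
  then show "\<exists>S\<in>theta_span E F. \<forall>z\<in>mcarrier E. mnorm F (K z + L z - S z) \<le> e * mnorm E z"
    using theta_span_add[OF S(1) S'(1)] by blast
qed

lemma compact_op_sum: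
  assumes "\<And>i. i \<in> I \<Longrightarrow> compact_op E F (K i)"
  shows "compact_op E F (\<lambda>x. \<Sum>i\<in>I. K i x)"
  using assms by (induction I rule: infinite_finite_induct) (simp_all add: compact_op_zero compact_op_add)

end

lemma compact_op_comp_left:
  assumes hm: "hilbert_module E" "hilbert_module F" "hilbert_module G"
    and K: "compact_op E F K" and A: "adjointable F G A"
  shows "compact_op E G (\<lambda>x. A (K x))"
  unfolding compact_op_def
proof (intro conjI allI impI)
  interpret F: hilbert_module F by (rule hm)
  interpret FG: hilbert_module_pair F G using hm by (simp add: hilbert_module_pair_def)
  show "adjointable E G (\<lambda>x. A (K x))" using K A by (simp add: compact_op_def adjointable_comp[of E F K G A])
  obtain B where B: "adjoints F G A B" using A by (auto simp: adjointable_iff_adjoints)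
  obtain c where c: "c \<ge> 0" "\<And>x. x \<in> mcarrier F \<Longrightarrow> mnorm G (A x) \<le> c * mnorm F x"
    using FG.adjoints_bounded[OF B] by blast
  fix e :: real assume e: "e > 0"
  then have "e / (c + 1) > 0" using c by simp
  then obtain S where S: "S \<in> theta_span E F"
      "\<And>z. z \<in> mcarrier E \<Longrightarrow> mnorm F (K z - S z) \<le> e / (c + 1) * mnorm E z"
    using K unfolding compact_op_def by meson
  have "(\<lambda>z. A (S z)) \<in> theta_span E G"
    using S(1)
  proof induction
    case theta_span_zero
    have "(\<lambda>z. A (0 z)) = 0" using FG.adjoints_zero[OF B] by (simp add: fun_eq_iff)
    show ?case unfolding \<open>(\<lambda>z. A (0 z)) = 0\<close> by (rule theta_span.theta_span_zero)
  next
    case (theta_span_theta x y)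
    have "(\<lambda>z. A (theta E F x y z)) = theta E G (A x) y"
      using FG.adjoints_act[OF B] theta_span_theta by (simp add: fun_eq_iff theta_def)
    then show ?case using theta_span.theta_span_theta adjoints_mem[OF B] theta_span_theta by metis
  next
    case (theta_span_add S T)
    have "(\<lambda>z. A ((S + T) z)) = (\<lambda>z. A (S z)) + (\<lambda>z. A (T z))"
      using FG.adjoints_add[OF B] theta_span_mem[OF theta_span_add(1) hm(2)]
        theta_span_mem[OF theta_span_add(2) hm(2)] by (simp add: fun_eq_iff)
    then show ?case using theta_span.theta_span_add theta_span_add by metis
  next
    case (theta_span_scaleC S c)
    have "(\<lambda>z. A ((c *\<^sub>C S) z)) = c *\<^sub>C (\<lambda>z. A (S z))"
      using FG.adjoints_scaleC[OF B] theta_span_mem[OF theta_span_scaleC(1) hm(2)]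
      by (simp add: fun_eq_iff scaleC_fun_def)
    then show ?case using theta_span.theta_span_scaleC theta_span_scaleC by metis
  qed
  moreover have "mnorm G (A (K z) - A (S z)) \<le> e * mnorm E z" if z: "z \<in> mcarrier E" for z
  proof -
    have m: "K z \<in> mcarrier F" "S z \<in> mcarrier F"
      using K z S(1) theta_span_mem hm(2) by (auto simp: compact_op_def adjointable_def)
    have "mnorm G (A (K z) - A (S z)) \<le> c * mnorm F (K z - S z)"
      using c(2)[of "K z - S z"] m by (simp add: FG.adjoints_diff[OF B] F.mem)
    also have "\<dots> \<le> c * (e / (c + 1) * mnorm E z)" by (rule mult_left_mono[OF S(2)[OF z] c(1)])
    also have "\<dots> = c / (c + 1) * (e * mnorm E z)" by simp
    also have "\<dots> \<le> 1 * (e * mnorm E z)"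
      using c e by (intro mult_right_mono) (auto simp: mnorm_def)
    finally show ?thesis by simp
  qed
  ultimately show "\<exists>S\<in>theta_span E G. \<forall>z\<in>mcarrier E. mnorm G (A (K z) - S z) \<le> e * mnorm E z"
    by (intro bexI[of _ "\<lambda>z. A (S z)"]) simp_all
qed

lemma compact_op_comp_right:
  assumes hm: "hilbert_module D" "hilbert_module E" "hilbert_module F"
    and K: "compact_op E F K" and A: "adjointable D E A"
  shows "compact_op D F (\<lambda>x. K (A x))"
  unfolding compact_op_def
proof (intro conjI allI impI)
  interpret DE: hilbert_module_pair D E using hm by (simp add: hilbert_module_pair_def)
  show "adjointable D F (\<lambda>x. K (A x))" using K A by (simp add: compact_op_def adjointable_comp[of D E A F K])
  obtain B where B: "adjoints D E A B" using A by (auto simp: adjointable_iff_adjoints)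
  obtain c where c: "c \<ge> 0" "\<And>x. x \<in> mcarrier D \<Longrightarrow> mnorm E (A x) \<le> c * mnorm D x"
    using DE.adjoints_bounded[OF B] by blast
  fix e :: real assume e: "e > 0"
  then have "e / (c + 1) > 0" using c by simp
  then obtain S where S: "S \<in> theta_span E F"
      "\<And>z. z \<in> mcarrier E \<Longrightarrow> mnorm F (K z - S z) \<le> e / (c + 1) * mnorm E z"
    using K unfolding compact_op_def by meson
  have "\<exists>S'\<in>theta_span D F. \<forall>z\<in>mcarrier D. S' z = S (A z)"
    using S(1)
  proof induction
    case theta_span_zero
    then show ?case by (intro bexI[OF _ theta_span.theta_span_zero]) simp
  next
    case (theta_span_theta x y)
    have "theta D F x (B y) z = theta E F x y (A z)" if "z \<in> mcarrier D" for z
      using DE.adjoints_inner'[OF B that theta_span_theta(2)] by (simp add: theta_def)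
    then show ?case
      using theta_span.theta_span_theta[OF theta_span_theta(1) adjoints_mem[OF DE.adjoints_sym[OF B] theta_span_theta(2)]]
      by blast
  next
    case (theta_span_add S T)
    then obtain S' T' where "S' \<in> theta_span D F" "\<forall>z\<in>mcarrier D. S' z = S (A z)"
      "T' \<in> theta_span D F" "\<forall>z\<in>mcarrier D. T' z = T (A z)" by blast
    then show ?case by (intro bexI[of _ "S' + T'"] theta_span.theta_span_add) simp_all
  next
    case (theta_span_scaleC S c)
    then obtain S' where "S' \<in> theta_span D F" "\<forall>z\<in>mcarrier D. S' z = S (A z)" by blast
    then show ?case
      by (intro bexI[of _ "c *\<^sub>C S'"] theta_span.theta_span_scaleC) (simp_all add: scaleC_fun_def)
  qed
  then obtain S' where S': "S' \<in> theta_span D F" "\<And>z. z \<in> mcarrier D \<Longrightarrow> S' z = S (A z)" by blast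
  have "mnorm F (K (A z) - S' z) \<le> e * mnorm D z" if z: "z \<in> mcarrier D" for z
  proof -
    have "mnorm F (K (A z) - S' z) \<le> e / (c + 1) * mnorm E (A z)"
      using S(2) S'(2) adjoints_mem[OF B] z by simp
    also have "\<dots> \<le> e / (c + 1) * (c * mnorm D z)"
      using c e z by (intro mult_left_mono) auto
    also have "\<dots> = c / (c + 1) * (e * mnorm D z)" by simp
    also have "\<dots> \<le> 1 * (e * mnorm D z)"
      using c e by (intro mult_right_mono) (auto simp: mnorm_def)
    finally show ?thesis by simp
  qed
  then show "\<exists>S\<in>theta_span D F. \<forall>z\<in>mcarrier D. mnorm F (K (A z) - S z) \<le> e * mnorm D z"
    using S'(1) by blast
qed

lemma (in hilbert_module_pair) compact_op_minus:
  assumes K: "compact_op E F K" shows "compact_op E F (\<lambda>x. - K x)"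
proof -
  interpret FF: hilbert_module_pair F F by unfold_locales
  have "adjointable F F (\<lambda>x. - x)" using FF.adjoints_op_uminus[OF adjoints_id] adjointable_iff_adjoints by blast
  from compact_op_comp_left[OF E.hilbert_module_axioms F.hilbert_module_axioms F.hilbert_module_axioms K this]
  show ?thesis .
qed

lemma (in hilbert_module_pair) compact_op_diff:
  assumes "compact_op E F K" "compact_op E F L" shows "compact_op E F (\<lambda>x. K x - L x)"
  using compact_op_add[OF assms(1) compact_op_minus[OF assms(2)]] by simp

section \<open>Finite direct sums\<close>

lemma dsum_carrier: "x \<in> mcarrier (dsum J E) \<longleftrightarrow> (\<forall>k\<in>J. x k \<in> mcarrier (E k)) \<and> (\<forall>k. k \<notin> J \<longrightarrow> x k = 0)"
  and dsum_act: "mact (dsum J E) x a = (\<lambda>k. if k \<in> J then mact (E k) (x k) a else 0)"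
  and dsum_inner: "minner (dsum J E) x y = (\<Sum>k\<in>J. minner (E k) (x k) (y k))"
  by (simp_all add: dsum_def)

definition single :: "int \<Rightarrow> 'e::zero \<Rightarrow> int \<Rightarrow> 'e"
  where "single k x = (\<lambda>j. if j = k then x else 0)"

locale finite_sum_modules =
  fixes J :: "int set" and E :: "int \<Rightarrow> ('a::cstar_algebra, 'e::complex_vector) hmodule"
  assumes finite_J: "finite J" and modules: "\<And>k. hilbert_module (E k)"
begin

text \<open>
  Monotonicity of the norm on the positive cone enters here: the square of the right-hand side is the
  norm of a sum of positive elements, one of which belongs to the left-hand side.
\<close>

lemma component_norm_le:
  assumes x: "\<And>k. k \<in> J \<Longrightarrow> x k \<in> mcarrier (E k)" and k: "k \<in> J"
  shows "mnorm (E k) (x k) \<le> mnorm (dsum J E) x"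
proof -
  have "minner (dsum J E) x x = minner (E k) (x k) (x k) + (\<Sum>j\<in>J - {k}. minner (E j) (x j) (x j))"
    unfolding dsum_inner by (rule sum.remove[OF finite_J k])
  moreover have "cstar_pos (minner (E k) (x k) (x k))" "cstar_pos (\<Sum>j\<in>J - {k}. minner (E j) (x j) (x j))"
    using x k hilbert_module.inner_pos[OF modules] by (auto intro!: cstar_pos_sum)
  ultimately have "norm (minner (E k) (x k) (x k)) \<le> norm (minner (dsum J E) x x)"
    using norm_le_norm_add by metis
  then show ?thesis by (simp add: mnorm_def)
qed

lemma mnorm_dsum_power2_le:
  "(mnorm (dsum J E) x)\<^sup>2 \<le> (\<Sum>k\<in>J. (mnorm (E k) (x k))\<^sup>2)"
  by (simp add: mnorm_def dsum_inner norm_sum)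

lemma mtendsto_dsum:
  assumes "\<And>k. k \<in> J \<Longrightarrow> mtendsto (E k) (\<lambda>n. X n k) (x k)"
  shows "mtendsto (dsum J E) X x"
proof -
  have "(\<lambda>n. \<Sum>k\<in>J. (mnorm (E k) (X n k - x k))\<^sup>2) \<longlonglongrightarrow> (\<Sum>k\<in>J. 0\<^sup>2)"
    using assms by (intro tendsto_sum tendsto_power) (simp add: mtendsto_def)
  then have lim: "(\<lambda>n. \<Sum>k\<in>J. (mnorm (E k) (X n k - x k))\<^sup>2) \<longlonglongrightarrow> 0" by simp
  have "(\<lambda>n. (mnorm (dsum J E) (X n - x))\<^sup>2) \<longlonglongrightarrow> 0"
    by (rule Lim_null_comparison[OF _ lim])
      (use mnorm_dsum_power2_le[of "X _ - x"] in simp)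
  then have "(\<lambda>n. sqrt ((mnorm (dsum J E) (X n - x))\<^sup>2)) \<longlonglongrightarrow> sqrt 0"
    by (rule tendsto_real_sqrt)
  then show ?thesis by (simp add: mtendsto_def mnorm_def)
qed

lemma hilbert_module_dsum: "hilbert_module (dsum J E)"
proof
  interpret M: hilbert_module "E k" for k by (rule modules)
  show "submodule (dsum J E) (mcarrier (dsum J E))"
    unfolding submodule_def subset_iff
    by (auto simp: dsum_carrier dsum_act M.mem scaleC_fun_def)
  fix x y z a b c
  assume x: "x \<in> mcarrier (dsum J E)"
  then show "mact (dsum J E) x (a + b) = mact (dsum J E) x a + mact (dsum J E) x b"
    and "mact (dsum J E) x (a * b) = mact (dsum J E) (mact (dsum J E) x a) b"
    and "mact (dsum J E) (c *\<^sub>C x) a = c *\<^sub>C mact (dsum J E) x a"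
    and "mact (dsum J E) x (c *\<^sub>C a) = c *\<^sub>C mact (dsum J E) x a"
    by (auto simp: dsum_carrier dsum_act M.act_add_right M.act_mult M.act_scaleC_left
        M.act_scaleC_right scaleC_fun_def fun_eq_iff)
  show "cstar_pos (minner (dsum J E) x x)"
    using x by (auto simp: dsum_carrier dsum_inner M.inner_pos intro!: cstar_pos_sum)
  show "x = 0" if "minner (dsum J E) x x = 0"
  proof
    fix k
    show "x k = 0 k"
    proof (cases "k \<in> J")
      case True
      then have "mnorm (E k) (x k) \<le> 0"
        using component_norm_le[of x k] x that by (simp add: dsum_carrier mnorm_def)
      then have "mnorm (E k) (x k) = 0" using M.mnorm_nonneg[of k "x k"] by linarith
      then show ?thesis using x True M.mnorm_eq_zero by (auto simp: dsum_carrier)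
    qed (use x in \<open>auto simp: dsum_carrier\<close>)
  qed
  assume y: "y \<in> mcarrier (dsum J E)"
  show "mact (dsum J E) (x + y) a = mact (dsum J E) x a + mact (dsum J E) y a"
    using x y by (auto simp: dsum_carrier dsum_act M.act_add_left fun_eq_iff)
  show "minner (dsum J E) x (c *\<^sub>C y) = c *\<^sub>C minner (dsum J E) x y"
    using x y by (simp add: dsum_carrier dsum_inner M.inner_scaleC_right scaleC_fun_def cv.scale_sum_right)
  show "minner (dsum J E) x (mact (dsum J E) y a) = minner (dsum J E) x y * a"
    using x y by (simp add: dsum_carrier dsum_inner dsum_act M.inner_act_right sum_distrib_right)
  show "star (minner (dsum J E) x y) = minner (dsum J E) y x"
    using x y
    by (simp add: dsum_carrier dsum_inner M.star_inner linear_sum[OF bounded_linear.linear[OF bounded_linear_star]])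
  assume z: "z \<in> mcarrier (dsum J E)"
  show "minner (dsum J E) x (y + z) = minner (dsum J E) x y + minner (dsum J E) x z"
    using x y z by (simp add: dsum_carrier dsum_inner M.inner_add_right sum.distrib)
next
  interpret M: hilbert_module "E k" for k by (rule modules)
  fix X :: "nat \<Rightarrow> int \<Rightarrow> 'e"
  assume X: "\<And>n. X n \<in> mcarrier (dsum J E)" and Cauchy: "mCauchy (dsum J E) X"
  have "\<exists>y\<in>mcarrier (E k). mtendsto (E k) (\<lambda>n. X n k) y" if k: "k \<in> J" for k
  proof (rule M.complete)
    show "X n k \<in> mcarrier (E k)" for n using X k by (simp add: dsum_carrier)
    have "mnorm (E k) (X m k - X n k) \<le> mnorm (dsum J E) (X m - X n)" for m n
      using component_norm_le[of "X m - X n" k] X k by (simp add: dsum_carrier M.diff_mem)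
    then show "mCauchy (E k) (\<lambda>n. X n k)"
      using Cauchy unfolding mCauchy_def by (meson order_le_less_trans)
  qed
  then obtain y where y: "\<And>k. k \<in> J \<Longrightarrow> y k \<in> mcarrier (E k) \<and> mtendsto (E k) (\<lambda>n. X n k) (y k)"
    by metis
  let ?x = "\<lambda>k. if k \<in> J then y k else 0"
  have "mtendsto (dsum J E) X ?x" by (rule mtendsto_dsum) (simp add: y)
  then show "\<exists>x\<in>mcarrier (dsum J E). mtendsto (dsum J E) X x"
    by (intro bexI[of _ ?x]) (simp_all add: dsum_carrier y)
qed

lemma single_mem:
  "x \<in> mcarrier (E k) \<Longrightarrow> k \<in> J \<or> x = 0 \<Longrightarrow> single k x \<in> mcarrier (dsum J E)"
  by (auto simp: dsum_carrier single_def hilbert_module.zero_mem[OF modules])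

lemma adjoints_single:
  assumes k: "k \<in> J" shows "adjoints (E k) (dsum J E) (single k) (\<lambda>x. x k)"
  unfolding adjoints_def
proof (intro conjI ballI)
  interpret M: hilbert_module "E j" for j by (rule modules)
  show "single k \<in> mcarrier (E k) \<rightarrow> mcarrier (dsum J E)"
  proof
    fix x assume "x \<in> mcarrier (E k)"
    then show "single k x \<in> mcarrier (dsum J E)" by (rule single_mem) (simp add: assms)
  qed
  show "(\<lambda>x. x k) \<in> mcarrier (dsum J E) \<rightarrow> mcarrier (E k)" using k by (auto simp: dsum_carrier)
  fix x y assume x: "x \<in> mcarrier (E k)" and y: "y \<in> mcarrier (dsum J E)"
  have "(\<Sum>j\<in>J. minner (E j) (single k x j) (y j)) = (\<Sum>j\<in>J. if j = k then minner (E k) x (y k) else 0)"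
    using y by (intro sum.cong) (auto simp: single_def dsum_carrier)
  then show "minner (dsum J E) (single k x) y = minner (E k) x (y k)"
    using k finite_J by (simp add: dsum_inner)
qed

lemma adjoints_component:
  assumes k: "k \<in> J" shows "adjoints (dsum J E) (E k) (\<lambda>x. x k) (single k)"
proof -
  interpret hilbert_module_pair "E k" "dsum J E"
    by (simp add: hilbert_module_pair_def modules hilbert_module_dsum)
  show ?thesis by (rule adjoints_sym[OF adjoints_single[OF k]])
qed

lemma mnorm_single_le:
  assumes x: "x \<in> mcarrier (E k)" shows "mnorm (dsum J E) (single k x) \<le> mnorm (E k) x"
proof (rule power2_le_imp_le)
  interpret M: hilbert_module "E j" for j by (rule modules)
  have "(\<Sum>j\<in>J. (mnorm (E j) (single k x j))\<^sup>2) = (\<Sum>j\<in>J. if j = k then (mnorm (E k) x)\<^sup>2 else 0)"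
    by (intro sum.cong) (auto simp: single_def)
  also have "\<dots> \<le> (mnorm (E k) x)\<^sup>2" using finite_J by simp
  finally show "(mnorm (dsum J E) (single k x))\<^sup>2 \<le> (mnorm (E k) x)\<^sup>2"
    using mnorm_dsum_power2_le[of "single k x"] by linarith
qed (simp add: mnorm_def)

definition diag :: "(int \<Rightarrow> 'e \<Rightarrow> 'e) \<Rightarrow> (int \<Rightarrow> 'e) \<Rightarrow> int \<Rightarrow> 'e"
  where "diag T x = (\<lambda>k. if k \<in> J then T k (x k) else 0)"

lemma adjoints_diag:
  assumes "\<And>k. k \<in> J \<Longrightarrow> adjoints (E k) (E k) (T k) (S k)"
  shows "adjoints (dsum J E) (dsum J E) (diag T) (diag S)"
  using assms by (auto simp: adjoints_def dsum_carrier diag_def dsum_inner Pi_iff intro!: sum.cong)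

lemma compact_op_diag:
  assumes K: "\<And>k. k \<in> J \<Longrightarrow> compact_op (E k) (E k) (K k)"
  shows "compact_op (dsum J E) (dsum J E) (diag K)"
proof -
  interpret hilbert_module_pair "dsum J E" "dsum J E"
    by (simp add: hilbert_module_pair_def hilbert_module_dsum)
  have "compact_op (dsum J E) (dsum J E) (\<lambda>x. single k (K k (x k)))" if k: "k \<in> J" for k
  proof -
    have "adjointable (dsum J E) (E k) (\<lambda>x. x k)" "adjointable (E k) (dsum J E) (single k)"
      using adjoints_single[OF k] adjoints_component[OF k] by (auto simp: adjointable_iff_adjoints)
    from compact_op_comp_left[OF modules modules hilbert_module_dsum K[OF k] this(2)] this(1)
    show ?thesis by (rule compact_op_comp_right[OF hilbert_module_dsum modules hilbert_module_dsum])
  qed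
  then have "compact_op (dsum J E) (dsum J E) (\<lambda>x. \<Sum>k\<in>J. single k (K k (x k)))"
    by (rule compact_op_sum)
  moreover have "(\<Sum>k\<in>J. single k (K k (x k))) = diag K x" for x
  proof
    fix j
    have "(\<Sum>k\<in>J. single k (K k (x k))) j = (\<Sum>k\<in>J. single k (K k (x k)) j)"
      by (induction J rule: infinite_finite_induct) simp_all
    also have "\<dots> = (\<Sum>k\<in>J. if k = j then K j (x j) else 0)"
      by (intro sum.cong) (auto simp: single_def)
    also have "\<dots> = diag K x j" using finite_J by (simp add: diag_def)
    finally show "(\<Sum>k\<in>J. single k (K k (x k))) j = diag K x j" .
  qed
  ultimately show ?thesis by simp
qed

end

context hilbert_module
begin

lemma mtendsto_imp_mCauchy:
  assumes X: "mtendsto E X x" "\<And>n. X n \<in> mcarrier E" "x \<in> mcarrier E"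
  shows "mCauchy E X"
  unfolding mCauchy_def
proof (intro allI impI)
  fix e :: real assume "e > 0"
  then obtain M where M: "\<And>n. n \<ge> M \<Longrightarrow> mnorm E (X n - x) < e / 2"
    using X(1) order_tendstoD(2)[of "\<lambda>n. mnorm E (X n - x)" 0 sequentially "e / 2"]
    by (auto simp: mtendsto_def eventually_sequentially)
  have "mnorm E (X m - X n) < e" if "m \<ge> M" "n \<ge> M" for m n
    using mnorm_triangle_via[OF X(2)[of m] X(3) X(2)[of n]] mnorm_diff_commute[OF X(3) X(2)[of n]]
      M[OF that(1)] M[OF that(2)] by linarith
  then show "\<exists>M. \<forall>m\<ge>M. \<forall>n\<ge>M. mnorm E (X m - X n) < e" by blast
qed

lemma mtendsto_diff:
  assumes X: "mtendsto E X x" "\<And>n. X n \<in> mcarrier E" "x \<in> mcarrier E"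
    and Y: "mtendsto E Y y" "\<And>n. Y n \<in> mcarrier E" "y \<in> mcarrier E"
  shows "mtendsto E (\<lambda>n. X n - Y n) (x - y)"
proof -
  have "(\<lambda>n. mnorm E (X n - x) + mnorm E (Y n - y)) \<longlonglongrightarrow> 0 + 0"
    using X(1) Y(1) by (intro tendsto_add) (simp_all add: mtendsto_def)
  then have lim: "(\<lambda>n. mnorm E (X n - x) + mnorm E (Y n - y)) \<longlonglongrightarrow> 0" by simp
  have "mnorm E (X n - Y n - (x - y)) \<le> mnorm E (X n - x) + mnorm E (Y n - y)" for n
    using mnorm_triangle_diff[of "X n - x" "Y n - y"] X Y by (simp add: diff_mem algebra_simps)
  then show ?thesis unfolding mtendsto_def by (intro Lim_null_comparison[OF _ lim]) simp
qed

lemma mdense_sequence: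
  assumes "mdense E S" "x \<in> mcarrier E"
  obtains X where "\<And>n. X n \<in> S" "mtendsto E X x"
proof -
  have "\<exists>y\<in>S. mnorm E (x - y) < inverse (real (Suc n))" for n
    using assms unfolding mdense_def by simp
  then obtain X where X: "\<And>n. X n \<in> S" "\<And>n. mnorm E (x - X n) < inverse (real (Suc n))" by metis
  have XE: "X n \<in> mcarrier E" for n using X(1) assms(1) by (auto simp: mdense_def)
  have "norm (mnorm E (X n - x)) \<le> inverse (real (Suc n))" for n
    using X(2)[of n] mnorm_diff_commute[OF XE[of n] assms(2)] by simp
  then have "mtendsto E X x" unfolding mtendsto_def
    by (intro Lim_null_comparison[OF _ LIMSEQ_inverse_real_of_nat]) simp
  with X(1) that show thesis by blast
qed

end

lemma mCauchy_dominated: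
  assumes "mCauchy F Y" "\<And>m n. mnorm E (X m - X n) \<le> mnorm F (Y m - Y n)"
  shows "mCauchy E X"
  using assms unfolding mCauchy_def by (meson order_le_less_trans)

lemma mdense_mono: "\<lbrakk>mdense E S; S \<subseteq> R; R \<subseteq> mcarrier E\<rbrakk> \<Longrightarrow> mdense E R"
  by (meson mdense_def subsetD)

lemma closed_opD:
  "\<lbrakk>closed_op E F t; \<And>n. X n \<in> opdom t; x \<in> mcarrier E; y \<in> mcarrier F; mtendsto E X x;
    mtendsto F (\<lambda>n. app t (X n)) y\<rbrakk> \<Longrightarrow> x \<in> opdom t \<and> app t x = y"
  unfolding closed_op_def by blast

section \<open>Operators with surjective resolvents\<close>

lemma le_if_mult_self_le:
  fixes n a :: real
  assumes "n * n \<le> n * a" "0 \<le> n" "0 \<le> a" shows "n \<le> a"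
  using assms by (cases "n = 0") auto

context hilbert_module_pair
begin

lemma linear_op_mem:
  assumes "densely_defined_linear E F t"
  shows "x \<in> opdom t \<Longrightarrow> x \<in> mcarrier E" "x \<in> opdom t \<Longrightarrow> app t x \<in> mcarrier F"
    "0 \<in> opdom t" "\<lbrakk>x \<in> opdom t; y \<in> opdom t\<rbrakk> \<Longrightarrow> x + y \<in> opdom t"
    "x \<in> opdom t \<Longrightarrow> c *\<^sub>C x \<in> opdom t" "x \<in> opdom t \<Longrightarrow> mact E x a \<in> opdom t"
  using assms by (auto simp: densely_defined_linear_def submodule_def)

lemma linear_op_app:
  assumes "densely_defined_linear E F t"
  shows "\<lbrakk>x \<in> opdom t; y \<in> opdom t\<rbrakk> \<Longrightarrow> app t (x + y) = app t x + app t y"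
    "x \<in> opdom t \<Longrightarrow> app t (c *\<^sub>C x) = c *\<^sub>C app t x"
    "x \<in> opdom t \<Longrightarrow> app t (mact E x a) = mact F (app t x) a"
  using assms by (auto simp: densely_defined_linear_def)

lemma linear_op_zero:
  assumes "densely_defined_linear E F t" shows "app t 0 = 0"
  using linear_op_app(2)[OF assms linear_op_mem(3)[OF assms], of 0] by simp

lemma linear_op_diff:
  assumes t: "densely_defined_linear E F t" and "x \<in> opdom t" "y \<in> opdom t"
  shows "x - y \<in> opdom t" "app t (x - y) = app t x - app t y"
proof -
  have "x - y = x + (-1) *\<^sub>C y" by (simp add: scaleC_one)
  moreover have "(-1) *\<^sub>C y \<in> opdom t" "app t ((-1) *\<^sub>C y) = - app t y"
    using linear_op_mem(5)[OF t assms(3), of "-1"] linear_op_app(2)[OF t assms(3), of "-1"]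
    by (simp_all only: cv.scale_minus_left scaleC_one)
  ultimately show "x - y \<in> opdom t" "app t (x - y) = app t x - app t y"
    using linear_op_mem(4)[OF t assms(2), of "- y"] linear_op_app(1)[OF t assms(2), of "- y"] by simp_all
qed

lemma closed_op_if_maximal:
  assumes t: "\<And>x. x \<in> opdom t \<Longrightarrow> x \<in> mcarrier E" "\<And>x. x \<in> opdom t \<Longrightarrow> app t x \<in> mcarrier F"
    and s: "\<And>y. y \<in> opdom s \<Longrightarrow> y \<in> mcarrier F" "\<And>y. y \<in> opdom s \<Longrightarrow> app s y \<in> mcarrier E"
    and formal: "\<And>x y. \<lbrakk>x \<in> opdom t; y \<in> opdom s\<rbrakk> \<Longrightarrow> minner F y (app t x) = minner E (app s y) x"
    and maximal: "\<And>x z. \<lbrakk>x \<in> mcarrier E; z \<in> mcarrier F;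
      \<And>y. y \<in> opdom s \<Longrightarrow> minner E (app s y) x = minner F y z\<rbrakk> \<Longrightarrow> x \<in> opdom t \<and> app t x = z"
  shows "closed_op E F t"
  unfolding closed_op_def
proof (intro allI impI, elim conjE)
  fix X x z
  assume X: "\<forall>n. X n \<in> opdom t" and x: "x \<in> mcarrier E" and z: "z \<in> mcarrier F"
    and lim: "mtendsto E X x" "mtendsto F (\<lambda>n. app t (X n)) z"
  have "minner E (app s y) x = minner F y z" if y: "y \<in> opdom s" for y
  proof (rule LIMSEQ_unique)
    show "(\<lambda>n. minner E (app s y) (X n)) \<longlonglongrightarrow> minner E (app s y) x"
      using X y x t s by (intro E.mtendsto_inner[OF lim(1)]) auto
    have "(\<lambda>n. minner F y (app t (X n))) \<longlonglongrightarrow> minner F y z"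
      using X y z t s by (intro F.mtendsto_inner[OF lim(2)]) auto
    then show "(\<lambda>n. minner E (app s y) (X n)) \<longlonglongrightarrow> minner F y z"
      using formal[OF _ y] X by simp
  qed
  then show "x \<in> opdom t \<and> app t x = z" by (rule maximal[OF x z])
qed

end

locale formal_adjoints = hilbert_module_pair E F
  for E :: "('a::cstar_algebra, 'e::complex_vector) hmodule"
    and F :: "('a, 'f::complex_vector) hmodule" +
  fixes t :: "('e, 'f) unbounded_op" and s :: "('f, 'e) unbounded_op"
  assumes linear_t: "densely_defined_linear E F t"
    and linear_s: "densely_defined_linear F E s"
    and formal: "\<lbrakk>x \<in> opdom t; y \<in> opdom s\<rbrakk> \<Longrightarrow> minner F (app t x) y = minner E x (app s y)"
begin

sublocale FE: hilbert_module_pair F E ..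

lemmas t_mem = linear_op_mem[OF linear_t] linear_op_diff(1)[OF linear_t]
lemmas t_app = linear_op_app[OF linear_t] linear_op_diff(2)[OF linear_t] linear_op_zero[OF linear_t]
lemmas s_mem = FE.linear_op_mem[OF linear_s] FE.linear_op_diff(1)[OF linear_s]
lemmas s_app = FE.linear_op_app[OF linear_s] FE.linear_op_diff(2)[OF linear_s] FE.linear_op_zero[OF linear_s]

lemma formal': "\<lbrakk>x \<in> opdom t; y \<in> opdom s\<rbrakk> \<Longrightarrow> minner F y (app t x) = minner E (app s y) x"
  by (metis E.star_inner F.star_inner formal s_mem(1,2) t_mem(1,2))

lemma swap_formal: "formal_adjoints F E s t"
  by unfold_locales (simp_all add: linear_t linear_s formal')

text \<open>
  The pairing of \<open>x\<close> with \<open>(1 + s t) x\<close> is the positive sum \<open>\<langle>x | x\<rangle> + \<langle>t x | t x\<rangle>\<close>.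
\<close>

lemma resolvent_bounds:
  assumes x: "x \<in> opdom t" "app t x \<in> opdom s"
  shows "mnorm E x \<le> mnorm E (x + app s (app t x))"
    and "mnorm F (app t x) \<le> mnorm E (x + app s (app t x))"
proof -
  let ?y = "x + app s (app t x)"
  have m: "x \<in> mcarrier E" "app t x \<in> mcarrier F" "app s (app t x) \<in> mcarrier E"
    using x t_mem s_mem by auto
  have eq: "minner E x ?y = minner E x x + minner F (app t x) (app t x)"
    using m x by (simp add: E.inner_add_right formal)
  have pos: "cstar_pos (minner E x x)" "cstar_pos (minner F (app t x) (app t x))"
    using m E.inner_pos F.inner_pos by auto
  have CS: "norm (minner E x ?y) \<le> mnorm E x * mnorm E ?y"
    using m by (intro E.Cauchy_Schwarz E.mem)
  have 1: "(mnorm E x)\<^sup>2 \<le> mnorm E x * mnorm E ?y"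
    using norm_le_norm_add[OF pos] CS eq by (simp add: E.mnorm_power2)
  have 2: "(mnorm F (app t x))\<^sup>2 \<le> mnorm E x * mnorm E ?y"
    using norm_le_norm_add[OF pos(2,1)] CS eq by (simp add: F.mnorm_power2 add.commute)
  show *: "mnorm E x \<le> mnorm E ?y"
    by (rule le_if_mult_self_le) (use 1 in \<open>simp_all add: power2_eq_square\<close>)
  have "mnorm E x * mnorm E ?y \<le> (mnorm E ?y)\<^sup>2"
    using * by (simp add: power2_eq_square mult_right_mono)
  from order_trans[OF 2 this] show "mnorm F (app t x) \<le> mnorm E ?y"
    by (rule power2_le_imp_le) simp
qed

text \<open>
  By the resolvent bounds, approximate solutions converge together with their images under \<open>t\<close>.
\<close>

lemma surj_if_dense_range:
  assumes closed: "closed_op E F t" "closed_op F E s"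
    and dense: "mdense E {x + app s (app t x) | x. x \<in> opdom t \<and> app t x \<in> opdom s}"
    and y: "y \<in> mcarrier E"
  shows "\<exists>x\<in>opdom t. app t x \<in> opdom s \<and> x + app s (app t x) = y"
proof -
  obtain Y where Y: "\<And>n. Y n \<in> {x + app s (app t x) | x. x \<in> opdom t \<and> app t x \<in> opdom s}"
      "mtendsto E Y y"
    using E.mdense_sequence[OF dense y] by blast
  then obtain X where X: "\<And>n. X n \<in> opdom t" "\<And>n. app t (X n) \<in> opdom s"
      "\<And>n. Y n = X n + app s (app t (X n))"
  proof -
    have "\<forall>n. \<exists>x. x \<in> opdom t \<and> app t x \<in> opdom s \<and> Y n = x + app s (app t x)" using Y(1) by blast
    then show thesis using that by metis
  qed
  have XE: "X n \<in> mcarrier E" and tX: "app t (X n) \<in> mcarrier F" and YE: "Y n \<in> mcarrier E" for n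
    using X t_mem s_mem by (auto simp: E.mem)
  have diff: "Y m - Y n = (X m - X n) + app s (app t (X m - X n))" for m n
    using X by (simp add: t_app s_app)
  have dom: "X m - X n \<in> opdom t" "app t (X m - X n) \<in> opdom s" for m n
    using X by (simp_all add: t_mem s_mem t_app)
  have Cauchy: "mCauchy E Y" using E.mtendsto_imp_mCauchy[OF Y(2) YE y] .
  have "mCauchy E X"
    by (rule mCauchy_dominated[OF Cauchy]) (simp only: diff resolvent_bounds[OF dom])
  then obtain x where x: "x \<in> mcarrier E" "mtendsto E X x" using E.complete[of X] XE by blast
  have "mCauchy F (\<lambda>n. app t (X n))"
  proof (rule mCauchy_dominated[OF Cauchy])
    show "mnorm F (app t (X m) - app t (X n)) \<le> mnorm E (Y m - Y n)" for m n
    proof -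
      have "app t (X m) - app t (X n) = app t (X m - X n)" using X by (simp add: t_app)
      then show ?thesis unfolding diff by (simp only: resolvent_bounds(2)[OF dom])
    qed
  qed
  then obtain w where w: "w \<in> mcarrier F" "mtendsto F (\<lambda>n. app t (X n)) w"
    using F.complete[of "\<lambda>n. app t (X n)"] tX by blast
  have tx: "x \<in> opdom t" "app t x = w"
    using closed_opD[OF closed(1) X(1) x(1) w(1) x(2) w(2)] by auto
  have "mtendsto E (\<lambda>n. Y n - X n) (y - x)"
    by (rule E.mtendsto_diff[OF Y(2) YE y x(2) XE x(1)])
  then have "mtendsto E (\<lambda>n. app s (app t (X n))) (y - x)" using X(3) by simp
  then have "w \<in> opdom s" "app s w = y - x"
    using closed_opD[OF closed(2) X(2) w(1) E.diff_mem[OF y x(1)] w(2)] by auto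
  with tx show ?thesis by (intro bexI[of _ x]) auto
qed

end

text \<open>
  The regular operators in a form that is symmetric in the operator and its adjoint: \<open>1 + s t\<close> and \<open>1 + t s\<close>
  are both onto. This determines each of the two as the adjoint of the other (\<open>maximal\<close>), implies regularity
  (\<open>regular_t\<close>), and passes to the Dirac operator.
\<close>

locale adjoint_pair = formal_adjoints E F t s
  for E :: "('a::cstar_algebra, 'e::complex_vector) hmodule"
    and F :: "('a, 'f::complex_vector) hmodule" and t s +
  assumes surj_t: "y \<in> mcarrier E \<Longrightarrow> \<exists>x\<in>opdom t. app t x \<in> opdom s \<and> x + app s (app t x) = y"
    and surj_s: "z \<in> mcarrier F \<Longrightarrow> \<exists>w\<in>opdom s. app s w \<in> opdom t \<and> w + app t (app s w) = z"
begin

lemma swap: "adjoint_pair F E s t"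
  by (intro adjoint_pair.intro swap_formal) (unfold_locales, simp_all add: surj_t surj_s)

text \<open>
  The graph of \<open>t\<close> and the flipped graph of \<open>s\<close> are orthogonal and together span the sum of both modules:
  the two surjectivity assumptions solve \<open>x + s w = z\<close>, \<open>t x - w = - y\<close>. The hypothesis says that
  \<open>(z, - y)\<close> is orthogonal to the graph of \<open>t\<close>, so its component \<open>x\<close> vanishes.
\<close>

lemma maximal:
  assumes y: "y \<in> mcarrier F" and z: "z \<in> mcarrier E"
    and adj: "\<And>x. x \<in> opdom t \<Longrightarrow> minner F (app t x) y = minner E x z"
  shows "y \<in> opdom s" "app s y = z"
proof -
  obtain a where a: "a \<in> opdom t" "app t a \<in> opdom s" "a + app s (app t a) = z" using surj_t[OF z] by blast
  obtain b where b: "b \<in> opdom s" "app s b \<in> opdom t" "b + app t (app s b) = y" using surj_s[OF y] by blast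
  define x where "x = a - app s b"
  define w where "w = app t a + b"
  have x: "x \<in> opdom t" and w: "w \<in> opdom s" using a b by (simp_all add: x_def w_def t_mem s_mem)
  have z_eq: "x + app s w = z" using a b by (simp add: x_def w_def s_app)
  have y_eq: "y = w - app t x" using a b by (simp add: x_def w_def t_app algebra_simps)
  have m: "x \<in> mcarrier E" "app t x \<in> mcarrier F" "w \<in> mcarrier F" "app s w \<in> mcarrier E"
    using x w t_mem s_mem by auto
  have "minner F (app t x) w - minner F (app t x) (app t x) = minner E x x + minner E x (app s w)"
    using adj[OF x] m by (simp add: y_eq z_eq[symmetric] F.inner_diff_right E.inner_add_right)
  then have sum0: "minner E x x + minner F (app t x) (app t x) = 0"
    using formal[OF x w] by (simp add: algebra_simps)
  have "norm (minner E x x) \<le> norm (minner E x x + minner F (app t x) (app t x))"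
    using m E.inner_pos F.inner_pos norm_le_norm_add by blast
  then have "x = 0" using sum0 m E.inner_definite by simp
  then show "y \<in> opdom s" "app s y = z" using w y_eq z_eq by (simp_all add: t_app)
qed

lemma maximal_t:
  assumes "x \<in> mcarrier E" "z \<in> mcarrier F"
    and "\<And>y. y \<in> opdom s \<Longrightarrow> minner E (app s y) x = minner F y z"
  shows "x \<in> opdom t" "app t x = z"
  using adjoint_pair.maximal[OF swap] assms by blast+

lemma closed_t: "closed_op E F t"
proof (rule closed_op_if_maximal[of t s])
  show "x \<in> opdom t \<and> app t x = z" if "x \<in> mcarrier E" "z \<in> mcarrier F"
    "\<And>y. y \<in> opdom s \<Longrightarrow> minner E (app s y) x = minner F y z" for x z
    using maximal_t[OF that] by blast
qed (use t_mem s_mem formal' in auto)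

lemma opdom_adjoint: "opdom (adjoint_op E F t) = opdom s"
proof -
  have "y \<in> opdom s" if "y \<in> mcarrier F" "z \<in> mcarrier E"
    "\<forall>x\<in>opdom t. minner F (app t x) y = minner E x z" for y z
    using maximal[OF that(1,2)] that(3) by blast
  moreover have "y \<in> mcarrier F" "\<exists>z\<in>mcarrier E. \<forall>x\<in>opdom t. minner F (app t x) y = minner E x z"
    if "y \<in> opdom s" for y
    using s_mem(1,2)[OF that] formal[OF _ that] by auto
  ultimately show ?thesis by (auto simp: adjoint_op_def)
qed

lemma app_adjoint:
  assumes y: "y \<in> opdom s" shows "app (adjoint_op E F t) y = app s y"
  unfolding adjoint_op_def unbounded_op.simps
proof (rule the_equality)
  show "app s y \<in> mcarrier E \<and> (\<forall>x\<in>opdom t. minner F (app t x) y = minner E x (app s y))"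
    using s_mem(2)[OF y] formal[OF _ y] by blast
  show "z = app s y" if "z \<in> mcarrier E \<and> (\<forall>x\<in>opdom t. minner F (app t x) y = minner E x z)" for z
    using maximal(2)[OF s_mem(1)[OF y], of z] that by auto
qed

lemma regular_t: "regular E F t"
  unfolding regular_def semiregular_def opdom_adjoint
proof (intro conjI)
  show "mdense F (opdom s)" using linear_s by (simp add: densely_defined_linear_def)
  have "{x + app (adjoint_op E F t) (app t x) | x. x \<in> opdom t \<and> app t x \<in> opdom s} = mcarrier E"
    (is "?R = _")
  proof
    show "?R \<subseteq> mcarrier E" using t_mem s_mem by (auto simp: app_adjoint E.add_mem)
    show "mcarrier E \<subseteq> ?R"
    proof
      fix y assume "y \<in> mcarrier E"
      then obtain x where "x \<in> opdom t" "app t x \<in> opdom s" "x + app s (app t x) = y" using surj_t by blast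
      then show "y \<in> ?R" using app_adjoint by force
    qed
  qed
  then show "mdense E ?R" by (auto simp: mdense_def intro!: bexI)
qed (rule linear_t closed_t)+

text \<open>
  If \<open>u\<close> is in the domain of \<open>t\<close> and \<open>b\<close> solves \<open>(1 + s t) b = u\<close>, then \<open>u = b + s w\<close> where \<open>w = t b\<close> solves
  \<open>(1 + t s) w = t u\<close>. Replacing \<open>t u\<close> by a nearby \<open>v\<close> in the domain of \<open>s\<close> changes \<open>s w\<close> little and turns it
  into \<open>c = (1 + s t)\<^sup>-\<^sup>1 s v\<close>, which lies in the domain of \<open>s t\<close>.
\<close>

lemma dense_dom_square: "mdense E {x \<in> opdom t. app t x \<in> opdom s}"
  unfolding mdense_def
proof (intro conjI ballI allI impI)
  show "{x \<in> opdom t. app t x \<in> opdom s} \<subseteq> mcarrier E" using t_mem by auto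
  fix x and e :: real assume x: "x \<in> mcarrier E" and e: "e > 0"
  have "mdense E (opdom t)" "mdense F (opdom s)"
    using linear_t linear_s by (simp_all add: densely_defined_linear_def)
  then have dense: "\<exists>u\<in>opdom t. mnorm E (x - u) < e / 2"
      "\<And>v. v \<in> mcarrier F \<Longrightarrow> \<exists>v'\<in>opdom s. mnorm F (v - v') < e / 2"
    using x e unfolding mdense_def by (meson half_gt_zero)+
  obtain u where u: "u \<in> opdom t" "mnorm E (x - u) < e / 2" using dense(1) by blast
  obtain v where v: "v \<in> opdom s" "mnorm F (app t u - v) < e / 2" using dense(2) t_mem(2)[OF u(1)] by blast
  obtain b where b: "b \<in> opdom t" "app t b \<in> opdom s" "b + app s (app t b) = u"
    using surj_t t_mem(1)[OF u(1)] by blast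
  obtain c where c: "c \<in> opdom t" "app t c \<in> opdom s" "c + app s (app t c) = app s v"
    using surj_t s_mem(2)[OF v(1)] by blast
  let ?w = "app t b - (v - app t c)"
  have sb: "app s (app t b) = u - b" using b(3) by (metis add_diff_cancel_left')
  have sc: "app s (app t c) = app s v - c" using c(3) by (metis add_diff_cancel_left')
  have w: "?w \<in> opdom s" using b c v by (simp add: s_mem)
  have sw: "app s ?w = u - (b + c)" using b(1,2) c(1,2) v by (simp add: s_mem s_app sb sc)
  have sw_dom: "app s ?w \<in> opdom t" unfolding sw using b c u by (simp add: t_mem)
  have eq: "?w + app t (u - (b + c)) = app t u - v"
    using b(1) c(1) u(1) by (simp add: t_mem t_app)
  have "mnorm E (u - (b + c)) \<le> mnorm F (app t u - v)"
    using formal_adjoints.resolvent_bounds(2)[OF swap_formal w sw_dom] by (simp only: sw eq)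
  then have "mnorm E (x - (b + c)) < e"
    using E.mnorm_triangle_via[of x u "b + c"] x u v b c t_mem(1) E.add_mem by force
  moreover have "b + c \<in> opdom t" "app t (b + c) \<in> opdom s" using b c by (simp_all add: t_mem s_mem t_app)
  ultimately show "\<exists>y\<in>{x \<in> opdom t. app t x \<in> opdom s}. mnorm E (x - y) < e" by blast
qed

text \<open>
  Everywhere defined operators of the form \<open>t g\<close> have an adjoint that can be written down with the
  resolvent of \<open>t s\<close>: it is \<open>M\<^sup>* s (1 + t s)\<^sup>-\<^sup>1\<close>. In the applications \<open>g\<close> is a Green operator and \<open>M\<close> is one plus
  the Laplacian, composed with \<open>g\<close>.
\<close>

lemma adjoints_app_solution:
  assumes M: "adjoints E E M M'" and g: "\<And>y. y \<in> mcarrier E \<Longrightarrow> g y \<in> opdom t"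
    and eq: "\<And>y w. \<lbrakk>y \<in> mcarrier E; w \<in> opdom s; app s w \<in> opdom t\<rbrakk> \<Longrightarrow>
      minner E (g y) (app s w) + minner F (app t (g y)) (app t (app s w)) = minner E (M y) (app s w)"
  obtains A where "adjoints E F (\<lambda>y. app t (g y)) A"
proof -
  define w where "w z = (SOME w. w \<in> opdom s \<and> app s w \<in> opdom t \<and> w + app t (app s w) = z)" for z
  have w: "w z \<in> opdom s \<and> app s (w z) \<in> opdom t \<and> w z + app t (app s (w z)) = z"
    if "z \<in> mcarrier F" for z
    unfolding w_def by (rule someI_ex) (use surj_s[OF that] in blast)
  interpret EE: hilbert_module_pair E E ..
  have "adjoints E F (\<lambda>y. app t (g y)) (\<lambda>z. M' (app s (w z)))"
    unfolding adjoints_def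
  proof (intro conjI ballI)
    show "(\<lambda>y. app t (g y)) \<in> mcarrier E \<rightarrow> mcarrier F" using g t_mem by auto
    show "(\<lambda>z. M' (app s (w z))) \<in> mcarrier F \<rightarrow> mcarrier E"
      using w s_mem adjoints_mem[OF EE.adjoints_sym[OF M]] by auto
    fix y z assume y: "y \<in> mcarrier E" and z: "z \<in> mcarrier F"
    have m: "w z \<in> mcarrier F" "app s (w z) \<in> mcarrier E" "app t (app s (w z)) \<in> mcarrier F"
      using w[OF z] s_mem t_mem by auto
    have "minner F (app t (g y)) z = minner F (app t (g y)) (w z + app t (app s (w z)))"
      using w[OF z] by simp
    also have "\<dots> = minner E (g y) (app s (w z)) + minner F (app t (g y)) (app t (app s (w z)))"
      using m g[OF y] w[THEN conjunct1, OF z] t_mem(2) by (simp add: F.inner_add_right formal)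
    also have "\<dots> = minner E y (M' (app s (w z)))"
      using eq[OF y] w[OF z] adjoints_inner[OF M y m(2)] by simp
    finally show "minner F (app t (g y)) z = minner E y (M' (app s (w z)))" .
  qed
  then show thesis by (rule that)
qed

end

context hilbert_module_pair
begin

lemma adjoint_op_characterization:
  assumes t: "densely_defined_linear E F t"
    and "y \<in> mcarrier F" "z \<in> mcarrier E" "\<And>x. x \<in> opdom t \<Longrightarrow> minner F (app t x) y = minner E x z"
  shows "y \<in> opdom (adjoint_op E F t)" "app (adjoint_op E F t) y = z"
proof -
  show "y \<in> opdom (adjoint_op E F t)" using assms by (auto simp: adjoint_op_def)
  show "app (adjoint_op E F t) y = z"
    unfolding adjoint_op_def unbounded_op.simps
  proof (rule the_equality)
    fix z' assume z': "z' \<in> mcarrier E \<and> (\<forall>x\<in>opdom t. minner F (app t x) y = minner E x z')"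
    have "minner E x (z' - z) = 0" if x: "x \<in> opdom t" for x
      using z' assms(3,4) x linear_op_mem[OF t] by (simp add: E.inner_diff_right)
    then have "z' - z = 0"
      using E.orthogonal_to_dense[of "opdom t" "z' - z"] t z' assms(3)
      by (simp add: densely_defined_linear_def E.diff_mem)
    then show "z' = z" by simp
  qed (use assms in blast)
qed

lemma adjoint_op_formal:
  assumes t: "densely_defined_linear E F t" and y: "y \<in> opdom (adjoint_op E F t)"
  shows "y \<in> mcarrier F" "app (adjoint_op E F t) y \<in> mcarrier E"
    "x \<in> opdom t \<Longrightarrow> minner F (app t x) y = minner E x (app (adjoint_op E F t) y)"
proof -
  obtain z where z: "y \<in> mcarrier F" "z \<in> mcarrier E" "\<And>x. x \<in> opdom t \<Longrightarrow> minner F (app t x) y = minner E x z"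
    using y by (auto simp: adjoint_op_def)
  then show "y \<in> mcarrier F" "app (adjoint_op E F t) y \<in> mcarrier E"
    "x \<in> opdom t \<Longrightarrow> minner F (app t x) y = minner E x (app (adjoint_op E F t) y)"
    using adjoint_op_characterization(2)[OF t z] by auto
qed

text \<open>
  Surjectivity of \<open>1 + t t\<^sup>*\<close> is not part of the definition of regularity. For \<open>y\<close> in the dense domain of
  \<open>t\<^sup>*\<close> a solution is \<open>y - t (1 + t\<^sup>* t)\<^sup>-\<^sup>1 t\<^sup>* y\<close>; the rest follows from closedness.
\<close>

lemma regular_imp_adjoint_pair:
  assumes reg: "regular E F t"
  shows "adjoint_pair E F t (adjoint_op E F t)"
proof -
  let ?s = "adjoint_op E F t"
  have t: "densely_defined_linear E F t" and dense_s: "mdense F (opdom ?s)"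
    and closed: "closed_op E F t"
    and dense: "mdense E {x + app ?s (app t x) | x. x \<in> opdom t \<and> app t x \<in> opdom ?s}"
    using reg by (simp_all add: regular_def semiregular_def)
  note adj = adjoint_op_formal[OF t] and char = adjoint_op_characterization[OF t]
  note tm = linear_op_mem[OF t]
  have add: "x + y \<in> opdom ?s \<and> app ?s (x + y) = app ?s x + app ?s y"
    if "x \<in> opdom ?s" "y \<in> opdom ?s" for x y
    using char[of "x + y" "app ?s x + app ?s y"] adj that tm
    by (simp add: E.mem F.mem E.inner_add_right F.inner_add_right)
  have scale: "c *\<^sub>C x \<in> opdom ?s \<and> app ?s (c *\<^sub>C x) = c *\<^sub>C app ?s x" if "x \<in> opdom ?s" for x c
    using char[of "c *\<^sub>C x" "c *\<^sub>C app ?s x"] adj that tm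
    by (simp add: E.mem F.mem E.inner_scaleC_right F.inner_scaleC_right)
  have act: "mact F x a \<in> opdom ?s \<and> app ?s (mact F x a) = mact E (app ?s x) a" if "x \<in> opdom ?s" for x a
    using char[of "mact F x a" "mact E (app ?s x) a"] adj that tm
    by (simp add: E.mem F.mem E.inner_act_right F.inner_act_right)
  have zero: "0 \<in> opdom ?s" using char[of 0 0] tm by (simp add: E.mem F.mem)
  have s: "densely_defined_linear F E ?s"
    unfolding densely_defined_linear_def submodule_def
    using add scale act zero adj dense_s by auto
  interpret formal_adjoints E F t ?s
    by unfold_locales (use t s adj in auto)
  have closed_s: "closed_op F E ?s"
  proof (rule FE.closed_op_if_maximal[of ?s t])
    show "minner E y (app ?s x) = minner F (app t y) x" if "x \<in> opdom ?s" "y \<in> opdom t" for x y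
      using formal[OF that(2,1)] by simp
    show "x \<in> opdom ?s \<and> app ?s x = z" if "x \<in> mcarrier F" "z \<in> mcarrier E"
      "\<And>y. y \<in> opdom t \<Longrightarrow> minner F (app t y) x = minner E y z" for x z
      using char[OF that] by blast
  qed (use t_mem s_mem in auto)
  note surj_t = surj_if_dense_range[OF closed closed_s dense]
  have dense': "mdense F {x + app t (app ?s x) | x. x \<in> opdom ?s \<and> app ?s x \<in> opdom t}" (is "mdense F ?R")
  proof -
    have "opdom ?s \<subseteq> ?R"
    proof
      fix y assume y: "y \<in> opdom ?s"
      obtain b where b: "b \<in> opdom t" "app t b \<in> opdom ?s" "b + app ?s (app t b) = app ?s y"
        using surj_t[OF s_mem(2)[OF y]] by blast
      have "app ?s (y - app t b) = b" using b y by (simp add: s_app flip: b(3))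
      then show "y \<in> ?R" using b y by (intro CollectI exI[of _ "y - app t b"]) (simp add: s_mem)
    qed
    moreover have "?R \<subseteq> mcarrier F" using t_mem s_mem by (auto simp: F.add_mem)
    ultimately show ?thesis by (rule mdense_mono[OF dense_s])
  qed
  have surj_s: "\<exists>x\<in>opdom ?s. app ?s x \<in> opdom t \<and> x + app t (app ?s x) = y" if "y \<in> mcarrier F" for y
    by (rule formal_adjoints.surj_if_dense_range[OF swap_formal closed_s closed dense' that])
  show ?thesis
    by unfold_locales (use surj_t surj_s in auto)
qed

end

section \<open>Two consecutive differentials\<close>

text \<open>
  Three neighbouring modules of a complex, with the adjoints \<open>s'\<close>, \<open>t'\<close> of the differentials. Reading the
  complex backwards exchanges \<open>(s, s')\<close> with \<open>(t', t)\<close>, so each statement about one half gives one about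
  the other.
\<close>

locale two_step = L: adjoint_pair F E s s' + R: adjoint_pair E G t t'
  for F :: "('a::cstar_algebra, 'f::complex_vector) hmodule"
    and E :: "('a, 'e::complex_vector) hmodule"
    and G :: "('a, 'g::complex_vector) hmodule"
    and s s' t t' +
  assumes exact: "x \<in> opdom s \<Longrightarrow> app s x \<in> opdom t \<and> app t (app s x) = 0"
begin

lemma s_exact: "x \<in> opdom s \<Longrightarrow> app s x \<in> opdom t" "x \<in> opdom s \<Longrightarrow> app t (app s x) = 0"
  using exact by auto

lemma orthogonal: "\<lbrakk>x \<in> opdom s; y \<in> opdom t'\<rbrakk> \<Longrightarrow> minner E (app s x) (app t' y) = 0"
  using R.formal[of "app s x" y] exact[of x] R.s_mem(1) by simp

lemma orthogonal': "\<lbrakk>x \<in> opdom s; y \<in> opdom t'\<rbrakk> \<Longrightarrow> minner E (app t' y) (app s x) = 0"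
  by (metis orthogonal L.t_mem(2) R.s_mem(2) L.F.star_inner star_zero)

lemma coexact:
  assumes y: "y \<in> opdom t'" shows "app t' y \<in> opdom s'" "app s' (app t' y) = 0"
  by (rule L.maximal[OF R.s_mem(2)[OF y] L.E.zero_mem]; simp add: orthogonal y L.t_mem(1))+

lemma swap: "two_step G E F t' t s' s"
proof -
  interpret L': adjoint_pair G E t' t by (rule R.swap)
  interpret R': adjoint_pair E F s' s by (rule L.swap)
  show ?thesis by unfold_locales (simp add: coexact)
qed

definition laplace_dom :: "'e set"
  where "laplace_dom = {x. x \<in> opdom t \<and> app t x \<in> opdom t' \<and> x \<in> opdom s' \<and> app s' x \<in> opdom s}"

definition laplace :: "'e \<Rightarrow> 'e"
  where "laplace x = app t' (app t x) + app s (app s' x)"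

lemma laplace_domD:
  assumes "x \<in> laplace_dom"
  shows "x \<in> opdom t" "app t x \<in> opdom t'" "x \<in> opdom s'" "app s' x \<in> opdom s"
    "x \<in> mcarrier E" "laplace x \<in> mcarrier E"
  using assms R.t_mem(1) by (auto simp: laplace_dom_def laplace_def R.s_mem(2) L.t_mem(2) L.F.add_mem)

lemma laplace_diff:
  assumes "x \<in> laplace_dom" "y \<in> laplace_dom"
  shows "x - y \<in> laplace_dom" "laplace (x - y) = laplace x - laplace y"
proof -
  note x = laplace_domD[OF assms(1)] and y = laplace_domD[OF assms(2)]
  show "x - y \<in> laplace_dom" "laplace (x - y) = laplace x - laplace y"
    using x y unfolding laplace_dom_def laplace_def
    by (simp_all add: R.t_mem R.s_mem L.t_mem L.s_mem R.t_app R.s_app L.t_app L.s_app)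
qed

lemma inner_laplace:
  assumes "x \<in> opdom t" "x \<in> opdom s'" "y \<in> laplace_dom"
  shows "minner E x (laplace y) = minner G (app t x) (app t y) + minner F (app s' x) (app s' y)"
proof -
  note y = laplace_domD[OF assms(3)]
  show ?thesis
    using assms y by (simp add: laplace_def L.F.inner_add_right R.t_mem(1) R.s_mem(2) L.t_mem(2)
        R.formal L.formal')
qed

text \<open>
  With \<open>b\<close>, \<open>b'\<close> the resolvents of \<open>t' t\<close> and \<open>s s'\<close> at \<open>y\<close>, the solution is \<open>b + b' - y\<close>. It differs from \<open>b\<close> by
  an element of the range of \<open>s\<close>, which \<open>t\<close> annihilates, and from \<open>b'\<close> by one of the range of \<open>t'\<close>.
\<close>

lemma laplace_resolvent:
  assumes y: "y \<in> mcarrier E"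
  obtains x where "x \<in> laplace_dom" "laplace x + x = y"
proof -
  obtain b where b: "b \<in> opdom t" "app t b \<in> opdom t'" "b + app t' (app t b) = y"
    using R.surj_t[OF y] by blast
  obtain b' where b': "b' \<in> opdom s'" "app s' b' \<in> opdom s" "b' + app s (app s' b') = y"
    using L.surj_s[OF y] by blast
  define x where "x = b - app s (app s' b')"
  have x': "x = b' - app t' (app t b)"
    unfolding x_def using b(3) b'(3) by (metis add_diff_cancel_left' diff_add_eq diff_diff_eq2)
  have 1: "x \<in> opdom t" "app t x = app t b"
    using b b' by (simp_all add: x_def R.t_mem R.t_app s_exact)
  have 2: "x \<in> opdom s'" "app s' x = app s' b'"
    using b b' unfolding x' by (simp_all add: L.s_mem L.s_app coexact)
  have "x \<in> laplace_dom" using 1 2 b b' by (simp add: laplace_dom_def)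
  moreover have "laplace x + x = y" using 1 2 b(3) by (simp add: laplace_def x_def algebra_simps)
  ultimately show thesis by (rule that)
qed

text \<open>
  The resolvent of \<open>t' t\<close> has dense range and maps the dense domain of \<open>s'\<close> into itself.
\<close>

lemma dense_common_domain: "mdense E (opdom t \<inter> opdom s')"
  unfolding mdense_def
proof (intro conjI ballI allI impI)
  show "opdom t \<inter> opdom s' \<subseteq> mcarrier E" using R.t_mem by auto
  fix x and e :: real assume x: "x \<in> mcarrier E" and e: "e > 0"
  obtain d where d: "d \<in> opdom t" "app t d \<in> opdom t'" "mnorm E (x - d) < e / 2"
    using R.dense_dom_square x e unfolding mdense_def by (metis (mono_tags, lifting) half_gt_zero mem_Collect_eq)
  let ?y = "d + app t' (app t d)"
  have y: "?y \<in> mcarrier E" using d by (simp add: L.F.add_mem R.t_mem(1) R.s_mem(2))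
  have "mdense E (opdom s')" using L.linear_s by (simp add: densely_defined_linear_def)
  then obtain u where u: "u \<in> opdom s'" "mnorm E (?y - u) < e / 2"
    using y e unfolding mdense_def by (metis half_gt_zero)
  obtain b where b: "b \<in> opdom t" "app t b \<in> opdom t'" "b + app t' (app t b) = u"
    using R.surj_t[OF L.s_mem(1)[OF u(1)]] by blast
  have "b = u - app t' (app t b)" using b(3) by (simp add: algebra_simps)
  then have "b \<in> opdom s'" using u(1) b(2) coexact(1) L.s_mem(7) by metis
  have eq: "?y - u = (d - b) + app t' (app t (d - b))"
    using b(1,2) d(1,2) by (simp add: R.t_app R.s_app flip: b(3))
  have "mnorm E (d - b) \<le> mnorm E (?y - u)"
    unfolding eq by (rule R.resolvent_bounds(1)) (use b d in \<open>simp_all add: R.t_mem R.s_mem R.t_app\<close>)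
  moreover have "mnorm E (x - b) \<le> mnorm E (x - d) + mnorm E (d - b)"
    by (rule L.F.mnorm_triangle_via[OF x R.t_mem(1)[OF d(1)] R.t_mem(1)[OF b(1)]])
  ultimately have "mnorm E (x - b) < e" using u(2) d(3) by linarith
  then show "\<exists>y\<in>opdom t \<inter> opdom s'. mnorm E (x - y) < e" using b(1) \<open>b \<in> opdom s'\<close> by blast
qed

section \<open>Elliptic estimates and Green operators\<close>

text \<open>
  The property to which both Fredholm conditions are reduced.
\<close>

definition elliptic :: "('e \<Rightarrow> 'e) \<Rightarrow> real \<Rightarrow> bool"
  where "elliptic C c \<longleftrightarrow> compact_op E E C \<and> 0 \<le> c \<and>
    (\<forall>x\<in>opdom t \<inter> opdom s'. mnorm E x \<le> mnorm E (C x) + c * (mnorm G (app t x) + mnorm F (app s' x)))"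

text \<open>
  A lower bound along the segment from \<open>\<Delta> + 1\<close> to \<open>\<Delta> + C\<^sup>* C\<close> that does not depend on \<open>\<sigma>\<close>. For
  \<open>\<sigma> \<ge> 1/2\<close> the term \<open>\<sigma> \<langle>x | x\<rangle>\<close> suffices; for smaller \<open>\<sigma>\<close> the pairing controls \<open>t x\<close>, \<open>s' x\<close> and \<open>C x\<close>, and
  the elliptic estimate applies.
\<close>

lemma elliptic_apriori:
  assumes ell: "elliptic C c" and C: "adjoints E E C C'"
    and \<sigma>: "0 \<le> \<sigma>" "\<sigma> \<le> 1" and x: "x \<in> laplace_dom"
  defines "y \<equiv> laplace x + (complex_of_real \<sigma> *\<^sub>C x + complex_of_real (1 - \<sigma>) *\<^sub>C C' (C x))"
  shows "mnorm E x \<le> (2 + 2 * c)\<^sup>2 * mnorm E y"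
proof -
  interpret EE: hilbert_module_pair E E ..
  note xd = laplace_domD[OF x]
  have c: "c \<ge> 0" using ell by (simp add: elliptic_def)
  have m: "C x \<in> mcarrier E" "C' (C x) \<in> mcarrier E"
    using adjoints_mem[OF C] adjoints_mem[OF EE.adjoints_sym[OF C]] xd by auto
  have yE: "y \<in> mcarrier E" using xd m by (simp add: y_def L.F.mem)
  let ?n = "mnorm E x" and ?m = "mnorm E y"
  define a1 where "a1 = minner G (app t x) (app t x)"
  define a2 where "a2 = minner F (app s' x) (app s' x)"
  define a3 where "a3 = \<sigma> *\<^sub>R minner E x x"
  define a4 where "a4 = (1 - \<sigma>) *\<^sub>R minner E (C x) (C x)"
  have pos: "cstar_pos a1" "cstar_pos a2" "cstar_pos a3" "cstar_pos a4"
    using xd m \<sigma> by (auto simp: a1_def a2_def a3_def a4_def R.t_mem(2) L.s_mem(2)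
        intro!: cstar_pos_scaleR L.F.inner_pos R.F.inner_pos L.E.inner_pos)
  have eq: "minner E x y = a1 + (a2 + (a3 + a4))"
    using xd m inner_laplace[OF xd(1,3) x]
    by (simp add: y_def L.F.inner_add_right L.F.inner_scaleC_right L.F.mem a1_def a2_def a3_def a4_def
        adjoints_inner[OF C] scaleR_eq_scaleC)
  have "norm (minner E x y) \<le> ?n * ?m" by (rule L.F.Cauchy_Schwarz[OF xd(5) yE])
  moreover have "norm a1 \<le> norm (a1 + (a2 + (a3 + a4)))" "norm a2 \<le> norm (a2 + (a1 + (a3 + a4)))"
    "norm a3 \<le> norm (a3 + (a1 + (a2 + a4)))" "norm a4 \<le> norm (a4 + (a1 + (a2 + a3)))"
    by (rule norm_le_norm_add; intro pos cstar_pos_add)+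
  ultimately have a: "norm a1 \<le> ?n * ?m" "norm a2 \<le> ?n * ?m" "norm a3 \<le> ?n * ?m" "norm a4 \<le> ?n * ?m"
    unfolding eq by (simp_all add: ac_simps)
  define p where "p = sqrt (?n * ?m)"
  have p: "p \<ge> 0" "p\<^sup>2 = ?n * ?m" by (simp_all add: p_def)
  have "?n \<le> (2 + 2 * c) * p"
  proof (cases "\<sigma> \<ge> 1 / 2")
    case True
    then have "(1 / 2) * norm (minner E x x) \<le> \<sigma> * norm (minner E x x)" by (intro mult_right_mono) auto
    then have "?n\<^sup>2 \<le> 2 * p\<^sup>2" using a(3) \<sigma> by (simp add: a3_def L.F.mnorm_power2 p)
    also have "\<dots> \<le> (2 * p)\<^sup>2" by (simp add: power2_eq_square)
    finally have "?n \<le> 2 * p" by (rule power2_le_imp_le) (use p in auto)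
    also have "\<dots> \<le> (2 + 2 * c) * p" using c p by (intro mult_right_mono) auto
    finally show ?thesis .
  next
    case False
    then have "(1 / 2) * norm (minner E (C x) (C x)) \<le> (1 - \<sigma>) * norm (minner E (C x) (C x))"
      by (intro mult_right_mono) auto
    then have "(mnorm E (C x))\<^sup>2 \<le> 2 * p\<^sup>2" using a(4) \<sigma> by (simp add: a4_def L.F.mnorm_power2 p)
    also have "\<dots> \<le> (2 * p)\<^sup>2" by (simp add: power2_eq_square)
    finally have 1: "mnorm E (C x) \<le> 2 * p" by (rule power2_le_imp_le) (use p in auto)
    have 2: "mnorm G (app t x) \<le> p"
      by (rule power2_le_imp_le) (use a(1) p in \<open>simp_all add: a1_def R.F.mnorm_power2\<close>)
    have 3: "mnorm F (app s' x) \<le> p"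
      by (rule power2_le_imp_le) (use a(2) p in \<open>simp_all add: a2_def L.E.mnorm_power2\<close>)
    have "?n \<le> mnorm E (C x) + c * (mnorm G (app t x) + mnorm F (app s' x))"
      using ell xd by (simp add: elliptic_def)
    also have "\<dots> \<le> 2 * p + c * (p + p)"
      using 1 2 3 c by (intro add_mono mult_left_mono) auto
    finally show ?thesis by (simp add: algebra_simps)
  qed
  then have "?n\<^sup>2 \<le> ((2 + 2 * c) * p)\<^sup>2" by (intro power_mono) simp_all
  then have "?n * ?n \<le> ?n * ((2 + 2 * c)\<^sup>2 * ?m)"
    unfolding power_mult_distrib p(2) power2_eq_square[of ?n] by (simp add: mult_ac)
  then show ?thesis by (rule le_if_mult_self_le) simp_all
qed

text \<open>
  The method of continuity. By the uniform lower bound, surjectivity at \<open>\<sigma>\<close> spreads to an interval around \<open>\<sigma>\<close>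
  of fixed length, through a contraction; finitely many steps lead from \<open>\<sigma> = 1\<close> to \<open>\<sigma> = 0\<close>.
\<close>

lemma elliptic_surjective:
  assumes ell: "elliptic C c" and C: "adjoints E E C C'" and y: "y \<in> mcarrier E"
  shows "\<exists>x\<in>laplace_dom. laplace x + C' (C x) = y"
proof -
  interpret EE: hilbert_module_pair E E ..
  define Q where "Q x = C' (C x)" for x
  have Q: "adjoints E E Q Q"
    using adjoints_comp[OF C EE.adjoints_sym[OF C]] by (simp add: Q_def[abs_def])
  have Q_mem: "Q x \<in> mcarrier E" if "x \<in> mcarrier E" for x using adjoints_mem[OF Q that] .
  obtain q where q: "q \<ge> 0" "\<And>x. x \<in> mcarrier E \<Longrightarrow> mnorm E (Q x) \<le> q * mnorm E x"
    using EE.adjoints_bounded[OF Q] by blast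
  define \<kappa> where "\<kappa> = (2 + 2 * c)\<^sup>2"
  have \<kappa>: "\<kappa> \<ge> 0" by (simp add: \<kappa>_def)
  define H where "H \<sigma> x = laplace x + (complex_of_real \<sigma> *\<^sub>C x + complex_of_real (1 - \<sigma>) *\<^sub>C Q x)" for \<sigma> x
  have apriori: "mnorm E x \<le> \<kappa> * mnorm E (H \<sigma> x)" if "0 \<le> \<sigma>" "\<sigma> \<le> 1" "x \<in> laplace_dom" for \<sigma> x
    using elliptic_apriori[OF ell C that] by (simp add: H_def Q_def \<kappa>_def)
  have H_diff: "H \<sigma> (x - x') = H \<sigma> x - H \<sigma> x'" if "x \<in> laplace_dom" "x' \<in> laplace_dom" for \<sigma> x x'
    using that laplace_domD(5)
    by (simp add: H_def laplace_diff EE.adjoints_diff[OF Q] cv.scale_right_diff_distrib algebra_simps)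
  have step: "\<forall>y\<in>mcarrier E. \<exists>x\<in>laplace_dom. H \<tau> x = y"
    if surj: "\<forall>y\<in>mcarrier E. \<exists>x\<in>laplace_dom. H \<sigma> x = y"
      and \<sigma>: "0 \<le> \<sigma>" "\<sigma> \<le> 1" and close: "\<kappa> * (\<bar>\<sigma> - \<tau>\<bar> * (1 + q)) \<le> 1 / 2" for \<sigma> \<tau>
  proof
    fix y assume y: "y \<in> mcarrier E"
    define g where "g z = (SOME x. x \<in> laplace_dom \<and> H \<sigma> x = z)" for z
    have g: "g z \<in> laplace_dom" "H \<sigma> (g z) = z" if "z \<in> mcarrier E" for z
      using someI_ex[of "\<lambda>x. x \<in> laplace_dom \<and> H \<sigma> x = z"] surj that unfolding g_def by blast+
    have g_lip: "mnorm E (g z - g z') \<le> \<kappa> * mnorm E (z - z')" if "z \<in> mcarrier E" "z' \<in> mcarrier E" for z z'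
      using apriori[OF \<sigma> laplace_diff(1)[OF g(1) g(1)], of z z'] that by (simp add: H_diff g)
    let ?d = "complex_of_real (\<sigma> - \<tau>)"
    define f where "f x = g (y + ?d *\<^sub>C (x - Q x))" for x
    have arg: "y + ?d *\<^sub>C (x - Q x) \<in> mcarrier E" if "x \<in> mcarrier E" for x
      using y that Q_mem by (simp add: L.F.mem)
    obtain x where x: "x \<in> mcarrier E" "f x = x"
    proof (rule L.F.contraction_fixpoint[of f "1/2"])
      show "f x \<in> mcarrier E" if "x \<in> mcarrier E" for x
        using g(1)[OF arg[OF that]] laplace_domD(5) by (simp add: f_def)
      fix x x' assume xx: "x \<in> mcarrier E" "x' \<in> mcarrier E"
      have "(y + ?d *\<^sub>C (x - Q x)) - (y + ?d *\<^sub>C (x' - Q x')) = ?d *\<^sub>C ((x - x') - Q (x - x'))"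
        using xx by (simp add: EE.adjoints_diff[OF Q] cv.scale_right_diff_distrib algebra_simps)
      then have "mnorm E (f x - f x') \<le> \<kappa> * mnorm E (?d *\<^sub>C ((x - x') - Q (x - x')))"
        using g_lip[OF arg arg, OF xx] by (simp only: f_def)
      also have "mnorm E (?d *\<^sub>C ((x - x') - Q (x - x'))) = \<bar>\<sigma> - \<tau>\<bar> * mnorm E ((x - x') - Q (x - x'))"
        using xx Q_mem by (simp add: L.F.mnorm_scaleC L.F.mem del: of_real_diff)
      also have "mnorm E ((x - x') - Q (x - x')) \<le> (1 + q) * mnorm E (x - x')"
        using L.F.mnorm_triangle_diff[of "x - x'" "Q (x - x')"] q(2)[of "x - x'"] xx Q_mem
        by (simp add: L.F.mem algebra_simps)
      finally have "mnorm E (f x - f x') \<le> \<kappa> * (\<bar>\<sigma> - \<tau>\<bar> * ((1 + q) * mnorm E (x - x')))"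
        using \<kappa> by (simp add: mult_left_mono)
      also have "\<dots> = \<kappa> * (\<bar>\<sigma> - \<tau>\<bar> * (1 + q)) * mnorm E (x - x')" by simp
      also have "\<dots> \<le> 1 / 2 * mnorm E (x - x')" by (rule mult_right_mono[OF close]) simp
      finally show "mnorm E (f x - f x') \<le> 1 / 2 * mnorm E (x - x')" .
    qed auto
    then have xd: "x \<in> laplace_dom" and "H \<sigma> x = y + ?d *\<^sub>C (x - Q x)"
      using g[OF arg[OF x(1)]] by (simp_all add: f_def)
    then have "H \<tau> x = y"
      by (simp add: H_def cv.scale_right_diff_distrib cv.scale_left_diff_distrib algebra_simps)
    with xd show "\<exists>x\<in>laplace_dom. H \<tau> x = y" by blast
  qed
  obtain M :: nat where M: "2 * (\<kappa> * (1 + q)) < real M" using reals_Archimedean2 by blast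
  have "2 * (\<kappa> * (1 + q)) \<ge> 0" using \<kappa> q by simp
  with M have M0: "real M > 0" by linarith
  have "\<forall>y\<in>mcarrier E. \<exists>x\<in>laplace_dom. H (1 - real n / real M) x = y" if "n \<le> M" for n
    using that
  proof (induction n)
    case 0
    have "\<exists>x\<in>laplace_dom. H 1 x = z" if "z \<in> mcarrier E" for z
      by (rule laplace_resolvent[OF that]) (auto simp: H_def scaleC_one)
    then show ?case by simp
  next
    case (Suc n)
    have "\<kappa> * (\<bar>(1 - real n / real M) - (1 - real (Suc n) / real M)\<bar> * (1 + q)) = \<kappa> * (1 + q) / real M"
      using M0 by (simp add: field_simps)
    also have "\<dots> \<le> 1 / 2" using M M0 by (simp add: field_simps)
    finally show ?case using Suc M0 by (intro step[OF Suc.IH]) auto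
  qed
  from this[of M] M0 y obtain x where "x \<in> laplace_dom" "H 0 x = y" by auto
  then show ?thesis by (intro bexI[of _ x]) (simp_all add: H_def Q_def scaleC_one)
qed

text \<open>
  The inverse of \<open>\<Delta> + C\<^sup>* C\<close>. It is adjointable because it is symmetric and everywhere defined.
\<close>

lemma green_operator:
  assumes ell: "elliptic C c"
  obtains gr K K' where "adjoints E E gr gr" "adjoints E E K K'" "compact_op E E K" "compact_op E E K'"
    "\<And>y. y \<in> mcarrier E \<Longrightarrow> gr y \<in> laplace_dom" "\<And>y. y \<in> mcarrier E \<Longrightarrow> laplace (gr y) = y - K y"
proof -
  interpret EE: hilbert_module_pair E E ..
  have hm: "hilbert_module E" by unfold_locales
  have compact: "compact_op E E C" using ell by (simp add: elliptic_def)
  then obtain C' where C: "adjoints E E C C'" by (auto simp: compact_op_def adjointable_iff_adjoints)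
  note C' = EE.adjoints_sym[OF C]
  define Q where "Q x = C' (C x)" for x
  have Q: "adjoints E E Q Q"
    using adjoints_comp[OF C EE.adjoints_sym[OF C]] by (simp add: Q_def[abs_def])
  define gr where "gr y = (SOME x. x \<in> laplace_dom \<and> laplace x + Q x = y)" for y
  have gr: "gr y \<in> laplace_dom" "laplace (gr y) + Q (gr y) = y" if "y \<in> mcarrier E" for y
    using someI_ex[of "\<lambda>x. x \<in> laplace_dom \<and> laplace x + Q x = y"] elliptic_surjective[OF ell C that]
    unfolding gr_def Q_def by blast+
  note grd = laplace_domD[OF gr(1)]
  have adj_gr: "adjoints E E gr gr"
    unfolding adjoints_def
  proof (intro conjI ballI)
    show "gr \<in> mcarrier E \<rightarrow> mcarrier E" using grd by auto
    then show "gr \<in> mcarrier E \<rightarrow> mcarrier E" .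
    fix x y assume x: "x \<in> mcarrier E" and y: "y \<in> mcarrier E"
    have Qm: "Q (gr x) \<in> mcarrier E" "Q (gr y) \<in> mcarrier E"
      using adjoints_mem[OF Q] grd x y by auto
    have 1: "minner E (gr x) (laplace (gr y)) = minner E (laplace (gr x)) (gr y)"
    proof -
      have "minner E (laplace (gr x)) (gr y) = star (minner E (gr y) (laplace (gr x)))"
        using grd x y by (simp add: L.F.star_inner)
      also have "\<dots> = minner E (gr x) (laplace (gr y))"
        using x y by (simp add: inner_laplace gr grd star_add R.F.star_inner L.E.star_inner R.t_mem(2) L.s_mem(2))
      finally show ?thesis by simp
    qed
    have "minner E (gr x) y = minner E (gr x) (laplace (gr y)) + minner E (gr x) (Q (gr y))"
      using gr(2)[OF y] L.F.inner_add_right[of "gr x" "laplace (gr y)" "Q (gr y)"] grd x y Qm by simp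
    also have "\<dots> = minner E (laplace (gr x)) (gr y) + minner E (Q (gr x)) (gr y)"
      using 1 adjoints_inner[OF Q, of "gr x" "gr y"] grd x y by simp
    also have "\<dots> = minner E x (gr y)"
      using gr(2)[OF x] L.F.inner_add_left[of "laplace (gr x)" "Q (gr x)" "gr y"] grd x y Qm by simp
    finally show "minner E (gr x) y = minner E x (gr y)" .
  qed
  have adj: "adjointable E E gr" "adjointable E E C'" using adj_gr C' adjointable_iff_adjoints by blast+
  have "compact_op E E (\<lambda>y. Q (gr y))"
    unfolding Q_def
    by (rule compact_op_comp_left[OF hm hm hm compact_op_comp_right[OF hm hm hm compact adj(1)] adj(2)])
  moreover have "compact_op E E (\<lambda>y. gr (Q y))"
    unfolding Q_def
    by (rule compact_op_comp_left[OF hm hm hm compact_op_comp_left[OF hm hm hm compact adj(2)] adj(1)])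
  moreover have "adjoints E E (\<lambda>y. Q (gr y)) (\<lambda>y. gr (Q y))" by (rule adjoints_comp[OF adj_gr Q])
  moreover have "laplace (gr y) = y - Q (gr y)" if "y \<in> mcarrier E" for y
    using gr(2)[OF that] by (metis add_diff_cancel_right')
  ultimately show thesis using that[OF adj_gr, of "\<lambda>y. Q (gr y)"] gr(1) by blast
qed

end

context two_step
begin

lemma laplace_swap:
  "two_step.laplace t' t s' s = laplace" "two_step.laplace_dom t' t s' s = laplace_dom"
  by (auto simp: laplace_def two_step.laplace_def[OF swap] laplace_dom_def
      two_step.laplace_dom_def[OF swap] fun_eq_iff add.commute)

lemma adjoints_differential_green:
  assumes gr: "adjoints E E gr gr" "\<And>y. y \<in> mcarrier E \<Longrightarrow> gr y \<in> laplace_dom"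
    and K: "adjoints E E K K'" "\<And>y. y \<in> mcarrier E \<Longrightarrow> laplace (gr y) = y - K y"
  obtains A where "adjoints E G (\<lambda>y. app t (gr y)) A"
proof (rule R.adjoints_app_solution)
  interpret EE: hilbert_module_pair E E ..
  show "adjoints E E (\<lambda>y. gr y + (y - K y)) (\<lambda>y. gr y + (y - K' y))"
    by (rule EE.adjoints_op_add[OF gr(1) EE.adjoints_op_diff[OF adjoints_id K(1)]])
  note grd = laplace_domD[OF gr(2)]
  show "gr y \<in> opdom t" if "y \<in> mcarrier E" for y using grd[OF that] by simp
  fix y w assume y: "y \<in> mcarrier E" and w: "w \<in> opdom t'" "app t' w \<in> opdom t"
  have "minner E (gr y + (y - K y)) (app t' w) = minner E (gr y) (app t' w) + minner E (laplace (gr y)) (app t' w)"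
    unfolding K(2)[OF y, symmetric] using grd[OF y] w by (simp add: L.F.inner_add_left R.s_mem(2))
  also have "minner E (laplace (gr y)) (app t' w) = minner E (app t' (app t (gr y))) (app t' w)"
    using grd[OF y] w by (simp add: laplace_def L.F.inner_add_left R.s_mem(2) L.t_mem(2) orthogonal)
  also have "\<dots> = minner G (app t (gr y)) (app t (app t' w))"
    using grd[OF y] w by (simp add: R.formal')
  finally show "minner E (gr y) (app t' w) + minner G (app t (gr y)) (app t (app t' w)) =
      minner E (gr y + (y - K y)) (app t' w)" ..
qed

text \<open>
  The parametrix is \<open>P\<^sub>l = (t G)\<^sup>*\<close>, \<open>P\<^sub>r = s' G\<close>. With \<open>Z = t' t G\<close> one has \<open>P\<^sub>l t = Z\<^sup>*\<close> on the domain of \<open>t\<close>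
  and \<open>s P\<^sub>r = 1 - K - Z\<close>, so that the remainder is \<open>K + Z - Z\<^sup>*\<close>. The ranges of \<open>Z\<close> and \<open>1 - K - Z\<close> are
  orthogonal, hence \<open>Z\<^sup>* (1 - K) = Z\<^sup>* Z\<close> is self-adjoint, and \<open>Z - Z\<^sup>* = K\<^sup>* Z - Z\<^sup>* K\<close> is compact.
\<close>

lemma parametrix_of_elliptic:
  assumes ell: "elliptic C c"
  obtains Pl Pr K where "adjointable G E Pl" "adjointable E F Pr" "compact_op E E K"
    "\<And>x. x \<in> opdom t \<Longrightarrow> Pr x \<in> opdom s \<and> Pl (app t x) + app s (Pr x) = x - K x"
proof -
  interpret EE: hilbert_module_pair E E ..
  have hm: "hilbert_module E" by unfold_locales
  obtain gr K K' where adj_gr: "adjoints E E gr gr" and K: "adjoints E E K K'"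
      and compact: "compact_op E E K" "compact_op E E K'"
      and gr: "\<And>y. y \<in> mcarrier E \<Longrightarrow> gr y \<in> laplace_dom"
      "\<And>y. y \<in> mcarrier E \<Longrightarrow> laplace (gr y) = y - K y"
    by (rule green_operator[OF ell]) blast
  note grd = laplace_domD[OF gr(1)]
  obtain A where A: "adjoints E G (\<lambda>y. app t (gr y)) A"
    by (rule adjoints_differential_green[OF adj_gr gr(1) K gr(2)])
  obtain B where B: "adjoints E F (\<lambda>y. app s' (gr y)) B"
    by (rule two_step.adjoints_differential_green[OF swap adj_gr _ K]) (auto simp: laplace_swap gr)
  define Z where "Z y = app t' (app t (gr y))" for y
  define M' where "M' y = gr y + (y - K' y)" for y
  have M: "adjoints E E (\<lambda>y. gr y + (y - K y)) M'"
    unfolding M'_def by (rule EE.adjoints_op_add[OF adj_gr EE.adjoints_op_diff[OF adjoints_id K]])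
  define b where "b z = (SOME x. x \<in> opdom t \<and> app t x \<in> opdom t' \<and> x + app t' (app t x) = z)" for z
  have b: "b z \<in> opdom t \<and> app t (b z) \<in> opdom t' \<and> b z + app t' (app t (b z)) = z"
    if "z \<in> mcarrier E" for z
    unfolding b_def by (rule someI_ex) (use R.surj_t[OF that] in blast)
  \<comment> \<open>The adjoint of \<open>Z\<close>, written with the resolvent \<open>b\<close> of \<open>t' t\<close>.\<close>
  define Z' where "Z' z = M' (app t' (app t (b z)))" for z
  have Z_mem: "Z y \<in> mcarrier E" if "y \<in> mcarrier E" for y
    using grd[OF that] by (simp add: Z_def R.s_mem(2))
  have Z: "adjoints E E Z Z'"
    unfolding adjoints_def
  proof (intro conjI ballI)
    show "Z \<in> mcarrier E \<rightarrow> mcarrier E" using Z_mem by auto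
    show "Z' \<in> mcarrier E \<rightarrow> mcarrier E"
      using b R.s_mem(2) adjoints_mem[OF EE.adjoints_sym[OF M]] by (auto simp: Z'_def)
    fix y z assume y: "y \<in> mcarrier E" and z: "z \<in> mcarrier E"
    let ?x = "gr y" and ?b = "b z"
    have bz: "?b \<in> opdom t" "app t ?b \<in> opdom t'" "?b + app t' (app t ?b) = z" using b[OF z] by auto
    have "minner E (Z y) z = minner E (Z y) (?b + app t' (app t ?b))" by (simp only: bz(3))
    also have "\<dots> = minner E (Z y) ?b + minner E (Z y) (app t' (app t ?b))"
      using bz(1,2) Z_mem[OF y] by (simp add: L.F.inner_add_right R.t_mem(1) R.s_mem(2))
    also have "minner E (Z y) ?b = minner E ?x (app t' (app t ?b))"
      using bz(1,2) grd[OF y] by (simp add: Z_def R.formal'[symmetric] R.formal)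
    also have "minner E (Z y) (app t' (app t ?b)) = minner E (laplace ?x) (app t' (app t ?b))"
      using grd[OF y] bz(1,2)
      by (simp add: laplace_def Z_def L.F.inner_add_left R.s_mem(2) L.t_mem(2) orthogonal)
    also have "minner E ?x (app t' (app t ?b)) + minner E (laplace ?x) (app t' (app t ?b)) =
        minner E (?x + (y - K y)) (app t' (app t ?b))"
      unfolding gr(2)[OF y, symmetric] using grd[OF y] bz(1,2) by (simp add: L.F.inner_add_left R.s_mem(2))
    also have "\<dots> = minner E y (Z' z)"
      using adjoints_inner[OF M y R.s_mem(2)[OF bz(2)]] by (simp add: Z'_def)
    finally show "minner E (Z y) z = minner E y (Z' z)" .
  qed
  note Z'_adj = EE.adjoints_sym[OF Z] and K_adj = EE.adjoints_sym[OF K]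
  note mem = Z_mem adjoints_mem[OF Z'_adj] adjoints_mem[OF K] adjoints_mem[OF K_adj]
  have split: "app s (app s' (gr y)) = (y - K y) - Z y" if "y \<in> mcarrier E" for y
    using gr(2)[OF that] by (simp add: laplace_def Z_def algebra_simps)
  have 1: "Z' y = Z' (Z y) + Z' (K y)" if y: "y \<in> mcarrier E" for y
  proof -
    have "Z' ((y - K y) - Z y) = 0"
    proof (rule L.F.eq_if_inner_eq)
      show "Z' ((y - K y) - Z y) \<in> mcarrier E" using y by (simp add: mem L.F.mem)
      fix z assume z: "z \<in> mcarrier E"
      have "minner E (Z z) (app s (app s' (gr y))) = 0"
        using grd[OF y] grd[OF z] by (simp add: Z_def orthogonal')
      then show "minner E z (Z' ((y - K y) - Z y)) = minner E z 0"
        using adjoints_inner[OF Z z, of "(y - K y) - Z y"] y z by (simp add: split mem L.F.mem)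
    qed (rule L.F.zero_mem)
    moreover have "Z' ((y - K y) - Z y) = (Z' y - Z' (K y)) - Z' (Z y)"
      using y by (simp only: EE.adjoints_diff[OF Z'_adj] mem L.F.mem)
    ultimately show ?thesis by (simp add: algebra_simps)
  qed
  have 2: "Z y = Z' (Z y) + K' (Z y)" if y: "y \<in> mcarrier E" for y
  proof (rule L.F.eq_if_inner_eq)
    fix z assume z: "z \<in> mcarrier E"
    have "minner E z (Z y) = minner E (Z' z) y"
      using EE.adjoints_inner'[OF Z y z] .
    also have "\<dots> = minner E (Z' (Z z)) y + minner E (Z' (K z)) y"
      by (subst 1[OF z]) (use y z in \<open>simp add: L.F.inner_add_left mem\<close>)
    also have "\<dots> = minner E z (Z' (Z y)) + minner E z (K' (Z y))"
      using y z adjoints_inner[OF Z'_adj] adjoints_inner[OF Z] adjoints_inner[OF K] by (simp add: mem)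
    finally show "minner E z (Z y) = minner E z (Z' (Z y) + K' (Z y))"
      using y z by (simp add: L.F.inner_add_right mem)
  qed (use y in \<open>simp_all add: mem L.F.mem\<close>)
  have adjb: "adjointable E E Z" "adjointable E E Z'" using Z Z'_adj adjointable_iff_adjoints by blast+
  define D where "D y = K y + (K' (Z y) - Z' (K y))" for y
  have "adjointable G E A" using R.adjoints_sym[OF A] adjointable_iff_adjoints by blast
  moreover have "adjointable E F (\<lambda>y. app s' (gr y))" using B adjointable_iff_adjoints by blast
  moreover have "compact_op E E D"
    unfolding D_def
    by (intro EE.compact_op_add EE.compact_op_diff compact(1)
        compact_op_comp_right[OF hm hm hm compact(2) adjb(1)]
        compact_op_comp_left[OF hm hm hm compact(1) adjb(2)])
  moreover have "app s' (gr x) \<in> opdom s \<and> A (app t x) + app s (app s' (gr x)) = x - D x"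
    if x: "x \<in> opdom t" for x
  proof
    note xE = R.t_mem(1)[OF x]
    show "app s' (gr x) \<in> opdom s" using grd[OF xE] by simp
    have "A (app t x) = Z' x"
    proof (rule L.F.eq_if_inner_eq)
      fix z assume z: "z \<in> mcarrier E"
      have "minner E z (A (app t x)) = minner G (app t (gr z)) (app t x)"
        using adjoints_inner[OF A z R.t_mem(2)[OF x]] by simp
      also have "\<dots> = minner E (Z z) x" using grd[OF z] x by (simp add: Z_def R.formal')
      finally show "minner E z (A (app t x)) = minner E z (Z' x)"
        using adjoints_inner[OF Z z xE] by simp
    qed (use adjoints_mem[OF R.adjoints_sym[OF A] R.t_mem(2)[OF x]] xE in \<open>simp_all add: mem\<close>)
    then show "A (app t x) + app s (app s' (gr x)) = x - D x"
      using 1[OF xE] 2[OF xE] by (simp add: split[OF xE] D_def algebra_simps)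
  qed
  ultimately show thesis by (rule that)
qed

text \<open>
  Pair the parametrix identity with \<open>x\<close> and move \<open>s\<close> to the other side.
\<close>

lemma elliptic_of_parametrix:
  assumes C: "compact_op E E C"
    and l: "0 \<le> l" "\<And>y. y \<in> mcarrier G \<Longrightarrow> Pl y \<in> mcarrier E \<and> mnorm E (Pl y) \<le> l * mnorm G y"
    and r: "0 \<le> r" "\<And>x. x \<in> mcarrier E \<Longrightarrow> Pr x \<in> mcarrier F \<and> mnorm F (Pr x) \<le> r * mnorm E x"
    and eq: "\<And>x. x \<in> opdom t \<Longrightarrow> Pr x \<in> opdom s \<and> Pl (app t x) + app s (Pr x) = x - C x"
  shows "elliptic C (max l r)"
  unfolding elliptic_def
proof (intro conjI ballI)
  fix x assume x: "x \<in> opdom t \<inter> opdom s'"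
  then have xt: "x \<in> opdom t" and xs: "x \<in> opdom s'" by auto
  note e = eq[OF xt] and xE = R.t_mem(1)[OF xt]
  have m: "C x \<in> mcarrier E" "Pl (app t x) \<in> mcarrier E" "app s (Pr x) \<in> mcarrier E" "Pr x \<in> mcarrier F"
      "app t x \<in> mcarrier G" "app s' x \<in> mcarrier F"
    using C xt xs xE l r e R.t_mem(2) L.t_mem(2) L.s_mem(2) by (auto simp: compact_op_def adjointable_def)
  have "x = C x + Pl (app t x) + app s (Pr x)" using e by (simp add: algebra_simps)
  then have "minner E x x = minner E x (C x) + minner E x (Pl (app t x)) + minner F (app s' x) (Pr x)"
    using L.F.inner_add_right[of x "C x + Pl (app t x)" "app s (Pr x)"]
      L.F.inner_add_right[of x "C x" "Pl (app t x)"] L.formal'[of "Pr x" x] xE xs e m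
    by (simp add: L.F.mem)
  then have "(mnorm E x)\<^sup>2 \<le> norm (minner E x (C x)) + norm (minner E x (Pl (app t x))) + norm (minner F (app s' x) (Pr x))"
    unfolding L.F.mnorm_power2 by (simp add: norm_triangle_mono norm_triangle_ineq)
  also have "\<dots> \<le> mnorm E x * mnorm E (C x) + mnorm E x * (l * mnorm G (app t x)) + mnorm F (app s' x) * (r * mnorm E x)"
  proof (intro add_mono)
    show "norm (minner E x (C x)) \<le> mnorm E x * mnorm E (C x)" using xE m by (intro L.F.Cauchy_Schwarz)
    have "norm (minner E x (Pl (app t x))) \<le> mnorm E x * mnorm E (Pl (app t x))"
      using xE m by (intro L.F.Cauchy_Schwarz)
    also have "\<dots> \<le> mnorm E x * (l * mnorm G (app t x))" using l(2)[OF m(5)] by (intro mult_left_mono) auto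
    finally show "norm (minner E x (Pl (app t x))) \<le> mnorm E x * (l * mnorm G (app t x))" .
    have "norm (minner F (app s' x) (Pr x)) \<le> mnorm F (app s' x) * mnorm F (Pr x)"
      using xE m by (intro L.E.Cauchy_Schwarz)
    also have "\<dots> \<le> mnorm F (app s' x) * (r * mnorm E x)" using r(2)[OF xE] by (intro mult_left_mono) auto
    finally show "norm (minner F (app s' x) (Pr x)) \<le> mnorm F (app s' x) * (r * mnorm E x)" .
  qed
  also have "\<dots> \<le> mnorm E x * (mnorm E (C x) + max l r * (mnorm G (app t x) + mnorm F (app s' x)))"
  proof -
    have "l * mnorm G (app t x) \<le> max l r * mnorm G (app t x)" "r * mnorm F (app s' x) \<le> max l r * mnorm F (app s' x)"
      by (intro mult_right_mono; simp)+
    then have "mnorm E (C x) + l * mnorm G (app t x) + r * mnorm F (app s' x) \<le>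
        mnorm E (C x) + max l r * (mnorm G (app t x) + mnorm F (app s' x))"
      by (simp add: algebra_simps)
    from mult_left_mono[OF this L.F.mnorm_nonneg[of x]] show ?thesis by (simp add: algebra_simps)
  qed
  finally have "mnorm E x * mnorm E x \<le> mnorm E x * (mnorm E (C x) + max l r * (mnorm G (app t x) + mnorm F (app s' x)))"
    by (simp add: power2_eq_square)
  then show "mnorm E x \<le> mnorm E (C x) + max l r * (mnorm G (app t x) + mnorm F (app s' x))"
    by (rule le_if_mult_self_le) (use l(1) in \<open>simp_all add: le_max_iff_disj\<close>)
qed (use C l in auto)

end

text \<open>
  The adjoint of \<open>t G\<close> is a left parametrix of \<open>t\<close> whenever \<open>s t G\<close> is the identity up to a remainder.
\<close>

lemma (in adjoint_pair) parametrix_of_green: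
  assumes gr: "adjoints E E gr gr" and K: "adjoints E E K K'"
    and dom: "\<And>y. y \<in> mcarrier E \<Longrightarrow> gr y \<in> opdom t \<and> app t (gr y) \<in> opdom s"
    and eq: "\<And>y. y \<in> mcarrier E \<Longrightarrow> app s (app t (gr y)) = y - K y"
  obtains A where "adjoints E F (\<lambda>y. app t (gr y)) A" "\<And>x. x \<in> opdom t \<Longrightarrow> A (app t x) = x - K' x"
proof -
  interpret EE: hilbert_module_pair E E ..
  have M: "adjoints E E (\<lambda>y. gr y + (y - K y)) (\<lambda>y. gr y + (y - K' y))"
    by (rule EE.adjoints_op_add[OF gr EE.adjoints_op_diff[OF adjoints_id K]])
  obtain A where A: "adjoints E F (\<lambda>y. app t (gr y)) A"
  proof (rule adjoints_app_solution[OF M])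
    fix y w assume y: "y \<in> mcarrier E" and w: "w \<in> opdom s" "app s w \<in> opdom t"
    show "minner E (gr y) (app s w) + minner F (app t (gr y)) (app t (app s w)) =
        minner E (gr y + (y - K y)) (app s w)"
      unfolding eq[OF y, symmetric] using dom[OF y] w
      by (simp add: E.inner_add_left t_mem(1) s_mem(2) formal')
  qed (use dom in auto)
  have "A (app t x) = x - K' x" if x: "x \<in> opdom t" for x
  proof (rule E.eq_if_inner_eq)
    note xE = t_mem(1)[OF x] and tx = t_mem(2)[OF x]
    have K'x: "K' x \<in> mcarrier E" using adjoints_mem[OF EE.adjoints_sym[OF K] xE] .
    then show "x - K' x \<in> mcarrier E" using xE E.diff_mem by blast
    show "A (app t x) \<in> mcarrier E" using adjoints_mem[OF adjoints_sym[OF A] tx] .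
    fix z assume z: "z \<in> mcarrier E"
    have Kz: "K z \<in> mcarrier E" using adjoints_mem[OF K z] .
    have "minner E z (A (app t x)) = minner F (app t (gr z)) (app t x)"
      using adjoints_inner[OF A z tx] by simp
    also have "\<dots> = minner E (z - K z) x" using dom[OF z] x by (simp add: formal' flip: eq[OF z])
    also have "\<dots> = minner E z (x - K' x)"
      using z Kz xE K'x adjoints_inner[OF K z xE] by (simp add: E.inner_diff_left E.inner_diff_right)
    finally show "minner E z (A (app t x)) = minner E z (x - K' x)" .
  qed
  with A show thesis by (rule that)
qed

section \<open>The Dirac operator\<close>

lemma sum_shift:
  fixes J J' :: "int set" and f :: "int \<Rightarrow> 'b::comm_monoid_add"
  assumes "finite J" "finite J'" "\<And>k. k \<notin> J \<Longrightarrow> f k = 0" "\<And>k. k + d \<notin> J' \<Longrightarrow> f k = 0"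
  shows "(\<Sum>j\<in>J'. f (j - d)) = (\<Sum>k\<in>J. f k)"
  by (rule sum.reindex_bij_witness_not_neutral[where S' = "{j \<in> J'. j - d \<notin> J}" and T' = "{k \<in> J. k + d \<notin> J'}"
        and i = "\<lambda>k. k + d" and j = "\<lambda>j. j - d"]) (use assms in auto)

locale graded_complex =
  fixes E :: "int \<Rightarrow> ('a::cstar_algebra, 'e::complex_vector) hmodule"
    and t u :: "int \<Rightarrow> ('e, 'e) unbounded_op"
  assumes steps: "two_step (E (k - 1)) (E k) (E (k + 1)) (t (k - 1)) (u (k - 1)) (t k) (u k)"
begin

sublocale S: two_step "E (k - 1)" "E k" "E (k + 1)" "t (k - 1)" "u (k - 1)" "t k" "u k" for k
  by (rule steps)

lemma module: "hilbert_module (E k)" ..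

text \<open>
  The part of the Dirac operator from the degrees in \<open>J\<close> to those in \<open>J'\<close>. Taking the even and the odd degrees,
  in either order, gives the two halves \<open>D\<^sup>+\<close> and \<open>D\<^sup>-\<close>.
\<close>

definition dirac :: "int set \<Rightarrow> int set \<Rightarrow> (int \<Rightarrow> 'e, int \<Rightarrow> 'e) unbounded_op"
  where "dirac J J' = \<lparr>
    opdom = {x \<in> mcarrier (dsum J E). \<forall>k\<in>J. x k \<in> opdom (t k) \<inter> opdom (u (k - 1))},
    app = (\<lambda>x j. if j \<in> J' then app (t (j - 1)) (x (j - 1)) + app (u j) (x (j + 1)) else 0)\<rparr>"

end

text \<open>
  The two index sets stand for the even and the odd degrees. A degree next to one of them is in the other or
  carries the zero module, so that no differential leaves the chosen range.
\<close>

locale dirac_complex = graded_complex E t u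
  for E :: "int \<Rightarrow> ('a::cstar_algebra, 'e::complex_vector) hmodule" and t u +
  fixes J J' :: "int set"
  assumes finite_degrees: "finite J" "finite J'"
    and neighbours: "\<lbrakk>k \<in> J; j = k + 1 \<or> j = k - 1; j \<notin> J'\<rbrakk> \<Longrightarrow> mcarrier (E j) = {0}"
    and neighbours': "\<lbrakk>k \<in> J'; j = k + 1 \<or> j = k - 1; j \<notin> J\<rbrakk> \<Longrightarrow> mcarrier (E j) = {0}"
begin

sublocale dJ: finite_sum_modules J E by unfold_locales (rule finite_degrees)
sublocale dJ': finite_sum_modules J' E by unfold_locales (rule finite_degrees)

lemma swap: "dirac_complex E t u J' J"
  by unfold_locales (use finite_degrees neighbours neighbours' in auto)

abbreviation "EJ \<equiv> dsum J E"
abbreviation "EJ' \<equiv> dsum J' E"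
abbreviation "D \<equiv> dirac J J'"
abbreviation "D' \<equiv> dirac J' J"

lemma u_mem: "y \<in> opdom (u j) \<Longrightarrow> y \<in> mcarrier (E (j + 1))" "y \<in> opdom (u j) \<Longrightarrow> app (u j) y \<in> mcarrier (E j)"
  using S.R.s_mem(1,2)[of y j] by auto

lemma t_mem: "x \<in> opdom (t j) \<Longrightarrow> x \<in> mcarrier (E j)" "x \<in> opdom (t j) \<Longrightarrow> app (t j) x \<in> mcarrier (E (j + 1))"
  using S.R.t_mem(1,2)[of x j] by auto

lemma t_prev_mem: "x \<in> opdom (t (j - 1)) \<Longrightarrow> app (t (j - 1)) x \<in> mcarrier (E j)"
  using t_mem(2)[of x "j - 1"] by simp

lemma zero_dom: "0 \<in> opdom (t j)" "0 \<in> opdom (u j)" "app (t j) 0 = 0" "app (u j) 0 = 0"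
  using S.R.t_mem(3)[of j] S.R.s_mem(3)[of j] S.R.t_app(5)[of j] S.R.s_app(5)[of j] by auto

lemma dirac_opdom_iff:
  "x \<in> opdom D \<longleftrightarrow> (\<forall>k. x k \<in> opdom (t k) \<and> x k \<in> opdom (u (k - 1))) \<and> (\<forall>k. k \<notin> J \<longrightarrow> x k = 0)"
proof
  assume x: "x \<in> opdom D"
  have "x k \<in> opdom (t k) \<and> x k \<in> opdom (u (k - 1))" for k
    using x zero_dom by (cases "k \<in> J") (auto simp: dirac_def dsum_carrier)
  then show "(\<forall>k. x k \<in> opdom (t k) \<and> x k \<in> opdom (u (k - 1))) \<and> (\<forall>k. k \<notin> J \<longrightarrow> x k = 0)"
    using x by (auto simp: dirac_def dsum_carrier)
qed (auto simp: dirac_def dsum_carrier t_mem)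

lemma dirac_opdomD:
  assumes "x \<in> opdom D"
  shows "x k \<in> opdom (t k)" "x k \<in> opdom (u (k - 1))" "x (k + 1) \<in> opdom (u k)" "k \<notin> J \<Longrightarrow> x k = 0"
    "x \<in> mcarrier EJ"
proof -
  show "x (k + 1) \<in> opdom (u k)" using assms[unfolded dirac_opdom_iff, THEN conjunct1, rule_format, of "k + 1"] by simp
  show "x \<in> mcarrier EJ" using assms by (simp add: dirac_def)
qed (use assms dirac_opdom_iff in auto)

text \<open>
  Outside the degrees of the target both summands lie in a zero module, so the case distinction in the
  definition can be dropped.
\<close>

lemma dirac_app:
  assumes x: "x \<in> opdom D"
  shows "app D x j = app (t (j - 1)) (x (j - 1)) + app (u j) (x (j + 1))"
proof (cases "j \<in> J'")
  case False
  note xd = dirac_opdomD[OF x]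
  have 1: "app (t (j - 1)) (x (j - 1)) = 0"
  proof (cases "j - 1 \<in> J")
    case True
    then have "mcarrier (E j) = {0}" using neighbours False by force
    then show ?thesis using t_prev_mem[OF xd(1)[of "j - 1"]] by simp
  qed (simp add: xd(4) zero_dom)
  have 2: "app (u j) (x (j + 1)) = 0"
  proof (cases "j + 1 \<in> J")
    case True
    then have "mcarrier (E j) = {0}" using neighbours False by force
    then show ?thesis using u_mem(2)[OF xd(3)[of j]] by simp
  qed (simp add: xd(4) zero_dom)
  show ?thesis using False 1 2 by (simp add: dirac_def)
qed (simp add: dirac_def)

lemma dirac_app_mem:
  assumes x: "x \<in> opdom D"
  shows "app D x \<in> mcarrier EJ'"
proof -
  show ?thesis
    using dirac_opdomD[OF x] t_prev_mem u_mem(2)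
    by (auto simp: dsum_carrier dirac_app[OF x] S.L.F.add_mem) (simp add: dirac_def flip: dirac_app[OF x])
qed

lemma dirac_linear: "densely_defined_linear EJ EJ' D"
  unfolding densely_defined_linear_def
proof (intro conjI ballI allI)
  interpret EJ: hilbert_module EJ by (rule dJ.hilbert_module_dsum)
  have add: "x + y \<in> opdom D" if "x \<in> opdom D" "y \<in> opdom D" for x y
    using that by (simp add: dirac_opdom_iff S.R.t_mem(4) S.L.s_mem(4))
  have scale: "c *\<^sub>C x \<in> opdom D" if "x \<in> opdom D" for x c
    using that by (simp add: dirac_opdom_iff S.R.t_mem(5) S.L.s_mem(5) scaleC_fun_def)
  have act: "mact EJ x a \<in> opdom D" if "x \<in> opdom D" for x a
    using that by (simp add: dirac_opdom_iff dsum_act S.R.t_mem(3,6) S.L.s_mem(3,6))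
  have zero: "0 \<in> opdom D" by (simp add: dirac_opdom_iff zero_dom)
  show "submodule EJ (opdom D)"
    unfolding submodule_def using dirac_opdomD(5) add scale act zero by auto
  show "app D \<in> opdom D \<rightarrow> mcarrier EJ'" using dirac_app_mem by auto
  fix x assume x: "x \<in> opdom D"
  note xd = dirac_opdomD[OF x]
  show "app D (x + y) = app D x + app D y" if y: "y \<in> opdom D" for y
  proof
    fix j
    note yd = dirac_opdomD[OF y]
    show "app D (x + y) j = (app D x + app D y) j"
      using S.R.t_app(1)[OF xd(1)[of "j - 1"] yd(1)[of "j - 1"]] S.R.s_app(1)[OF xd(3)[of j] yd(3)[of j]]
      by (simp add: dirac_app[OF x] dirac_app[OF y] dirac_app[OF add[OF x y]])
  qed
  show "app D (c *\<^sub>C x) = c *\<^sub>C app D x" for c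
  proof
    fix j
    show "app D (c *\<^sub>C x) j = (c *\<^sub>C app D x) j"
      using S.R.t_app(2)[OF xd(1)[of "j - 1"], of c] S.R.s_app(2)[OF xd(3)[of j], of c]
      by (subst dirac_app[OF scale[OF x]]) (simp add: scaleC_fun_def dirac_app[OF x] scaleC_add_right)
  qed
  show "app D (mact EJ x a) = mact EJ' (app D x) a" for a
  proof
    fix j
    have eq: "mact EJ x a k = mact (E k) (x k) a" for k
    proof (cases "k \<in> J")
      case False
      have "mact (E k) 0 a = 0" using S.L.F.act_scaleC_left[OF S.L.F.zero_mem, of k 0 a] by simp
      then show ?thesis using False by (simp add: dsum_act xd(4))
    qed (simp add: dsum_act)
    have 1: "app (t (j - 1)) (mact (E (j - 1)) (x (j - 1)) a) = mact (E j) (app (t (j - 1)) (x (j - 1))) a"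
      using S.R.t_app(3)[OF xd(1)[of "j - 1"], of a] by simp
    have 2: "app (u j) (mact (E (j + 1)) (x (j + 1)) a) = mact (E j) (app (u j) (x (j + 1))) a"
      using S.R.s_app(3)[OF xd(3)[of j], of a] by simp
    show "app D (mact EJ x a) j = mact EJ' (app D x) a j"
    proof (cases "j \<in> J'")
      case True
      then show ?thesis
        using S.L.F.act_add_left[OF t_prev_mem[OF xd(1)[of "j - 1"]] u_mem(2)[OF xd(3)[of j]], of a]
        by (simp add: dirac_app[OF x] dirac_app[OF act[OF x]] eq 1 2 dsum_act[of J'])
    next
      case False
      then show ?thesis by (simp add: dirac_def dsum_act[of J'])
    qed
  qed
next
  interpret EJ: hilbert_module EJ by (rule dJ.hilbert_module_dsum)
  show "mdense EJ (opdom D)"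
    unfolding mdense_def
  proof (intro conjI ballI allI impI)
    show "opdom D \<subseteq> mcarrier EJ" using dirac_opdomD(5) by auto
    fix x and e :: real assume x: "x \<in> mcarrier EJ" and e: "e > 0"
    have "\<exists>Y. (\<forall>n. Y n \<in> opdom (t k) \<inter> opdom (u (k - 1))) \<and> mtendsto (E k) Y (x k)" if k: "k \<in> J" for k
    proof -
      have "x k \<in> mcarrier (E k)" using x k by (simp add: dsum_carrier)
      from S.L.F.mdense_sequence[OF S.dense_common_domain this] show ?thesis by metis
    qed
    then obtain Y where Y: "\<And>k n. k \<in> J \<Longrightarrow> Y k n \<in> opdom (t k) \<inter> opdom (u (k - 1))"
        "\<And>k. k \<in> J \<Longrightarrow> mtendsto (E k) (Y k) (x k)"
      by metis
    define X where "X n k = (if k \<in> J then Y k n else 0)" for n k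
    have X: "X n \<in> opdom D" for n using Y(1) by (auto simp: dirac_opdom_iff X_def zero_dom)
    have "mtendsto EJ X x" by (rule dJ.mtendsto_dsum) (simp add: X_def Y)
    then obtain n where "mnorm EJ (X n - x) < e"
      using e order_tendstoD(2)[of "\<lambda>n. mnorm EJ (X n - x)" 0 sequentially e]
      by (auto simp: mtendsto_def eventually_sequentially)
    then show "\<exists>y\<in>opdom D. mnorm EJ (x - y) < e"
      using X[of n] EJ.mnorm_diff_commute[OF x dirac_opdomD(5)[OF X[of n]]]
      by (intro bexI[of _ "X n"]) simp_all
  qed
qed

text \<open>
  Both sides are sums over pairs of neighbouring degrees. They agree after a shift of the index, in which the
  terms at the ends of the complex vanish.
\<close>

lemma dirac_formal:
  assumes x: "x \<in> opdom D" and y: "y \<in> opdom D'"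
  shows "minner EJ' (app D x) y = minner EJ x (app D' y)"
proof -
  interpret sw: dirac_complex E t u J' J by (rule swap)
  note xd = dirac_opdomD[OF x] and yd = sw.dirac_opdomD[OF y]
  define f where "f k = minner (E k) (x k) (app (u k) (y (k + 1)))" for k
  define g where "g k = minner (E k) (x k) (app (t (k - 1)) (y (k - 1)))" for k
  have m: "x k \<in> mcarrier (E k)" "y k \<in> mcarrier (E k)" "app (u k) (y (k + 1)) \<in> mcarrier (E k)"
    "app (u k) (x (k + 1)) \<in> mcarrier (E k)" "app (t (k - 1)) (y (k - 1)) \<in> mcarrier (E k)"
    "app (t (k - 1)) (x (k - 1)) \<in> mcarrier (E k)" for k
    using xd yd t_mem(1) u_mem(2) t_prev_mem by auto
  have "minner EJ' (app D x) y = (\<Sum>j\<in>J'. f (j - 1) + g (j - (-1)))"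
    unfolding dsum_inner
  proof (rule sum.cong)
    fix j
    have "minner (E j) (app (t (j - 1)) (x (j - 1))) (y j) = f (j - 1)"
      using S.L.formal[OF xd(1)[of "j - 1"] yd(2)[of j]] by (simp add: f_def)
    moreover have "minner (E j) (app (u j) (x (j + 1))) (y j) = g (j + 1)"
      using S.R.formal'[OF yd(1)[of j] xd(3)[of j]] by (simp add: g_def)
    ultimately show "minner (E j) (app D x j) (y j) = f (j - 1) + g (j - (-1))"
      using m by (simp add: dirac_app[OF x] S.L.F.inner_add_left)
  qed simp
  also have "\<dots> = (\<Sum>k\<in>J. f k) + (\<Sum>k\<in>J. g k)"
    unfolding sum.distrib
  proof (intro arg_cong2[where f = "(+)"] sum_shift finite_degrees)
    show "f k = 0" if "k \<notin> J" for k using xd(4)[OF that] m by (simp add: f_def)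
    show "g k = 0" if "k \<notin> J" for k using xd(4)[OF that] m by (simp add: g_def)
    show "f k = 0" if "k + 1 \<notin> J'" for k using yd(4)[OF that] m by (simp add: f_def zero_dom)
    show "g k = 0" if "k + - 1 \<notin> J'" for k
      using yd(4)[of "k - 1"] that m by (simp add: g_def zero_dom)
  qed
  also have "\<dots> = minner EJ x (app D' y)"
    unfolding dsum_inner using m
    by (simp add: f_def g_def sw.dirac_app[OF y] S.L.F.inner_add_right sum.distrib add.commute)
  finally show ?thesis .
qed

text \<open>
  The mixed terms of the square contain two consecutive differentials, or two consecutive adjoints, and vanish.
\<close>

lemma dirac_square:
  assumes x: "x \<in> mcarrier EJ" and lap: "\<And>k. k \<in> J \<Longrightarrow> x k \<in> S.laplace_dom k"
  shows "x \<in> opdom D" "app D x \<in> opdom D'" "app D' (app D x) k = (if k \<in> J then S.laplace k (x k) else 0)"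
proof -
  interpret sw: dirac_complex E t u J' J by (rule swap)
  have out: "x k = 0" if "k \<notin> J" for k using x that by (simp add: dsum_carrier)
  have lap: "x k \<in> S.laplace_dom k" for k
  proof (cases "k \<in> J")
    case False
    then show ?thesis by (simp add: out S.laplace_dom_def zero_dom)
  qed (rule lap)
  have ld: "x k \<in> opdom (t k)" "app (t k) (x k) \<in> opdom (u k)" "x k \<in> opdom (u (k - 1))"
      "app (u (k - 1)) (x k) \<in> opdom (t (k - 1))" for k
    using S.laplace_domD[OF lap[of k]] by auto
  show xD: "x \<in> opdom D" using ld out by (simp add: dirac_opdom_iff)
  have tt: "app (t (k - 1)) (x (k - 1)) \<in> opdom (t k)" "app (t k) (app (t (k - 1)) (x (k - 1))) = 0" for k
    using S.s_exact[OF ld(1)[of "k - 1"]] by auto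
  have uu: "app (u k) (x (k + 1)) \<in> opdom (u (k - 1))" "app (u (k - 1)) (app (u k) (x (k + 1))) = 0" for k
    using S.coexact[of "x (k + 1)" k] ld(3)[of "k + 1"] by auto
  have tu: "app (t (k - 1)) (x (k - 1)) \<in> opdom (u (k - 1))" "app (u k) (x (k + 1)) \<in> opdom (t k)" for k
    using ld(2)[of "k - 1"] ld(4)[of "k + 1"] by auto
  have "app D x k = 0" if "k \<notin> J'" for k using that by (simp add: dirac_def)
  then show Dx: "app D x \<in> opdom D'"
    unfolding sw.dirac_opdom_iff
    using S.R.t_mem(4)[OF tt(1) tu(2)] S.L.s_mem(4)[OF tu(1) uu(1)] by (simp add: dirac_app[OF xD])
  have 1: "app (t (k - 1)) (app D x (k - 1)) = app (t (k - 1)) (app (u (k - 1)) (x k))"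
    using S.R.t_app(1)[OF tt(1)[of "k - 1"] tu(2)[of "k - 1"]] tt(2)[of "k - 1"]
    by (simp add: dirac_app[OF xD])
  have 2: "app (u k) (app D x (k + 1)) = app (u k) (app (t k) (x k))"
    using S.R.s_app(1)[of "app (t k) (x k)" k "app (u (k + 1)) (x (k + 1 + 1))"] ld(2)[of k] uu[of "k + 1"]
    by (simp add: dirac_app[OF xD])
  have "app D' (app D x) k = S.laplace k (x k)"
    by (simp add: sw.dirac_app[OF Dx] 1 2 S.laplace_def)
  moreover have "app D' (app D x) k = 0" if "k \<notin> J" using that by (simp add: dirac_def)
  ultimately show "app D' (app D x) k = (if k \<in> J then S.laplace k (x k) else 0)" by simp
qed

lemma dirac_surj:
  assumes y: "y \<in> mcarrier EJ"
  shows "\<exists>x\<in>opdom D. app D x \<in> opdom D' \<and> x + app D' (app D x) = y"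
proof -
  have "\<exists>x. x \<in> S.laplace_dom k \<and> S.laplace k x + x = y k" if k: "k \<in> J" for k
  proof -
    have "y k \<in> mcarrier (E k)" using y k by (simp add: dsum_carrier)
    from S.laplace_resolvent[OF this] show ?thesis by metis
  qed
  then obtain z where z: "\<And>k. k \<in> J \<Longrightarrow> z k \<in> S.laplace_dom k \<and> S.laplace k (z k) + z k = y k" by metis
  define x where "x k = (if k \<in> J then z k else 0)" for k
  have xm: "x \<in> mcarrier EJ" using z S.laplace_domD(5) by (simp add: dsum_carrier x_def)
  have lap: "x k \<in> S.laplace_dom k" if "k \<in> J" for k using z that by (simp add: x_def)
  note sq = dirac_square[OF xm lap]
  have "x + app D' (app D x) = y"
  proof
    fix k
    show "(x + app D' (app D x)) k = y k"
      using z[of k] y by (simp add: sq(3) x_def dsum_carrier add.commute)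
  qed
  with sq(1,2) show ?thesis by blast
qed

lemma dirac_adjoint_pair: "adjoint_pair EJ EJ' D D'"
proof -
  interpret sw: dirac_complex E t u J' J by (rule swap)
  interpret EJ: hilbert_module EJ by (rule dJ.hilbert_module_dsum)
  interpret EJ': hilbert_module EJ' by (rule dJ'.hilbert_module_dsum)
  show ?thesis
    by unfold_locales
      (simp_all add: dirac_linear sw.dirac_linear dirac_formal dirac_surj sw.dirac_surj)
qed

lemma single_dirac:
  assumes k: "k \<in> J" and x: "x \<in> opdom (t k) \<inter> opdom (u (k - 1))"
  shows "single k x \<in> opdom D"
    "mnorm EJ' (app D (single k x)) \<le> mnorm (E (k + 1)) (app (t k) x) + mnorm (E (k - 1)) (app (u (k - 1)) x)"
proof -
  interpret EJ': hilbert_module EJ' by (rule dJ'.hilbert_module_dsum)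
  show xD: "single k x \<in> opdom D" using k x by (auto simp: dirac_opdom_iff single_def zero_dom)
  have m: "app (t k) x \<in> mcarrier (E (k + 1))" "app (u (k - 1)) x \<in> mcarrier (E (k - 1))"
    using x t_mem(2) u_mem(2) by auto
  have eq: "app D (single k x) = single (k + 1) (app (t k) x) + single (k - 1) (app (u (k - 1)) x)"
  proof
    fix j
    show "app D (single k x) j = (single (k + 1) (app (t k) x) + single (k - 1) (app (u (k - 1)) x)) j"
      unfolding dirac_app[OF xD] by (auto simp: single_def zero_dom)
  qed
  have s: "single (k + 1) (app (t k) x) \<in> mcarrier EJ'" "single (k - 1) (app (u (k - 1)) x) \<in> mcarrier EJ'"
    using m neighbours[OF k] by (auto intro!: dJ'.single_mem)
  show "mnorm EJ' (app D (single k x)) \<le> mnorm (E (k + 1)) (app (t k) x) + mnorm (E (k - 1)) (app (u (k - 1)) x)"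
    unfolding eq
    using EJ'.mnorm_triangle[OF s] dJ'.mnorm_single_le[OF m(1)] dJ'.mnorm_single_le[OF m(2)] by linarith
qed

lemma compact_corner:
  assumes k: "k \<in> J" and C: "compact_op EJ EJ C"
  shows "compact_op (E k) (E k) (\<lambda>x. C (single k x) k)"
proof -
  have adj: "adjointable EJ (E k) (\<lambda>x. x k)" "adjointable (E k) EJ (single k)"
    using dJ.adjoints_single[OF k] dJ.adjoints_component[OF k] by (auto simp: adjointable_iff_adjoints)
  note hm = module[of k] dJ.hilbert_module_dsum
  from compact_op_comp_right[OF hm hm(2) C adj(2)]
  have "compact_op (E k) EJ (\<lambda>x. C (single k x))" .
  from compact_op_comp_left[OF hm(1,2,1) this adj(1)] show ?thesis .
qed

text \<open>
  Test the parametrix on elements that are concentrated in degree \<open>k\<close>.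
\<close>

lemma elliptic_of_left_parametrix:
  assumes k: "k \<in> J" and P: "adjointable EJ' EJ P" and C: "compact_op EJ EJ C"
    and eq: "\<And>x. x \<in> opdom D \<Longrightarrow> P (app D x) = x - C x"
  obtains C c where "S.elliptic k C c"
proof -
  obtain c where c: "c \<ge> 0" "\<And>y. y \<in> mcarrier EJ' \<Longrightarrow> mnorm EJ (P y) \<le> c * mnorm EJ' y"
    using adjointable_bounded[OF dJ'.hilbert_module_dsum dJ.hilbert_module_dsum P] by blast
  have "mnorm (E k) x \<le> mnorm (E k) (C (single k x) k) +
      c * (mnorm (E (k + 1)) (app (t k) x) + mnorm (E (k - 1)) (app (u (k - 1)) x))"
    if x: "x \<in> opdom (t k) \<inter> opdom (u (k - 1))" for x
  proof -
    let ?X = "single k x"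
    note X = single_dirac[OF k x] and XE = dirac_opdomD(5)[OF single_dirac(1)[OF k x]]
    have PD: "P (app D ?X) \<in> mcarrier EJ" using P dirac_app_mem[OF X(1)] by (auto simp: adjointable_def)
    have CX: "C ?X \<in> mcarrier EJ" using C XE by (auto simp: compact_op_def adjointable_def)
    have m: "P (app D ?X) k \<in> mcarrier (E k)" "C ?X k \<in> mcarrier (E k)"
      using PD CX k by (simp_all add: dsum_carrier)
    have "x = P (app D ?X) k + C ?X k" using eq[OF X(1)] by (simp add: single_def)
    then have "mnorm (E k) x \<le> mnorm (E k) (P (app D ?X) k) + mnorm (E k) (C ?X k)"
      using S.L.F.mnorm_triangle[OF m] by simp
    also have "mnorm (E k) (P (app D ?X) k) \<le> mnorm EJ (P (app D ?X))"
      using PD k by (intro dJ.component_norm_le) (simp_all add: dsum_carrier)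
    also have "\<dots> \<le> c * mnorm EJ' (app D ?X)" by (rule c(2)[OF dirac_app_mem[OF X(1)]])
    also have "\<dots> \<le> c * (mnorm (E (k + 1)) (app (t k) x) + mnorm (E (k - 1)) (app (u (k - 1)) x))"
      by (rule mult_left_mono[OF X(2) c(1)])
    finally show ?thesis by simp
  qed
  then show thesis using that compact_corner[OF k C] c(1) unfolding S.elliptic_def by blast
qed

text \<open>
  A right parametrix of the opposite Dirac operator serves as well: pair \<open>X = C X + D' P X\<close> with \<open>X\<close> and use
  \<open>\<langle>X | D' P X\<rangle> = \<langle>D X | P X\<rangle>\<close>. In this way the remainder \<open>C\<close> itself, rather than its adjoint, enters the
  estimate.
\<close>

lemma elliptic_of_right_parametrix:
  assumes k: "k \<in> J" and P: "adjointable EJ EJ' P" and C: "compact_op EJ EJ C"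
    and eq: "\<And>y. y \<in> mcarrier EJ \<Longrightarrow> P y \<in> opdom D' \<and> app D' (P y) = y - C y"
  obtains C c where "S.elliptic k C c"
proof -
  interpret EJ: hilbert_module EJ by (rule dJ.hilbert_module_dsum)
  interpret EJ': hilbert_module EJ' by (rule dJ'.hilbert_module_dsum)
  obtain c where c: "c \<ge> 0" "\<And>y. y \<in> mcarrier EJ \<Longrightarrow> mnorm EJ' (P y) \<le> c * mnorm EJ y"
    using adjointable_bounded[OF dJ.hilbert_module_dsum dJ'.hilbert_module_dsum P] by blast
  have "mnorm (E k) x \<le> mnorm (E k) (C (single k x) k) +
      c * (mnorm (E (k + 1)) (app (t k) x) + mnorm (E (k - 1)) (app (u (k - 1)) x))"
    if x: "x \<in> opdom (t k) \<inter> opdom (u (k - 1))" for x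
  proof -
    let ?X = "single k x"
    let ?d = "mnorm (E (k + 1)) (app (t k) x) + mnorm (E (k - 1)) (app (u (k - 1)) x)"
    note X = single_dirac[OF k x] and XE = dirac_opdomD(5)[OF single_dirac(1)[OF k x]]
    have xE: "x \<in> mcarrier (E k)" using x t_mem(1) by auto
    have CX: "C ?X \<in> mcarrier EJ" using C XE by (auto simp: compact_op_def adjointable_def)
    have PX: "P ?X \<in> mcarrier EJ'" using P XE by (auto simp: adjointable_def)
    have DX: "app D ?X \<in> mcarrier EJ'" by (rule dirac_app_mem[OF X(1)])
    note e = eq[OF XE]
    have D'PX: "app D' (P ?X) \<in> mcarrier EJ" using e XE CX by (simp add: EJ.diff_mem)
    have inner: "minner EJ ?X z = minner (E k) x (z k)" if "z \<in> mcarrier EJ" for z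
      using adjoints_inner[OF dJ.adjoints_single[OF k] xE that] .
    have "?X = C ?X + app D' (P ?X)" using e by simp
    then have "minner EJ ?X ?X = minner EJ ?X (C ?X) + minner EJ ?X (app D' (P ?X))"
      using EJ.inner_add_right[OF XE CX D'PX] by simp
    then have "minner (E k) x x = minner (E k) x (C ?X k) + minner EJ' (app D ?X) (P ?X)"
      using inner[OF XE] inner[OF CX] dirac_formal[OF X(1), of "P ?X"] e by (simp add: single_def)
    then have "(mnorm (E k) x)\<^sup>2 \<le> norm (minner (E k) x (C ?X k)) + norm (minner EJ' (app D ?X) (P ?X))"
      unfolding S.L.F.mnorm_power2 by (simp add: norm_triangle_ineq)
    also have "norm (minner (E k) x (C ?X k)) \<le> mnorm (E k) x * mnorm (E k) (C ?X k)"
      using CX k xE by (intro S.L.F.Cauchy_Schwarz) (simp_all add: dsum_carrier)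
    also have "norm (minner EJ' (app D ?X) (P ?X)) \<le> mnorm EJ' (app D ?X) * mnorm EJ' (P ?X)"
      by (rule EJ'.Cauchy_Schwarz[OF DX PX])
    also have "\<dots> \<le> ?d * (c * mnorm (E k) x)"
    proof (rule mult_mono[OF X(2)])
      have "mnorm EJ' (P ?X) \<le> c * mnorm EJ ?X" by (rule c(2)[OF XE])
      also have "\<dots> \<le> c * mnorm (E k) x" by (rule mult_left_mono[OF dJ.mnorm_single_le[OF xE] c(1)])
      finally show "mnorm EJ' (P ?X) \<le> c * mnorm (E k) x" .
    qed simp_all
    finally have "mnorm (E k) x * mnorm (E k) x \<le> mnorm (E k) x * (mnorm (E k) (C ?X k) + c * ?d)"
      by (simp add: power2_eq_square algebra_simps)
    then show ?thesis by (rule le_if_mult_self_le) (use c(1) in simp_all)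
  qed
  then show thesis using that compact_corner[OF k C] c(1) unfolding S.elliptic_def by blast
qed

lemma dirac_green:
  assumes ell: "\<And>k. k \<in> J \<Longrightarrow> \<exists>C c. S.elliptic k C c"
  obtains gr K K' where "adjoints EJ EJ gr gr" "adjoints EJ EJ K K'" "compact_op EJ EJ K" "compact_op EJ EJ K'"
    "\<And>y. y \<in> mcarrier EJ \<Longrightarrow> gr y \<in> opdom D \<and> app D (gr y) \<in> opdom D'"
    "\<And>y. y \<in> mcarrier EJ \<Longrightarrow> app D' (app D (gr y)) = y - K y"
proof -
  define good where "good k g L L' \<longleftrightarrow> adjoints (E k) (E k) g g \<and> adjoints (E k) (E k) L L' \<and>
      compact_op (E k) (E k) L \<and> compact_op (E k) (E k) L' \<and>
      (\<forall>y\<in>mcarrier (E k). g y \<in> S.laplace_dom k \<and> S.laplace k (g y) = y - L y)" for k g L L'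
  have "\<exists>g L L'. good k g L L'" if k: "k \<in> J" for k
  proof -
    obtain C c where "S.elliptic k C c" using ell[OF k] by blast
    then show ?thesis by (rule S.green_operator) (unfold good_def, blast)
  qed
  then obtain g L L' where good: "\<And>k. k \<in> J \<Longrightarrow> good k (g k) (L k) (L' k)" by metis
  have lap: "dJ.diag g y k \<in> S.laplace_dom k" if "y \<in> mcarrier EJ" "k \<in> J" for y k
    using good[OF that(2)] that by (simp add: good_def dJ.diag_def dsum_carrier)
  have adj: "adjoints EJ EJ (dJ.diag g) (dJ.diag g)"
    using good by (intro dJ.adjoints_diag) (simp add: good_def)
  note sq = dirac_square[OF adjoints_mem[OF adj] lap]
  show thesis
  proof (rule that[OF adj])
    show "adjoints EJ EJ (dJ.diag L) (dJ.diag L')"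
      using good by (intro dJ.adjoints_diag) (simp add: good_def)
    show "compact_op EJ EJ (dJ.diag L)" "compact_op EJ EJ (dJ.diag L')"
      using good by (auto intro!: dJ.compact_op_diag simp: good_def)
    fix y assume y: "y \<in> mcarrier EJ"
    show "dJ.diag g y \<in> opdom D \<and> app D (dJ.diag g y) \<in> opdom D'" using sq(1,2)[OF y y] by blast
    show "app D' (app D (dJ.diag g y)) = y - dJ.diag L y"
    proof
      fix k
      show "app D' (app D (dJ.diag g y)) k = (y - dJ.diag L y) k"
        using sq(3)[OF y y, of k] good[of k] y by (auto simp: good_def dJ.diag_def dsum_carrier)
    qed
  qed
qed

lemma dirac_fredholm_iff_elliptic:
  "fredholm_op EJ EJ' D \<longleftrightarrow> (\<forall>k\<in>J \<union> J'. \<exists>C c. S.elliptic k C c)"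
proof
  interpret sw: dirac_complex E t u J' J by (rule swap)
  {
    assume "fredholm_op EJ EJ' D"
    then obtain Pl Pr Cl Cr where P: "adjointable EJ' EJ Pl" "adjointable EJ' EJ Pr"
      "compact_op EJ EJ Cl" "compact_op EJ' EJ' Cr" "\<And>x. x \<in> opdom D \<Longrightarrow> Pl (app D x) = x - Cl x"
      "\<And>y. y \<in> mcarrier EJ' \<Longrightarrow> Pr y \<in> opdom D \<and> app D (Pr y) = y - Cr y"
      unfolding fredholm_op_def by blast
    show "\<forall>k\<in>J \<union> J'. \<exists>C c. S.elliptic k C c"
    proof
      fix k assume "k \<in> J \<union> J'"
      then consider "k \<in> J" | "k \<in> J'" by blast
      then show "\<exists>C c. S.elliptic k C c"
      proof cases
        case 1
        from elliptic_of_left_parametrix[OF 1 P(1,3,5)] show ?thesis by metis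
      next
        case 2
        from sw.elliptic_of_right_parametrix[OF 2 P(2,4,6)] show ?thesis by metis
      qed
    qed
  }
  assume ell: "\<forall>k\<in>J \<union> J'. \<exists>C c. S.elliptic k C c"
  interpret DD: adjoint_pair EJ EJ' D D' by (rule dirac_adjoint_pair)
  interpret DD': adjoint_pair EJ' EJ D' D by (rule DD.swap)
  obtain gr K K' where G: "adjoints EJ EJ gr gr" "adjoints EJ EJ K K'" "compact_op EJ EJ K'"
    "\<And>y. y \<in> mcarrier EJ \<Longrightarrow> gr y \<in> opdom D \<and> app D (gr y) \<in> opdom D'"
    "\<And>y. y \<in> mcarrier EJ \<Longrightarrow> app D' (app D (gr y)) = y - K y"
    using dirac_green ell by (metis UnI1)
  obtain A where A: "adjoints EJ EJ' (\<lambda>y. app D (gr y)) A" "\<And>x. x \<in> opdom D \<Longrightarrow> A (app D x) = x - K' x"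
    using DD.parametrix_of_green[OF G(1,2,4,5)] by blast
  obtain gr' L L' where G': "adjoints EJ' EJ' gr' gr'" "adjoints EJ' EJ' L L'" "compact_op EJ' EJ' L"
    "\<And>y. y \<in> mcarrier EJ' \<Longrightarrow> gr' y \<in> opdom D' \<and> app D' (gr' y) \<in> opdom D"
    "\<And>y. y \<in> mcarrier EJ' \<Longrightarrow> app D (app D' (gr' y)) = y - L y"
    using sw.dirac_green ell by (metis UnI2)
  obtain B where B: "adjoints EJ' EJ (\<lambda>y. app D' (gr' y)) B"
    using DD'.parametrix_of_green[OF G'(1,2,4,5)] by blast
  have "adjointable EJ' EJ A" using DD.adjoints_sym[OF A(1)] adjointable_iff_adjoints by blast
  moreover have "adjointable EJ' EJ (\<lambda>y. app D' (gr' y))" using B adjointable_iff_adjoints by blast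
  ultimately show "fredholm_op EJ EJ' D"
    unfolding fredholm_op_def using DD.regular_t G(3) A(2) G'(3,4,5) by blast
qed

end

section \<open>Joint parametrices\<close>

text \<open>
  By \<open>dirac_fredholm_iff_elliptic\<close> it remains to compare joint parametrices with elliptic estimates in the degrees
  from \<open>0\<close> to \<open>N + 1\<close>.
\<close>

theorem theorem1p11:
  fixes N :: nat
    and E :: "int \<Rightarrow> ('a::cstar_algebra, 'e::complex_vector) hmodule"
    and t :: "int \<Rightarrow> ('e, 'e) unbounded_op"
  assumes "finite_length_complex N E t"
  shows "fredholm_complex N E t \<longleftrightarrow>
    fredholm_op (even_part N E) (odd_part N E) (even_dirac N E t)"
proof -
  define u where "u k = adjoint_op (E k) (E (k + 1)) (t k)" for k
  have hm: "hilbert_module (E k)" and reg: "regular (E k) (E (k + 1)) (t k)"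
    and exact: "x \<in> opdom (t k) \<Longrightarrow> app (t k) x \<in> opdom (t (k + 1)) \<and> app (t (k + 1)) (app (t k) x) = 0"
    and trivial: "k \<notin> {0..int N + 1} \<Longrightarrow> mcarrier (E k) = {0}" for k x
    using assms by (auto simp: finite_length_complex_def hilbert_complex_def)
  have pair: "adjoint_pair (E k) (E (k + 1)) (t k) (u k)" for k
  proof -
    interpret hilbert_module_pair "E k" "E (k + 1)" by (simp add: hilbert_module_pair_def hm)
    show ?thesis unfolding u_def by (rule regular_imp_adjoint_pair[OF reg])
  qed
  interpret graded_complex E t u
  proof (rule graded_complex.intro)
    fix k
    interpret L: adjoint_pair "E (k - 1)" "E k" "t (k - 1)" "u (k - 1)" using pair[of "k - 1"] by simp
    interpret R: adjoint_pair "E k" "E (k + 1)" "t k" "u k" by (rule pair)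
    show "two_step (E (k - 1)) (E k) (E (k + 1)) (t (k - 1)) (u (k - 1)) (t k) (u k)"
      by unfold_locales (use exact[of _ "k - 1"] in simp)
  qed
  interpret dirac_complex E t u "ev_degrees N" "odd_degrees N"
  proof
    show "finite (ev_degrees N)" "finite (odd_degrees N)"
      unfolding ev_degrees_def odd_degrees_def by (rule finite_subset[of _ "{0..int N + 1}"]; auto)+
    show "mcarrier (E j) = {0}" if "k \<in> ev_degrees N" "j = k + 1 \<or> j = k - 1" "j \<notin> odd_degrees N" for k j
      using that by (intro trivial) (auto simp: ev_degrees_def odd_degrees_def)
    show "mcarrier (E j) = {0}" if "k \<in> odd_degrees N" "j = k + 1 \<or> j = k - 1" "j \<notin> ev_degrees N" for k j
      using that by (intro trivial) (auto simp: ev_degrees_def odd_degrees_def)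
  qed
  have dirac_eq: "even_dirac N E t = dirac (ev_degrees N) (odd_degrees N)"
    unfolding even_dirac_def dirac_def even_part_def u_def by simp
  have degrees: "ev_degrees N \<union> odd_degrees N = {0..int N + 1}"
    by (auto simp: ev_degrees_def odd_degrees_def)
  have "fredholm_complex N E t \<longleftrightarrow> (\<forall>k\<in>{0..int N + 1}. \<exists>C c. S.elliptic k C c)"
  proof
    assume "fredholm_complex N E t"
    then obtain Pl Pr where jp: "joint_parametrix N E t Pl Pr" by (auto simp: fredholm_complex_def)
    note jp = jp[unfolded joint_parametrix_def]
    have P: "adjointable (E (k + 1)) (E k) (Pl k)" "adjointable (E (k + 1)) (E k) (Pr k)"
      if "k \<in> {0..int N}" for k
      using jp[THEN conjunct1] that by auto
    have P0: "Pl k x = 0" "Pr k x = 0" if "k \<notin> {0..int N}" "x \<in> mcarrier (E (k + 1))" for k x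
      using jp[THEN conjunct2, THEN conjunct1] that by blast+
    obtain C where C: "\<forall>k\<in>{0..int N + 1}. compact_op (E k) (E k) (C k) \<and>
        (\<forall>x\<in>opdom (t k). Pr (k - 1) x \<in> opdom (t (k - 1)) \<and>
          Pl k (app (t k) x) + app (t (k - 1)) (Pr (k - 1) x) = x - C k x)"
      using jp[THEN conjunct2, THEN conjunct2] by (elim exE)
    have bounded: "\<exists>c\<ge>0. \<forall>y\<in>mcarrier (E (k + 1)). Q y \<in> mcarrier (E k) \<and> mnorm (E k) (Q y) \<le> c * mnorm (E (k + 1)) y"
      if Q: "k \<in> {0..int N} \<and> adjointable (E (k + 1)) (E k) Q \<or> (\<forall>y\<in>mcarrier (E (k + 1)). Q y = 0)" for k Q
    proof (cases "\<forall>y\<in>mcarrier (E (k + 1)). Q y = 0")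
      case True
      then show ?thesis
        using hilbert_module.zero_mem[OF hm] hilbert_module.mnorm_zero[OF hm] by (intro exI[of _ 0]) simp
    next
      case False
      then have Q: "adjointable (E (k + 1)) (E k) Q" using Q by blast
      obtain c where "c \<ge> 0" "\<And>x. x \<in> mcarrier (E (k + 1)) \<Longrightarrow> mnorm (E k) (Q x) \<le> c * mnorm (E (k + 1)) x"
        using adjointable_bounded[OF hm hm Q] by blast
      then show ?thesis using Q by (intro exI[of _ c]) (auto simp: adjointable_def)
    qed
    show "\<forall>k\<in>{0..int N + 1}. \<exists>C c. S.elliptic k C c"
    proof
      fix k assume k: "k \<in> {0..int N + 1}"
      obtain l where l: "0 \<le> l" "\<And>y. y \<in> mcarrier (E (k + 1)) \<Longrightarrow>
          Pl k y \<in> mcarrier (E k) \<and> mnorm (E k) (Pl k y) \<le> l * mnorm (E (k + 1)) y"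
        using bounded[of k "Pl k"] P[of k] P0[of k] by blast
      obtain r where r: "0 \<le> r" "\<And>y. y \<in> mcarrier (E k) \<Longrightarrow>
          Pr (k - 1) y \<in> mcarrier (E (k - 1)) \<and> mnorm (E (k - 1)) (Pr (k - 1) y) \<le> r * mnorm (E k) y"
      proof -
        have "\<exists>c\<ge>0. \<forall>y\<in>mcarrier (E (k - 1 + 1)). Pr (k - 1) y \<in> mcarrier (E (k - 1)) \<and>
            mnorm (E (k - 1)) (Pr (k - 1) y) \<le> c * mnorm (E (k - 1 + 1)) y"
          using bounded[of "k - 1" "Pr (k - 1)"] P(2)[of "k - 1"] P0(2)[of "k - 1"] by blast
        then show thesis using that by auto
      qed
      have "S.elliptic k (C k) (max l r)"
        using bspec[OF C k] by (intro S.elliptic_of_parametrix[OF _ l r]) auto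
      then show "\<exists>C c. S.elliptic k C c" by blast
    qed
  next
    assume ell: "\<forall>k\<in>{0..int N + 1}. \<exists>C c. S.elliptic k C c"
    define good where "good k Pl Pr K \<longleftrightarrow> adjointable (E (k + 1)) (E k) Pl \<and> adjointable (E k) (E (k - 1)) Pr \<and>
      compact_op (E k) (E k) K \<and>
      (\<forall>x\<in>opdom (t k). Pr x \<in> opdom (t (k - 1)) \<and> Pl (app (t k) x) + app (t (k - 1)) (Pr x) = x - K x)"
      for k Pl Pr K
    have "\<exists>Pl Pr K. good k Pl Pr K" if "k \<in> {0..int N + 1}" for k
    proof -
      obtain C c where "S.elliptic k C c" using ell \<open>k \<in> {0..int N + 1}\<close> by blast
      then show ?thesis by (rule S.parametrix_of_elliptic) (unfold good_def, blast)
    qed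
    then obtain Pl Pr K where good: "\<And>k. k \<in> {0..int N + 1} \<Longrightarrow> good k (Pl k) (Pr k) (K k)" by metis
    define Pl' where "Pl' k = (if k \<in> {0..int N} then Pl k else (\<lambda>x. 0))" for k
    define Pr' where "Pr' k = (if k \<in> {0..int N} then Pr (k + 1) else (\<lambda>x. 0))" for k
    have "joint_parametrix N E t Pl' Pr'"
      unfolding joint_parametrix_def
    proof (intro conjI ballI exI[of _ K] allI impI)
      fix k assume k: "k \<in> {0..int N}"
      show "adjointable (E (k + 1)) (E k) (Pl' k)" using good[of k] k by (simp add: Pl'_def good_def)
      show "adjointable (E (k + 1)) (E k) (Pr' k)" using good[of "k + 1"] k by (simp add: Pr'_def good_def)
    next
      fix k x assume "k \<notin> {0..int N}"
      then show "Pl' k x = 0" "Pr' k x = 0" by (auto simp: Pl'_def Pr'_def)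
    next
      fix k assume k: "k \<in> {0..int N + 1}"
      note g = good[OF k, unfolded good_def]
      show "compact_op (E k) (E k) (K k)" using g by simp
      fix x assume x: "x \<in> opdom (t k)"
      \<comment> \<open>The operators that were set to zero have a zero module as source or target.\<close>
      have r: "Pr' (k - 1) x = Pr k x"
      proof (cases "k = 0")
        case True
        have "Pr k x \<in> mcarrier (E (k - 1))" using g t_mem(1)[OF x] by (auto simp: adjointable_def)
        then show ?thesis using trivial[of "k - 1"] True by (simp add: Pr'_def)
      qed (use k in \<open>simp add: Pr'_def\<close>)
      have l: "Pl' k (app (t k) x) = Pl k (app (t k) x)"
      proof (cases "k = int N + 1")
        case True
        have "app (t k) x = 0" using t_mem(2)[OF x] trivial[of "k + 1"] True by simp
        moreover have "Pl k 0 = 0"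
          using g S.R.FE.adjoints_zero[of k "Pl k"] by (auto simp: adjointable_iff_adjoints)
        ultimately show ?thesis using True by (simp add: Pl'_def)
      qed (use k in \<open>simp add: Pl'_def\<close>)
      show "Pr' (k - 1) x \<in> opdom (t (k - 1))"
        "Pl' k (app (t k) x) + app (t (k - 1)) (Pr' (k - 1) x) = x - K k x"
        using g x r l by simp_all
    qed
    then show "fredholm_complex N E t" unfolding fredholm_complex_def by blast
  qed
  also have "\<dots> \<longleftrightarrow> fredholm_op (even_part N E) (odd_part N E) (even_dirac N E t)"
    unfolding even_part_def odd_part_def dirac_eq dirac_fredholm_iff_elliptic degrees ..
  finally show ?thesis .
qed

end
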